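(* Let $X$ be a metric space with bounded geometry. Then the following properties are equivalent: (1) for every sparse subspace $X'\subseteq X$, the Roe algebra $C^*(X')$ contains no block-rank-one ghost projections; (2) for every sparse subspace $X'\subseteq X$, the uniform Roe algebra $C^*_u(X')$ contains no block-rank-one ghost projections; (3) $X$ contains no sparse subspaces consisting of ghostly measured asymptotic expanders; (4) there is no sparse space $Z$ with bounded geometry that consists of ghostly measured asymptotic expanders and admits a coarse embedding into $X$. Moreover, these properties are coarse properties, i.e. they are invariant under coarse equivalence among metric spaces with bounded geometry.
   Context: All metric spaces are non-empty and discrete. $(X,d)$ has bounded geometry if $\sup_{x\in X}|B(x,R)|<\infty$ for each $R>0$ (closed balls). A map $f:Z\to X$ is a coarse embedding if there are non-decreasing unbounded $\rho_\pm:[0,\infty)\to[0,\infty)$ with $\rho_-(d_Z(x,y))\le d_X(f(x),f(y))\le\rho_+(d_Z(x,y))$ for all $x,y$; it is a coarse equivalence if in addition every point of $X$ is within distance $C$ of $f(Z)$ for some constant $C>0$. Sparse: $(X,d)$ is sparse if there is a partition $X=\bigsqcup_{n\in\mathbb N}X_n$ with $0<|X_n|<\infty$ and $d(X_n,X_m)\to\infty$ as $n+m\to\infty$, $n\ne m$. Measured asymptotic expanders: finite probability-measured metric spaces $\{(X_n,d_n,m_n)\}_n$ such that for every $\alpha\in(0,\frac12]$ there exist $c_\alpha\in(0,1)$, $R_\alpha>0$ such that for every $n$ and $A\subseteq X_n$ with $\alpha\le m_n(A)\le\frac12$ one has $m_n(\partial_{R_\alpha}A)>c_\alpha m_n(A)$,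 where $\partial_RA=\{x\in X_n\setminus A:d_n(x,A)\le R\}$. A sparse space $X$ consists of ghostly measured asymptotic expanders if there exist a decomposition $X=\bigsqcup_nX_n$ as in the definition of sparse and probability measures $m_n$ on $X_n$ with $\lim_n\sup_{x\in X_n}m_n(x)=0$ such that $\{(X_n,d|_{X_n},m_n)\}_n$ is a sequence of measured asymptotic expanders. Block-rank-one ghost projections: let $X'$ be sparse and $H_0$ a Hilbert space. A block-rank-one projection on $X'$ is a projection of the form $P=\bigoplus_nP_n\in\mathfrak B(\bigoplus_n\ell^2(X_n;H_0))=\mathfrak B(\ell^2(X';H_0))$ for some decomposition $X'=\bigsqcup_nX_n$ as in the definition of sparse, each $P_n$ being a rank-one projection $P_n\eta=\langle\eta,\xi_n\rangle\xi_n$ with $\xi_n\in\ell^2(X_n;H_0)$ a unit vector. Its associated probability measures are $m_n(x)=\|\xi_n(x)\|^2$, and it is a ghost if $\lim_n\sup_{x\in X_n}m_n(x)=0$. Roe algebras: write $T\in\mathfrak B(\ell^2(X;H_0))$ as a matrix $(T_{x,y})$ with entries in $\mathfrak B(H_0)$; $T$ has finite propagation if $\sup\{d(x,y):T_{x,y}\ne0\}<\infty$ and is locally compact if all $T_{x,y}$ are compact. $C^*_u(X)$ is the norm closure of finite propagation operators in $\mathfrak B(\ell^2(X))$ (so $H_0=\mathbb C$); $C^*(X)$ is the norm closure of finite propagation locally compact operators in $\mathfrak B(\ell^2(X;H_0))$ with $H_0$ a fixed infinite-dimensional separable Hilbert space. *)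

theory Defs
  imports "HOL-Probability.Probability"
begin

definition discrete_space :: "'a metric \<Rightarrow> bool" where
  "discrete_space X \<longleftrightarrow> mspace X \<noteq> {} \<and> mtopology_of X = discrete_topology (mspace X)"

definition bounded_geometry :: "'a metric \<Rightarrow> bool" where
  "bounded_geometry X \<longleftrightarrow>
     (\<forall>R>0. \<exists>N. \<forall>x\<in>mspace X. finite (mcball_of X x R) \<and> card (mcball_of X x R) \<le> N)"

definition control_function :: "(real \<Rightarrow> real) \<Rightarrow> bool" where
  "control_function \<rho> \<longleftrightarrow> \<rho> \<in> {0..} \<rightarrow> {0..} \<and> mono_on {0..} \<rho> \<and> \<not> bdd_above (\<rho> ` {0..})"

definition coarse_embedding :: "'a metric \<Rightarrow> 'b metric \<Rightarrow> ('a \<Rightarrow> 'b) \<Rightarrow> bool" where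
  "coarse_embedding Z X f \<longleftrightarrow>
     f \<in> mspace Z \<rightarrow> mspace X \<and>
     (\<exists>\<rho>\<^sub>1 \<rho>\<^sub>2. control_function \<rho>\<^sub>1 \<and> control_function \<rho>\<^sub>2 \<and>
        (\<forall>x\<in>mspace Z. \<forall>y\<in>mspace Z.
           \<rho>\<^sub>1 (mdist Z x y) \<le> mdist X (f x) (f y) \<and>
           mdist X (f x) (f y) \<le> \<rho>\<^sub>2 (mdist Z x y)))"

definition coarse_equivalence :: "'a metric \<Rightarrow> 'b metric \<Rightarrow> ('a \<Rightarrow> 'b) \<Rightarrow> bool" where
  "coarse_equivalence Z X f \<longleftrightarrow>
     coarse_embedding Z X f \<and>
     (\<exists>C>0. \<forall>x\<in>mspace X. \<exists>z\<in>mspace Z. mdist X x (f z) \<le> C)"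

definition set_mdist :: "'a metric \<Rightarrow> 'a set \<Rightarrow> 'a set \<Rightarrow> real" where
  "set_mdist X A B = (INF (a, b)\<in>A \<times> B. mdist X a b)"

text \<open>The blocks are indexed by all natural numbers and are non-empty, so a sparse space is infinite.\<close>

definition sparse_decomposition :: "'a metric \<Rightarrow> (nat \<Rightarrow> 'a set) \<Rightarrow> bool" where
  "sparse_decomposition X B \<longleftrightarrow>
     (\<Union>n. B n) = mspace X \<and> disjoint_family B \<and> (\<forall>n. finite (B n) \<and> B n \<noteq> {}) \<and>
     (\<forall>R. \<exists>N. \<forall>n m. n \<noteq> m \<and> N \<le> n + m \<longrightarrow> R \<le> set_mdist X (B n) (B m))"

definition sparse_space :: "'a metric \<Rightarrow> bool" where
  "sparse_space X \<longleftrightarrow> (\<exists>B. sparse_decomposition X B)"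

definition outer_boundary :: "'a metric \<Rightarrow> real \<Rightarrow> 'a set \<Rightarrow> 'a set" where
  "outer_boundary X R A = {x \<in> mspace X - A. set_mdist X {x} A \<le> R}"

definition measured_asymptotic_expanders :: "(nat \<Rightarrow> 'a metric) \<Rightarrow> (nat \<Rightarrow> 'a pmf) \<Rightarrow> bool" where
  "measured_asymptotic_expanders X m \<longleftrightarrow>
     (\<forall>n. finite (mspace (X n)) \<and> set_pmf (m n) \<subseteq> mspace (X n)) \<and>
     (\<forall>\<alpha>. 0 < \<alpha> \<and> \<alpha> \<le> 1/2 \<longrightarrow>
        (\<exists>c R. 0 < c \<and> c < 1 \<and> 0 < R \<and>
          (\<forall>n. \<forall>A \<subseteq> mspace (X n).
             \<alpha> \<le> measure_pmf.prob (m n) A \<and> measure_pmf.prob (m n) A \<le> 1/2 \<longrightarrow>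
             measure_pmf.prob (m n) (outer_boundary (X n) R A) > c * measure_pmf.prob (m n) A)))"

definition ghostly_measured_asymptotic_expanders :: "'a metric \<Rightarrow> bool" where
  "ghostly_measured_asymptotic_expanders X \<longleftrightarrow>
     (\<exists>B m. sparse_decomposition X B \<and>
        (\<forall>n. set_pmf (m n) \<subseteq> B n) \<and>
        (\<lambda>n. SUP x\<in>B n. pmf (m n) x) \<longlonglongrightarrow> 0 \<and>
        measured_asymptotic_expanders (\<lambda>n. submetric X (B n)) m)"

text \<open>The inner product is linear in its first argument.\<close>

class complex_hilbert = banach +
  fixes cscale :: "complex \<Rightarrow> 'a \<Rightarrow> 'a" (infixr \<open>*\<^sub>C\<close> 75)
    and cinner :: "'a \<Rightarrow> 'a \<Rightarrow> complex"
  assumes cscale_add_right: "a *\<^sub>C (x + y) = a *\<^sub>C x + a *\<^sub>C y"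
    and cscale_add_left: "(a + b) *\<^sub>C x = a *\<^sub>C x + b *\<^sub>C x"
    and cscale_cscale: "a *\<^sub>C (b *\<^sub>C x) = (a * b) *\<^sub>C x"
    and cscale_of_real: "complex_of_real r *\<^sub>C x = r *\<^sub>R x"
    and cinner_add_left: "cinner (x + y) z = cinner x z + cinner y z"
    and cinner_cscale_left: "cinner (a *\<^sub>C x) y = a * cinner x y"
    and cinner_commute: "cinner x y = cnj (cinner y x)"
    and cinner_self: "cinner x x = complex_of_real ((norm x)\<^sup>2)"

global_interpretation complex_hilbert: vector_space "cscale :: complex \<Rightarrow> 'a \<Rightarrow> 'a::complex_hilbert"
proof
  show "(1::complex) *\<^sub>C x = x" for x :: 'a
    using cscale_of_real[of 1 x] by simp
qed (simp_all add: cscale_add_right cscale_add_left cscale_cscale)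

instantiation complex :: complex_hilbert
begin

definition cscale_complex :: "complex \<Rightarrow> complex \<Rightarrow> complex" where
  "cscale_complex a x = a * x"

definition cinner_complex :: "complex \<Rightarrow> complex \<Rightarrow> complex" where
  "cinner_complex x y = x * cnj y"

instance
proof
  fix x :: complex
  show "cinner x x = complex_of_real ((norm x)\<^sup>2)"
    by (simp only: cinner_complex_def complex_norm_square)
qed (simp_all add: cscale_complex_def cinner_complex_def algebra_simps scaleR_conv_of_real)

end

definition separable_hilbert :: "'h::complex_hilbert itself \<Rightarrow> bool" where
  "separable_hilbert _ \<longleftrightarrow> separable_space (euclidean :: 'h topology)"

definition infinite_dim_hilbert :: "'h::complex_hilbert itself \<Rightarrow> bool" where
  "infinite_dim_hilbert _ \<longleftrightarrow> \<not> (\<exists>B::'h set. finite B \<and> complex_hilbert.span B = UNIV)"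

text \<open>
  For \<open>S :: 'a set\<close> the Hilbert space of square-summable functions from \<open>S\<close> to \<open>'h\<close> is
  represented by the functions on the whole type \<open>'a\<close> that vanish outside \<open>S\<close>. An operator on
  it is a function on \<open>'a \<Rightarrow> 'h\<close> of which only the values on \<open>l2 S\<close> matter; all notions below
  depend only on these values.
\<close>

definition l2 :: "'a set \<Rightarrow> ('a \<Rightarrow> 'h::complex_hilbert) set" where
  "l2 S = {\<eta>. (\<forall>x. x \<notin> S \<longrightarrow> \<eta> x = 0) \<and> (\<lambda>x. (norm (\<eta> x))\<^sup>2) summable_on S}"

definition l2_norm :: "'a set \<Rightarrow> ('a \<Rightarrow> 'h::complex_hilbert) \<Rightarrow> real" where
  "l2_norm S \<eta> = sqrt (\<Sum>\<^sub>\<infinity>x\<in>S. (norm (\<eta> x))\<^sup>2)"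

definition l2_inner :: "'a set \<Rightarrow> ('a \<Rightarrow> 'h::complex_hilbert) \<Rightarrow> ('a \<Rightarrow> 'h) \<Rightarrow> complex" where
  "l2_inner S \<eta> \<zeta> = (\<Sum>\<^sub>\<infinity>x\<in>S. cinner (\<eta> x) (\<zeta> x))"

definition bounded_operators ::
    "'a set \<Rightarrow> (('a \<Rightarrow> 'h::complex_hilbert) \<Rightarrow> ('a \<Rightarrow> 'h)) set" where
  "bounded_operators S = {T. T \<in> l2 S \<rightarrow> l2 S \<and>
     (\<forall>\<eta>\<in>l2 S. \<forall>\<zeta>\<in>l2 S. T (\<lambda>x. \<eta> x + \<zeta> x) = (\<lambda>x. T \<eta> x + T \<zeta> x)) \<and>
     (\<forall>a. \<forall>\<eta>\<in>l2 S. T (\<lambda>x. a *\<^sub>C \<eta> x) = (\<lambda>x. a *\<^sub>C T \<eta> x)) \<and>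
     (\<exists>K. \<forall>\<eta>\<in>l2 S. l2_norm S (T \<eta>) \<le> K * l2_norm S \<eta>)}"

definition l2_op_norm ::
    "'a set \<Rightarrow> (('a \<Rightarrow> 'h::complex_hilbert) \<Rightarrow> ('a \<Rightarrow> 'h)) \<Rightarrow> real" where
  "l2_op_norm S T = (SUP \<eta>\<in>{\<eta> \<in> l2 S. l2_norm S \<eta> \<le> 1}. l2_norm S (T \<eta>))"

definition operator_norm_closure ::
    "'a set \<Rightarrow> (('a \<Rightarrow> 'h::complex_hilbert) \<Rightarrow> ('a \<Rightarrow> 'h)) set \<Rightarrow> (('a \<Rightarrow> 'h) \<Rightarrow> ('a \<Rightarrow> 'h)) set" where
  "operator_norm_closure S \<A> =
     {T \<in> bounded_operators S. \<forall>\<epsilon>>0. \<exists>T'\<in>\<A>. l2_op_norm S (\<lambda>\<eta> x. T \<eta> x - T' \<eta> x) < \<epsilon>}"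

definition matrix_entry ::
    "(('a \<Rightarrow> 'h::complex_hilbert) \<Rightarrow> ('a \<Rightarrow> 'h)) \<Rightarrow> 'a \<Rightarrow> 'a \<Rightarrow> 'h \<Rightarrow> 'h" where
  "matrix_entry T x y = (\<lambda>h. T (\<lambda>z. if z = y then h else 0) x)"

definition compact_operator :: "('h::complex_hilbert \<Rightarrow> 'h) \<Rightarrow> bool" where
  "compact_operator K \<longleftrightarrow> compact (closure (K ` cball 0 1))"

definition finite_propagation ::
    "'a metric \<Rightarrow> (('a \<Rightarrow> 'h::complex_hilbert) \<Rightarrow> ('a \<Rightarrow> 'h)) \<Rightarrow> bool" where
  "finite_propagation X T \<longleftrightarrow>
     bdd_above {mdist X x y | x y. x \<in> mspace X \<and> y \<in> mspace X \<and> matrix_entry T x y \<noteq> (\<lambda>h. 0)}"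

definition locally_compact_operator ::
    "'a metric \<Rightarrow> (('a \<Rightarrow> 'h::complex_hilbert) \<Rightarrow> ('a \<Rightarrow> 'h)) \<Rightarrow> bool" where
  "locally_compact_operator X T \<longleftrightarrow>
     (\<forall>x\<in>mspace X. \<forall>y\<in>mspace X. compact_operator (matrix_entry T x y))"

definition roe_algebra :: "'a metric \<Rightarrow> (('a \<Rightarrow> 'h::complex_hilbert) \<Rightarrow> ('a \<Rightarrow> 'h)) set" where
  "roe_algebra X = operator_norm_closure (mspace X)
     {T \<in> bounded_operators (mspace X). finite_propagation X T \<and> locally_compact_operator X T}"

definition uniform_roe_algebra :: "'a metric \<Rightarrow> (('a \<Rightarrow> complex) \<Rightarrow> ('a \<Rightarrow> complex)) set" where
  "uniform_roe_algebra X = operator_norm_closure (mspace X)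
     {T \<in> bounded_operators (mspace X). finite_propagation X T}"

definition restrict_to :: "'a set \<Rightarrow> ('a \<Rightarrow> 'h::complex_hilbert) \<Rightarrow> ('a \<Rightarrow> 'h)" where
  "restrict_to S \<eta> = (\<lambda>x. if x \<in> S then \<eta> x else 0)"

definition rank_one_projection ::
    "'a set \<Rightarrow> ('a \<Rightarrow> 'h::complex_hilbert) \<Rightarrow> ('a \<Rightarrow> 'h) \<Rightarrow> ('a \<Rightarrow> 'h)" where
  "rank_one_projection S \<xi> \<eta> = (\<lambda>x. l2_inner S \<eta> \<xi> *\<^sub>C \<xi> x)"

text \<open>\<open>is_direct_sum S B P Q\<close>: on \<open>l2 S\<close>, the operator \<open>P\<close> is the orthogonal direct sum of the
  operators \<open>Q n\<close> on \<open>l2 (B n)\<close>, where \<open>S\<close> is the disjoint union of the sets \<open>B n\<close>.\<close>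

definition is_direct_sum ::
    "'a set \<Rightarrow> (nat \<Rightarrow> 'a set) \<Rightarrow> (('a \<Rightarrow> 'h::complex_hilbert) \<Rightarrow> ('a \<Rightarrow> 'h)) \<Rightarrow>
     (nat \<Rightarrow> ('a \<Rightarrow> 'h) \<Rightarrow> ('a \<Rightarrow> 'h)) \<Rightarrow> bool" where
  "is_direct_sum S B P Q \<longleftrightarrow>
     P \<in> bounded_operators S \<and>
     (\<forall>\<eta>\<in>l2 S. \<forall>n. restrict_to (B n) (P \<eta>) = Q n (restrict_to (B n) \<eta>))"

definition block_rank_one_projection ::
    "'a metric \<Rightarrow> (nat \<Rightarrow> 'a set) \<Rightarrow> (nat \<Rightarrow> 'a \<Rightarrow> 'h::complex_hilbert) \<Rightarrow>
     (('a \<Rightarrow> 'h) \<Rightarrow> ('a \<Rightarrow> 'h)) \<Rightarrow> bool" where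
  "block_rank_one_projection X B \<xi> P \<longleftrightarrow>
     sparse_decomposition X B \<and>
     (\<forall>n. \<xi> n \<in> l2 (B n) \<and> l2_norm (B n) (\<xi> n) = 1) \<and>
     is_direct_sum (mspace X) B P (\<lambda>n. rank_one_projection (B n) (\<xi> n))"

definition block_rank_one_ghost_projection ::
    "'a metric \<Rightarrow> (('a \<Rightarrow> 'h::complex_hilbert) \<Rightarrow> ('a \<Rightarrow> 'h)) \<Rightarrow> bool" where
  "block_rank_one_ghost_projection X P \<longleftrightarrow>
     (\<exists>B \<xi>. block_rank_one_projection X B \<xi> P \<and>
        (\<lambda>n. SUP x\<in>B n. (norm (\<xi> n x))\<^sup>2) \<longlonglongrightarrow> 0)"

definition roe_ghost_free :: "'h::complex_hilbert itself \<Rightarrow> 'a metric \<Rightarrow> bool" where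
  "roe_ghost_free _ X \<longleftrightarrow>
     (\<forall>S \<subseteq> mspace X. sparse_space (submetric X S) \<longrightarrow>
        \<not> (\<exists>P \<in> (roe_algebra (submetric X S) :: (('a \<Rightarrow> 'h) \<Rightarrow> ('a \<Rightarrow> 'h)) set).
             block_rank_one_ghost_projection (submetric X S) P))"

definition uniform_roe_ghost_free :: "'a metric \<Rightarrow> bool" where
  "uniform_roe_ghost_free X \<longleftrightarrow>
     (\<forall>S \<subseteq> mspace X. sparse_space (submetric X S) \<longrightarrow>
        \<not> (\<exists>P \<in> uniform_roe_algebra (submetric X S).
             block_rank_one_ghost_projection (submetric X S) P))"

definition no_expander_subspace :: "'a metric \<Rightarrow> bool" where
  "no_expander_subspace X \<longleftrightarrow>
     \<not> (\<exists>S \<subseteq> mspace X. sparse_space (submetric X S) \<and>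
          ghostly_measured_asymptotic_expanders (submetric X S))"

text \<open>The points of the spaces \<open>Z\<close> are taken from the type \<open>'z\<close>. As sparse spaces are countably
  infinite, every infinite type contains isometric copies of all of them, whereas for finite
  \<open>'z\<close> the condition would be void.\<close>

definition no_embedded_expanders :: "'z itself \<Rightarrow> 'a metric \<Rightarrow> bool" where
  "no_embedded_expanders _ X \<longleftrightarrow>
     \<not> (\<exists>(Z::'z metric) f. discrete_space Z \<and> sparse_space Z \<and> bounded_geometry Z \<and>
          ghostly_measured_asymptotic_expanders Z \<and> coarse_embedding Z X f)"

end

theory Submission
  imports Defs
begin

text \<open>
  Conditions (3) and (4) are compared by pushing measures forward: along a coarse embedding fibres
  have bounded cardinality and boundaries are mapped into boundaries, so ghostly expanders are
  mapped to ghostly expanders. This makes (4), hence everything equivalent to it, coarsely invariant.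

  A block-rank-one projection in either algebra is nearly of finite propagation, so that its
  corners between subsets of a block that are far apart are small. These corners have norm
  \<open>sqrt (m A * m D)\<close>, whence the expansion of \<open>m\<close>.

  Conversely, given ghostly measured asymptotic expanders, expansion at the single scale
  \<open>1/8\<close> suffices to find in every block a subset of mass at least \<open>3/4\<close> satisfying a uniform
  isoperimetric inequality for the conductances \<open>min (m x) (m y)\<close>. Bounded geometry bounds the
  weighted degrees, so the Cheeger inequality gives a uniform spectral gap, and the powers of the lazy random
  walk, which have finite propagation, converge in norm to a block-rank-one projection over the
  union of the subsets. Tensoring with a fixed rank-one projection places it in the Roe algebra.
\<close>

subsection \<open>Isoperimetry and the Cheeger inequality\<close>

text \<open>Two defects of the given measures shape the passage from expanders to projections.
  Expansion is known only for sets of mass bounded below, so tiny sets may fail to expand and a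
  whole block may have no spectral gap. Hence a part of each block is discarded and the projection
  lives over a smaller subspace, which is harmless because (1) and (2) range over all sparse
  subspaces. Moreover the masses of neighbouring points may differ wildly, while the walk has to be
  reversible with controlled degrees. Taking minima as conductances achieves this, but undervalues
  heavy boundary points attached to light points; if the cut is small, those light points carry
  little mass and can be removed first. The scale 1/8 leaves room for this removal: a set of mass at
  least 1/4 loses less than 1/16. All constants depend only on the expansion constant and on the
  cardinality of balls of one radius. Therefore one power of the walk approximates on all blocks
  simultaneously, and its propagation is finite. Normalising the restricted measure multiplies
  masses by at most 4/3, so ghostliness survives.\<close>

definition cut :: "('a \<Rightarrow> 'a \<Rightarrow> real) \<Rightarrow> 'a set \<Rightarrow> 'a set \<Rightarrow> real" where
  "cut a A B = (\<Sum>x\<in>A. \<Sum>y\<in>B. a x y)"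

text \<open>An edge at \<open>x\<close> has conductance at most \<open>\<mu> x\<close>, however
  heavy its other end is. So a point with at most \<open>N\<close> neighbours has weighted degree at
  most \<open>N * \<mu> x\<close>.\<close>

definition min_conductance :: "('a \<Rightarrow> real) \<Rightarrow> ('a \<Rightarrow> 'a \<Rightarrow> bool) \<Rightarrow> 'a \<Rightarrow> 'a \<Rightarrow> real" where
  "min_conductance \<mu> E x y = (if E x y then min (\<mu> x) (\<mu> y) else 0)"

text \<open>Each point of \<open>D\<close> is charged to a single edge into \<open>B\<close>.
  Different points use different edges, so no multiplicity enters.\<close>

lemma cut_ge_sum_left:
  assumes "finite A" "finite B" "D \<subseteq> A" "\<And>x y. x \<in> A \<Longrightarrow> y \<in> B \<Longrightarrow> 0 \<le> a x y"
    and "\<And>x. x \<in> D \<Longrightarrow> \<exists>y\<in>B. \<mu> x \<le> a x y"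
  shows "sum \<mu> D \<le> cut a A B"
proof -
  have "sum \<mu> D \<le> (\<Sum>x\<in>D. \<Sum>y\<in>B. a x y)"
  proof (rule sum_mono)
    fix x assume "x \<in> D"
    then obtain y where y: "y \<in> B" "\<mu> x \<le> a x y" using assms by blast
    have "a x y \<le> (\<Sum>y\<in>B. a x y)"
      using \<open>x \<in> D\<close> y assms by (intro member_le_sum) auto
    then show "\<mu> x \<le> (\<Sum>y\<in>B. a x y)" using y by linarith
  qed
  also have "\<dots> \<le> (\<Sum>x\<in>A. \<Sum>y\<in>B. a x y)"
    using assms by (intro sum_mono2) (auto intro!: sum_nonneg)
  finally show ?thesis by (simp add: cut_def)
qed

lemma cut_commute: "cut a A B = cut (\<lambda>x y. a y x) B A"
  unfolding cut_def by (rule sum.swap)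

text \<open>If the cut of \<open>A\<close> is small, then the points \<open>J\<close> of \<open>A\<close> that have a heavier neighbour outside
  have small mass, and so do the boundary points \<open>D\<close> that have a neighbour in \<open>A\<close> at least as
  heavy. But \<open>D \<union> J\<close> contains the boundary of \<open>A - J\<close>.\<close>

lemma min_conductance_cut_ge:
  fixes \<mu> :: "'a \<Rightarrow> real"
  assumes V: "finite V" "\<And>x. x \<in> V \<Longrightarrow> 0 \<le> \<mu> x"
    and c: "0 < c" "c < 1"
    and exp: "\<And>A. A \<subseteq> V \<Longrightarrow> 1/8 \<le> sum \<mu> A \<Longrightarrow> sum \<mu> A \<le> 1/2 \<Longrightarrow>
      c * sum \<mu> A < sum \<mu> {y \<in> V - A. \<exists>x\<in>A. E x y}"
    and sym: "\<And>x y. E x y \<Longrightarrow> E y x"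
    and A: "A \<subseteq> V" "1/4 \<le> sum \<mu> A" "sum \<mu> A \<le> 1/2"
  shows "c/16 \<le> cut (min_conductance \<mu> E) A (V - A)"
proof (rule ccontr)
  define w where "w = cut (min_conductance \<mu> E) A (V - A)"
  assume "\<not> ?thesis"
  then have w: "w < c/16" by (simp add: w_def)
  have finA: "finite A" using A V finite_subset by blast
  define D where "D = {y \<in> V - A. \<exists>x\<in>A. E x y \<and> \<mu> y \<le> \<mu> x}"
  define J where "J = {x \<in> A. \<exists>y\<in>V - A. E x y \<and> \<mu> x < \<mu> y}"
  have fin: "finite D" "finite J" using finA V by (auto simp: D_def J_def)
  have nonneg: "0 \<le> min_conductance \<mu> E x y" if "x \<in> V" "y \<in> V" for x y
    using that V by (simp add: min_conductance_def)
  have J: "sum \<mu> J \<le> w"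
    unfolding w_def
  proof (rule cut_ge_sum_left)
    fix x assume "x \<in> J"
    then obtain y where "y \<in> V - A" "E x y" "\<mu> x < \<mu> y" by (auto simp: J_def)
    then show "\<exists>y\<in>V - A. \<mu> x \<le> min_conductance \<mu> E x y"
      by (intro bexI[of _ y]) (auto simp: min_conductance_def)
  qed (use finA V A nonneg in \<open>auto simp: J_def\<close>)
  have D: "sum \<mu> D \<le> w"
    unfolding w_def cut_commute[of _ A]
  proof (rule cut_ge_sum_left)
    fix y assume "y \<in> D"
    then obtain x where "x \<in> A" "E x y" "\<mu> y \<le> \<mu> x" by (auto simp: D_def)
    then show "\<exists>x\<in>A. \<mu> y \<le> min_conductance \<mu> E x y"
      by (intro bexI[of _ x]) (auto simp: min_conductance_def)
  qed (use finA V A nonneg in \<open>auto simp: D_def\<close>)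
  define A' where "A' = A - J"
  have A': "sum \<mu> A' = sum \<mu> A - sum \<mu> J"
    unfolding A'_def using finA by (intro sum_diff) (auto simp: J_def)
  have J0: "0 \<le> sum \<mu> J" using V A by (intro sum_nonneg) (auto simp: J_def)
  \<comment> \<open>Since \<open>c < 1\<close>, the removed mass is below 1/16 and at least 3/16
    remains: expansion is needed at a scale below 1/4, and 1/8 will do.\<close>
  have lo: "1/8 \<le> sum \<mu> A'" using A' A J w c by linarith
  have up: "sum \<mu> A' \<le> 1/2" using A' A J0 by linarith
  have "A' \<subseteq> V" using A by (auto simp: A'_def)
  from exp[OF this lo up] have "c * sum \<mu> A' < sum \<mu> {y \<in> V - A'. \<exists>x\<in>A'. E x y}" .
  also have "\<dots> \<le> sum \<mu> (D \<union> J)"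
  proof (rule sum_mono2)
    \<comment> \<open>A point of \<open>A - J\<close> has no heavier neighbour outside
      \<open>A\<close>, so each such neighbour belongs to \<open>D\<close>; boundary points inside
      \<open>A\<close> were removed with \<open>J\<close>.\<close>
    show "{y \<in> V - A'. \<exists>x\<in>A'. E x y} \<subseteq> D \<union> J"
      unfolding A'_def D_def J_def using sym by force
  qed (use V A fin in \<open>auto simp: D_def J_def\<close>)
  also have "\<dots> \<le> sum \<mu> D + sum \<mu> J"
  proof -
    have "D \<inter> J = {}" by (auto simp: D_def J_def)
    then show ?thesis using fin by (simp add: sum.union_disjoint)
  qed
  finally have "c * sum \<mu> A' < 2 * w" using D J by linarith
  \<comment> \<open>Both \<open>D\<close> and \<open>J\<close> cost up to \<open>w\<close>, so
    \<open>w\<close> exceeds half of \<open>c/8\<close>; this is the origin of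
    \<open>c/16\<close>.\<close>
  moreover have "c * (1/8) \<le> c * sum \<mu> A'" using lo c by (intro mult_left_mono) auto
  ultimately show False using w by linarith
qed

text \<open>Removing from \<open>V\<close> a largest set \<open>F\<close> that violates the isoperimetric inequality leaves a set
  that satisfies it: a violating \<open>A\<close> in the remainder could be added to \<open>F\<close>.\<close>

lemma isoperimetric_subset_exists:
  fixes \<mu> :: "'a \<Rightarrow> real"
  assumes V: "finite V" "\<And>x. x \<in> V \<Longrightarrow> 0 \<le> \<mu> x" "sum \<mu> V = 1"
    and a: "\<And>x y. x \<in> V \<Longrightarrow> y \<in> V \<Longrightarrow> 0 \<le> a x y" "\<And>x y. a x y = a y x"
    and \<delta>: "0 < \<delta>"
    and cut: "\<And>A. A \<subseteq> V \<Longrightarrow> 1/4 \<le> sum \<mu> A \<Longrightarrow> sum \<mu> A \<le> 1/2 \<Longrightarrow> \<delta> \<le> cut a A (V - A)"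
  shows "\<exists>Y\<subseteq>V. 3/4 \<le> sum \<mu> Y \<and>
    (\<forall>A\<subseteq>Y. sum \<mu> A \<le> sum \<mu> Y / 2 \<longrightarrow> \<delta> * sum \<mu> A \<le> cut a A (Y - A))"
proof -
  \<comment> \<open>The inequality is not strict, so the empty set belongs to the family and a
    largest member exists.\<close>
  define \<F> where "\<F> = {F. F \<subseteq> V \<and> sum \<mu> F \<le> 1/2 \<and> cut a F (V - F) \<le> \<delta> * sum \<mu> F}"
  have "finite \<F>" unfolding \<F>_def using V by (auto intro: finite_subset[of _ "Pow V"])
  moreover have "{} \<in> \<F>" by (simp add: \<F>_def cut_def)
  ultimately obtain F where F: "F \<in> \<F>" "\<And>G. G \<in> \<F> \<Longrightarrow> card G \<le> card F"
    using obtains_MAX[of \<F> card] by (metis Max_ge empty_iff finite_imageI image_eqI)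
  have FV: "F \<subseteq> V" "finite F" using F V by (auto simp: \<F>_def intro: finite_subset)
  \<comment> \<open>Between masses 1/4 and 1/2 the hypothesis demands a cut of at least
    \<open>\<delta>\<close>, while membership in the family allows at most
    \<open>\<delta> / 2\<close>.\<close>
  have small: "sum \<mu> F < 1/4"
  proof (rule ccontr)
    assume *: "\<not> ?thesis"
    have "\<delta> \<le> cut a F (V - F)" using * F by (intro cut) (auto simp: \<F>_def)
    also have "\<dots> \<le> \<delta> * sum \<mu> F" using F by (auto simp: \<F>_def)
    also have "\<dots> \<le> \<delta> * (1/2)" using F \<delta> by (intro mult_left_mono) (auto simp: \<F>_def)
    finally show False using \<delta> by simp
  qed
  have Y: "sum \<mu> (V - F) = 1 - sum \<mu> F" using FV V by (simp add: sum_diff)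
  have main: "\<delta> * sum \<mu> A \<le> cut a A (V - F - A)"
    if A: "A \<subseteq> V - F" "sum \<mu> A \<le> sum \<mu> (V - F) / 2" for A
  proof (rule ccontr)
    assume "\<not> ?thesis"
    then have bad: "cut a A (V - F - A) < \<delta> * sum \<mu> A" by simp
    have finA: "finite A" using A V by (meson finite_Diff finite_subset)
    have A0: "A \<noteq> {}" using bad by (auto simp: cut_def)
    have FA: "sum \<mu> (F \<union> A) = sum \<mu> F + sum \<mu> A"
      using A FV finA by (intro sum.union_disjoint) auto
    have FA1: "sum \<mu> (F \<union> A) \<le> 1"
      using V A FV by (metis sum_mono2 Diff_iff Un_least Diff_subset subset_trans)
    have "cut a (F \<union> A) (V - (F \<union> A)) = cut a F (V - (F \<union> A)) + cut a A (V - F - A)"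
    proof -
      have "V - (F \<union> A) = V - F - A" by blast
      then show ?thesis
        unfolding cut_def using A FV finA by (subst sum.union_disjoint) auto
    qed
    also have "cut a F (V - (F \<union> A)) \<le> cut a F (V - F)"
      unfolding cut_def using V a FV by (intro sum_mono sum_mono2) auto
    also have "\<dots> \<le> \<delta> * sum \<mu> F" using F by (auto simp: \<F>_def)
    finally have less: "cut a (F \<union> A) (V - (F \<union> A)) < \<delta> * sum \<mu> (F \<union> A)"
      using bad by (simp add: FA algebra_simps)
    show False
    proof (cases "sum \<mu> (F \<union> A) \<le> 1/2")
      case True
      then have "F \<union> A \<in> \<F>" using less A FV by (auto simp: \<F>_def)
      then have "card (F \<union> A) \<le> card F" using F by blast
      moreover have "card (F \<union> A) = card F + card A"
        using A FV finA by (intro card_Un_disjoint) auto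
      ultimately show False using A0 finA by simp
    next
      case False
      \<comment> \<open>The union is too heavy to belong to the family, so its complement is used.
        The union has mass at most (1 + 1/4)/2 = 5/8, so \<open>G\<close> has mass between 3/8 and
        1/2; by symmetry of \<open>a\<close> both sets have the same cut.\<close>
      define G where "G = V - (F \<union> A)"
      have G: "sum \<mu> G = 1 - sum \<mu> (F \<union> A)"
        unfolding G_def using V A FV by (subst sum_diff) auto
      have "V - G = F \<union> A" using A FV by (auto simp: G_def)
      have "\<delta> \<le> cut a G (V - G)"
      proof (rule cut)
        show "1/4 \<le> sum \<mu> G" using G FA A Y small by linarith
        show "sum \<mu> G \<le> 1/2" using G False by linarith
      qed (auto simp: G_def)
      also have "\<dots> = cut a (F \<union> A) (V - (F \<union> A))"
        unfolding \<open>V - G = F \<union> A\<close> using a(2) by (subst cut_commute) (simp add: G_def)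
      also have "\<dots> < \<delta> * sum \<mu> (F \<union> A)" by fact
      also have "\<dots> \<le> \<delta> * 1" using FA1 \<delta> by (intro mult_left_mono) auto
      finally show False by simp
    qed
  qed
  show ?thesis
    using main Y small by (intro exI[of _ "V - F"]) auto
qed

lemma sum_eq_sum_positive_part:
  fixes \<mu> :: "'a \<Rightarrow> real"
  assumes "finite A" "\<And>x. x \<in> A \<Longrightarrow> 0 \<le> \<mu> x"
  shows "sum \<mu> {x \<in> A. 0 < \<mu> x} = sum \<mu> A"
proof (rule sum.mono_neutral_left)
  show "\<forall>i\<in>A - {x \<in> A. 0 < \<mu> x}. \<mu> i = 0" using assms by force
qed (use assms in auto)

text \<open>The walk divides by \<open>sqrt (\<mu> x)\<close>, so points of mass zero have to go.
  They carry no mass, and all conductances at them vanish, so both sides of the isoperimetric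
  inequality are unchanged.\<close>

lemma positive_isoperimetric_subset_exists:
  fixes \<mu> :: "'a \<Rightarrow> real"
  assumes V: "finite V" "\<And>x. x \<in> V \<Longrightarrow> 0 \<le> \<mu> x" "sum \<mu> V = 1"
    and c: "0 < c" "c < 1"
    and exp: "\<And>A. A \<subseteq> V \<Longrightarrow> 1/8 \<le> sum \<mu> A \<Longrightarrow> sum \<mu> A \<le> 1/2 \<Longrightarrow>
      c * sum \<mu> A < sum \<mu> {y \<in> V - A. \<exists>x\<in>A. E x y}"
    and sym: "\<And>x y. E x y \<Longrightarrow> E y x"
  shows "\<exists>Y\<subseteq>V. 3/4 \<le> sum \<mu> Y \<and> (\<forall>x\<in>Y. 0 < \<mu> x) \<and>
    (\<forall>A\<subseteq>Y. sum \<mu> A \<le> sum \<mu> Y / 2 \<longrightarrow> c/16 * sum \<mu> A \<le> cut (min_conductance \<mu> E) A (Y - A))"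
proof -
  have "\<exists>Y\<subseteq>V. 3/4 \<le> sum \<mu> Y \<and>
    (\<forall>A\<subseteq>Y. sum \<mu> A \<le> sum \<mu> Y / 2 \<longrightarrow> c/16 * sum \<mu> A \<le> cut (min_conductance \<mu> E) A (Y - A))"
  proof (rule isoperimetric_subset_exists)
    show "min_conductance \<mu> E x y = min_conductance \<mu> E y x" for x y
      using sym by (auto simp: min_conductance_def min.commute)
    show "0 \<le> min_conductance \<mu> E x y" if "x \<in> V" "y \<in> V" for x y
      using that V by (simp add: min_conductance_def)
    show "c/16 \<le> cut (min_conductance \<mu> E) A (V - A)"
      if "A \<subseteq> V" "1/4 \<le> sum \<mu> A" "sum \<mu> A \<le> 1/2" for A
      using min_conductance_cut_ge[OF V(1,2) c exp sym that] by simp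
  qed (use V c in auto)
  then obtain Y where Y: "Y \<subseteq> V" "3/4 \<le> sum \<mu> Y" and
    iso: "\<And>A. A \<subseteq> Y \<Longrightarrow> sum \<mu> A \<le> sum \<mu> Y / 2 \<Longrightarrow> c/16 * sum \<mu> A \<le> cut (min_conductance \<mu> E) A (Y - A)"
    by blast
  have finY: "finite Y" using Y V finite_subset by blast
  define Y' where "Y' = {x \<in> Y. 0 < \<mu> x}"
  have s: "sum \<mu> Y' = sum \<mu> Y"
    unfolding Y'_def using Y V by (intro sum_eq_sum_positive_part finY) auto
  have "c/16 * sum \<mu> A \<le> cut (min_conductance \<mu> E) A (Y' - A)"
    if A: "A \<subseteq> Y'" "sum \<mu> A \<le> sum \<mu> Y' / 2" for A
  proof -
    have AY: "A \<subseteq> Y" using A by (auto simp: Y'_def)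
    then have "c/16 * sum \<mu> A \<le> cut (min_conductance \<mu> E) A (Y - A)"
      using A s by (intro iso) auto
    also have "\<dots> = cut (min_conductance \<mu> E) A (Y' - A)"
      unfolding cut_def
    proof (rule sum.cong[OF refl], rule sum.mono_neutral_right)
      fix x assume x: "x \<in> A"
      show "\<forall>y\<in>Y - A - (Y' - A). min_conductance \<mu> E x y = 0"
      proof
        fix y assume "y \<in> Y - A - (Y' - A)"
        then have "\<mu> y = 0" using V(2)[of y] Y by (auto simp: Y'_def)
        moreover have "0 \<le> \<mu> x" using x V AY Y by blast
        ultimately show "min_conductance \<mu> E x y = 0" by (simp add: min_conductance_def)
      qed
    qed (use finY in \<open>auto simp: Y'_def\<close>)
    finally show ?thesis .
  qed
  then show ?thesis using Y s by (intro exI[of _ Y']) (auto simp: Y'_def)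
qed

section \<open>From isoperimetry to a Poincare inequality\<close>

definition energy :: "'a set \<Rightarrow> ('a \<Rightarrow> 'a \<Rightarrow> real) \<Rightarrow> ('a \<Rightarrow> real) \<Rightarrow> real" where
  "energy Y a f = (\<Sum>x\<in>Y. \<Sum>y\<in>Y. a x y * (f x - f y)\<^sup>2)"

text \<open>The co-area inequality, with induction on the size of the support instead of an integral
  over levels. If \<open>t\<close> is the least positive value of \<open>g\<close> and
  \<open>A\<close> its support, lowering \<open>g\<close> by \<open>t\<close> on \<open>A\<close>
  removes a layer that contributes \<open>t * sum \<mu> A\<close> to the mass and
  \<open>2 * t * cut a A (Y - A)\<close> to the variation; the 2 is due to summation over ordered
  pairs. A point where the minimum is attained leaves the support.\<close>

lemma sum_abs_diff_ge_isoperimetric: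
  fixes g :: "'a \<Rightarrow> real"
  assumes "finite Y" "\<And>x y. a x y = a y x"
    and iso: "\<And>A. A \<subseteq> Y \<Longrightarrow> sum \<mu> A \<le> s \<Longrightarrow> h * sum \<mu> A \<le> cut a A (Y - A)"
    and \<mu>: "\<And>x. x \<in> Y \<Longrightarrow> 0 \<le> \<mu> x"
    and "\<And>x. x \<in> Y \<Longrightarrow> 0 \<le> g x" and "sum \<mu> {x \<in> Y. 0 < g x} \<le> s"
  shows "2 * h * (\<Sum>x\<in>Y. \<mu> x * g x) \<le> (\<Sum>x\<in>Y. \<Sum>y\<in>Y. a x y * \<bar>g x - g y\<bar>)"
  using assms(5,6)
proof (induction "card {x \<in> Y. 0 < g x}" arbitrary: g rule: less_induct)
  case less
  define A where "A = {x \<in> Y. 0 < g x}"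
  have AY: "A \<subseteq> Y" "finite A" using assms(1) by (auto simp: A_def)
  show ?case
  proof (cases "A = {}")
    case True
    then have "\<forall>x\<in>Y. g x = 0" using less.prems unfolding A_def by force
    then show ?thesis by simp
  next
    case False
    define t where "t = Min (g ` A)"
    have t: "0 < t" "\<And>x. x \<in> A \<Longrightarrow> t \<le> g x"
      unfolding t_def using False AY by (auto simp: A_def)
    obtain z where z: "z \<in> A" "g z = t"
      using obtains_MIN[of A g] False AY unfolding t_def by metis
    define g' where "g' x = (if x \<in> A then g x - t else g x)" for x
    have sub: "{x \<in> Y. 0 < g' x} \<subseteq> A - {z}"
      using z by (auto simp: g'_def A_def split: if_splits)
    have "2 * h * (\<Sum>x\<in>Y. \<mu> x * g' x) \<le> (\<Sum>x\<in>Y. \<Sum>y\<in>Y. a x y * \<bar>g' x - g' y\<bar>)"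
    proof (rule less.hyps)
      show "card {x \<in> Y. 0 < g' x} < card {x \<in> Y. 0 < g x}"
        using sub z AY unfolding A_def[symmetric]
        by (meson card_Diff1_less card_mono finite_Diff le_less_trans)
      show "0 \<le> g' x" if "x \<in> Y" for x
        using that less.prems t by (simp add: g'_def)
      have "sum \<mu> {x \<in> Y. 0 < g' x} \<le> sum \<mu> A"
        using sub AY \<mu> by (intro sum_mono2) (auto simp: A_def)
      then show "sum \<mu> {x \<in> Y. 0 < g' x} \<le> s" using less.prems by (simp add: A_def)
    qed
    moreover have "(\<Sum>x\<in>Y. \<mu> x * g x) = (\<Sum>x\<in>Y. \<mu> x * g' x) + t * sum \<mu> A"
    proof -
      have "(\<Sum>x\<in>Y. \<mu> x * g x) = (\<Sum>x\<in>Y. \<mu> x * g' x + (if x \<in> A then t * \<mu> x else 0))"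
        by (intro sum.cong) (auto simp: g'_def algebra_simps)
      then show ?thesis
        using AY assms(1) by (simp add: sum.distrib sum.If_cases Int_absorb1 sum_distrib_left)
    qed
    moreover have "(\<Sum>x\<in>Y. \<Sum>y\<in>Y. a x y * \<bar>g x - g y\<bar>)
        = (\<Sum>x\<in>Y. \<Sum>y\<in>Y. a x y * \<bar>g' x - g' y\<bar>) + 2 * (t * cut a A (Y - A))"
    proof -
      \<comment> \<open>Only pairs separated by \<open>A\<close> notice the removal: within
        \<open>A\<close> both values drop by \<open>t\<close>, and outside \<open>A\<close> both are
        zero.\<close>
      have pt: "a x y * \<bar>g x - g y\<bar> = a x y * \<bar>g' x - g' y\<bar>
          + t * (if x \<in> A \<and> y \<in> Y - A then a x y else 0)
          + t * (if y \<in> A \<and> x \<in> Y - A then a y x else 0)" if "x \<in> Y" "y \<in> Y" for x y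
      proof -
        have zero: "g u = 0" if "u \<in> Y" "u \<notin> A" for u
          using that less.prems(1)[of u] by (force simp: A_def)
        show ?thesis
          using that t(2)[of x] t(2)[of y] zero[of x] zero[of y] t(1) assms(2)[of x y]
          by (cases "x \<in> A"; cases "y \<in> A") (auto simp: g'_def algebra_simps)
      qed
      have c1: "(\<Sum>x\<in>Y. \<Sum>y\<in>Y. if x \<in> A \<and> y \<in> Y - A then a x y else 0) = cut a A (Y - A)"
      proof -
        have "(\<Sum>x\<in>Y. \<Sum>y\<in>Y. if x \<in> A \<and> y \<in> Y - A then a x y else 0)
          = (\<Sum>x\<in>Y. if x \<in> A then (\<Sum>y\<in>Y. if y \<in> Y - A then a x y else 0) else 0)"
          by (intro sum.cong) auto
        also have "\<dots> = (\<Sum>x\<in>A. \<Sum>y\<in>Y. if y \<in> Y - A then a x y else 0)"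
          using AY assms(1) by (simp add: sum.If_cases Int_absorb1)
        also have "\<dots> = (\<Sum>x\<in>A. \<Sum>y\<in>Y - A. a x y)"
          using AY assms(1) by (intro sum.cong refl sum.mono_neutral_cong_right) auto
        finally show ?thesis by (simp add: cut_def)
      qed
      have c2: "(\<Sum>x\<in>Y. \<Sum>y\<in>Y. if y \<in> A \<and> x \<in> Y - A then a y x else 0) = cut a A (Y - A)"
        unfolding c1[symmetric] by (rule sum.swap)
      have "(\<Sum>x\<in>Y. \<Sum>y\<in>Y. a x y * \<bar>g x - g y\<bar>) = (\<Sum>x\<in>Y. \<Sum>y\<in>Y. a x y * \<bar>g' x - g' y\<bar>
          + t * (if x \<in> A \<and> y \<in> Y - A then a x y else 0)
          + t * (if y \<in> A \<and> x \<in> Y - A then a y x else 0))"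
        by (intro sum.cong refl pt)
      also have "\<dots> = (\<Sum>x\<in>Y. \<Sum>y\<in>Y. a x y * \<bar>g' x - g' y\<bar>)
          + t * (\<Sum>x\<in>Y. \<Sum>y\<in>Y. if x \<in> A \<and> y \<in> Y - A then a x y else 0)
          + t * (\<Sum>x\<in>Y. \<Sum>y\<in>Y. if y \<in> A \<and> x \<in> Y - A then a y x else 0)"
        by (simp only: sum.distrib sum_distrib_left)
      finally show ?thesis unfolding c1 c2 by simp
    qed
    moreover have "t * (h * sum \<mu> A) \<le> t * cut a A (Y - A)"
      using t AY less.prems(2) by (intro mult_left_mono iso) (auto simp: A_def)
    ultimately show ?thesis by (simp add: algebra_simps)
  qed
qed

lemma double_sum_weighted_le:
  fixes \<phi> :: "'a \<Rightarrow> real"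
  assumes "\<And>x. x \<in> Y \<Longrightarrow> (\<Sum>y\<in>Y. a x y) \<le> N * \<mu> x" "\<And>x. x \<in> Y \<Longrightarrow> 0 \<le> \<phi> x"
  shows "(\<Sum>x\<in>Y. \<Sum>y\<in>Y. a x y * \<phi> x) \<le> N * (\<Sum>x\<in>Y. \<mu> x * \<phi> x)"
proof -
  have "(\<Sum>x\<in>Y. \<Sum>y\<in>Y. a x y * \<phi> x) = (\<Sum>x\<in>Y. (\<Sum>y\<in>Y. a x y) * \<phi> x)"
    by (simp add: sum_distrib_right)
  also have "\<dots> \<le> (\<Sum>x\<in>Y. (N * \<mu> x) * \<phi> x)"
    using assms by (intro sum_mono mult_right_mono) auto
  finally show ?thesis by (simp add: sum_distrib_left mult.assoc)
qed

text \<open>The co-area inequality is applied to the square of \<open>\<phi>\<close>. A difference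
  of squares is a product \<open>u * v\<close> of difference and sum, which is split by the weighted
  inequality from \<open>(2*N*u - h*v)\<^sup>2 \<ge> 0\<close>. The weights are such that, by the
  degree bound, the terms from \<open>v\<close> absorb exactly half of the left-hand side.\<close>

lemma Cheeger_one_sided:
  fixes \<phi> :: "'a \<Rightarrow> real"
  assumes Y: "finite Y" and a: "\<And>x y. a x y = a y x" "\<And>x y. x \<in> Y \<Longrightarrow> y \<in> Y \<Longrightarrow> 0 \<le> a x y"
    and deg: "\<And>x. x \<in> Y \<Longrightarrow> (\<Sum>y\<in>Y. a x y) \<le> N * \<mu> x"
    and iso: "\<And>A. A \<subseteq> Y \<Longrightarrow> sum \<mu> A \<le> s \<Longrightarrow> h * sum \<mu> A \<le> cut a A (Y - A)"
    and \<mu>: "\<And>x. x \<in> Y \<Longrightarrow> 0 \<le> \<mu> x"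
    and hN: "0 < h" "0 < N"
    and \<phi>: "\<And>x. x \<in> Y \<Longrightarrow> 0 \<le> \<phi> x" "sum \<mu> {x \<in> Y. 0 < \<phi> x} \<le> s"
  shows "h\<^sup>2 / N * (\<Sum>x\<in>Y. \<mu> x * (\<phi> x)\<^sup>2) \<le> energy Y a \<phi>"
proof -
  define S where "S = (\<Sum>x\<in>Y. \<mu> x * (\<phi> x)\<^sup>2)"
  have eq: "{x \<in> Y. 0 < (\<phi> x)\<^sup>2} = {x \<in> Y. 0 < \<phi> x}"
    using \<phi>(1) by (force simp: less_le)
  have "2 * h * S \<le> (\<Sum>x\<in>Y. \<Sum>y\<in>Y. a x y * \<bar>(\<phi> x)\<^sup>2 - (\<phi> y)\<^sup>2\<bar>)"
    unfolding S_def
    by (rule sum_abs_diff_ge_isoperimetric[where s=s]) (use assms eq in auto)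
  also have "\<dots> \<le> (\<Sum>x\<in>Y. \<Sum>y\<in>Y. N/h * (a x y * (\<phi> x - \<phi> y)\<^sup>2)
      + h / (2*N) * (a x y * (\<phi> x)\<^sup>2) + h / (2*N) * (a y x * (\<phi> y)\<^sup>2))"
  proof (intro sum_mono)
    fix x y assume xy: "x \<in> Y" "y \<in> Y"
    define u where "u = \<bar>\<phi> x - \<phi> y\<bar>"
    define v where "v = \<phi> x + \<phi> y"
    have "\<bar>(\<phi> x)\<^sup>2 - (\<phi> y)\<^sup>2\<bar> = u * v"
      using \<phi>(1) xy by (simp add: u_def v_def power2_eq_square square_diff_square_factored abs_mult)
    also have "\<dots> \<le> N/h * u\<^sup>2 + h/(4*N) * v\<^sup>2"
    proof -
      have "0 \<le> (2 * N * u - h * v)\<^sup>2" by simp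
      then show ?thesis using hN by (simp add: field_simps power2_eq_square)
    qed
    also have "h/(4*N) * v\<^sup>2 \<le> h/(4*N) * (2 * (\<phi> x)\<^sup>2 + 2 * (\<phi> y)\<^sup>2)"
    proof (rule mult_left_mono)
      have "0 \<le> (\<phi> x - \<phi> y)\<^sup>2" by simp
      then show "v\<^sup>2 \<le> 2 * (\<phi> x)\<^sup>2 + 2 * (\<phi> y)\<^sup>2"
        by (simp add: v_def power2_eq_square algebra_simps)
    qed (use hN in auto)
    finally have "\<bar>(\<phi> x)\<^sup>2 - (\<phi> y)\<^sup>2\<bar> \<le> N/h * (\<phi> x - \<phi> y)\<^sup>2 + h/(2*N) * (\<phi> x)\<^sup>2 + h/(2*N) * (\<phi> y)\<^sup>2"
      using hN by (simp add: u_def field_simps)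
    then have "a x y * \<bar>(\<phi> x)\<^sup>2 - (\<phi> y)\<^sup>2\<bar>
       \<le> a x y * (N/h * (\<phi> x - \<phi> y)\<^sup>2 + h/(2*N) * (\<phi> x)\<^sup>2 + h/(2*N) * (\<phi> y)\<^sup>2)"
      using a xy by (intro mult_left_mono) auto
    then show "a x y * \<bar>(\<phi> x)\<^sup>2 - (\<phi> y)\<^sup>2\<bar> \<le> N/h * (a x y * (\<phi> x - \<phi> y)\<^sup>2)
      + h / (2*N) * (a x y * (\<phi> x)\<^sup>2) + h / (2*N) * (a y x * (\<phi> y)\<^sup>2)"
      using a(1)[of x y] by (simp add: algebra_simps)
  qed
  also have "\<dots> = N/h * energy Y a \<phi> + h/(2*N) * (\<Sum>x\<in>Y. \<Sum>y\<in>Y. a x y * (\<phi> x)\<^sup>2)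
      + h/(2*N) * (\<Sum>x\<in>Y. \<Sum>y\<in>Y. a y x * (\<phi> y)\<^sup>2)"
    by (simp only: sum.distrib sum_distrib_left energy_def)
  also have "(\<Sum>x\<in>Y. \<Sum>y\<in>Y. a y x * (\<phi> y)\<^sup>2) = (\<Sum>x\<in>Y. \<Sum>y\<in>Y. a x y * (\<phi> x)\<^sup>2)"
    by (rule sum.swap)
  finally have "2 * h * S \<le> N/h * energy Y a \<phi> + h/N * (\<Sum>x\<in>Y. \<Sum>y\<in>Y. a x y * (\<phi> x)\<^sup>2)"
    using hN by (simp add: field_simps)
  also have "h/N * (\<Sum>x\<in>Y. \<Sum>y\<in>Y. a x y * (\<phi> x)\<^sup>2) \<le> h/N * (N * S)"
    unfolding S_def using hN deg by (intro mult_left_mono double_sum_weighted_le) auto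
  finally have "h * S \<le> N/h * energy Y a \<phi>" using hN by (simp add: mult.commute)
  then show ?thesis using hN by (simp add: S_def field_simps power2_eq_square)
qed

text \<open>The median is the least value \<open>t\<close> of \<open>f\<close> above which lies at
  most half of the mass. If there is a next smaller value \<open>r\<close>, it fails this test, so
  more than half lies above \<open>r\<close>, and the complement of that part is the part below
  \<open>t\<close>.\<close>

lemma median_exists:
  fixes f \<mu> :: "'a \<Rightarrow> real"
  assumes "finite Y" "\<And>x. x \<in> Y \<Longrightarrow> 0 \<le> \<mu> x"
  shows "\<exists>t. sum \<mu> {x \<in> Y. t < f x} \<le> sum \<mu> Y / 2 \<and> sum \<mu> {x \<in> Y. f x < t} \<le> sum \<mu> Y / 2"
proof (cases "Y = {}")
  case False
  define T where "T = {t \<in> f ` Y. sum \<mu> {x \<in> Y. t < f x} \<le> sum \<mu> Y / 2}"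
  have s0: "0 \<le> sum \<mu> Y" using assms by (intro sum_nonneg)
  have "{x \<in> Y. Max (f ` Y) < f x} = {}" using assms by (auto simp: not_less)
  then have "sum \<mu> {x \<in> Y. Max (f ` Y) < f x} \<le> sum \<mu> Y / 2" using s0 by (simp only: sum.empty)
  moreover have "Max (f ` Y) \<in> f ` Y" using False assms by (intro Max_in) auto
  ultimately have "Max (f ` Y) \<in> T"
    unfolding T_def by blast
  moreover have finT: "finite T" unfolding T_def using assms by auto
  ultimately have t: "Min T \<in> T" by (intro Min_in) auto
  define t where "t = Min T"
  have "sum \<mu> {x \<in> Y. f x < t} \<le> sum \<mu> Y / 2"
  proof (cases "{x \<in> Y. f x < t} = {}")
    case True
    then show ?thesis using s0 by (simp only: sum.empty)
  next
    case ne: False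
    define r where "r = Max (f ` {x \<in> Y. f x < t})"
    have "r \<in> f ` {x \<in> Y. f x < t}" unfolding r_def using ne assms by (intro Max_in) auto
    then have r: "r \<in> f ` Y" "r < t" by auto
    have "r \<notin> T" using r Min_le[OF finT, of r] by (auto simp: t_def)
    then have "sum \<mu> {x \<in> Y. r < f x} > sum \<mu> Y / 2" using r by (auto simp: T_def)
    moreover have "{x \<in> Y. f x < t} = Y - {x \<in> Y. r < f x}"
    proof -
      have "f x \<le> r" if "x \<in> Y" "f x < t" for x
        unfolding r_def using that assms by (intro Max_ge) auto
      then show ?thesis using r by force
    qed
    then have "sum \<mu> {x \<in> Y. f x < t} = sum \<mu> Y - sum \<mu> {x \<in> Y. r < f x}"
      using assms by (simp add: sum_diff)
    ultimately show ?thesis by linarith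
  qed
  then show ?thesis using t by (auto simp: T_def t_def)
qed auto

text \<open>The one-sided estimate needs a support of at most half the mass. Splitting
  \<open>f - t\<close> at a median \<open>t\<close> into its positive and negative parts gives two
  such functions, whose energies add up to at most the energy of \<open>f\<close>.\<close>

lemma Cheeger_Poincare:
  fixes f :: "'a \<Rightarrow> real"
  assumes Y: "finite Y" and a: "\<And>x y. a x y = a y x" "\<And>x y. x \<in> Y \<Longrightarrow> y \<in> Y \<Longrightarrow> 0 \<le> a x y"
    and deg: "\<And>x. x \<in> Y \<Longrightarrow> (\<Sum>y\<in>Y. a x y) \<le> N * \<mu> x"
    and iso: "\<And>A. A \<subseteq> Y \<Longrightarrow> sum \<mu> A \<le> sum \<mu> Y / 2 \<Longrightarrow> h * sum \<mu> A \<le> cut a A (Y - A)"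
    and \<mu>: "\<And>x. x \<in> Y \<Longrightarrow> 0 \<le> \<mu> x"
    and hN: "0 < h" "0 < N"
    and mean: "(\<Sum>x\<in>Y. \<mu> x * f x) = 0"
  shows "h\<^sup>2 / N * (\<Sum>x\<in>Y. \<mu> x * (f x)\<^sup>2) \<le> energy Y a f"
proof -
  obtain t where t: "sum \<mu> {x \<in> Y. t < f x} \<le> sum \<mu> Y / 2" "sum \<mu> {x \<in> Y. f x < t} \<le> sum \<mu> Y / 2"
    using median_exists[of Y \<mu> f] Y \<mu> by blast
  define p where "p x = max (f x - t) 0" for x
  define q where "q x = max (t - f x) 0" for x
  have "{x \<in> Y. 0 < p x} = {x \<in> Y. t < f x}" "{x \<in> Y. 0 < q x} = {x \<in> Y. f x < t}"
    by (auto simp: p_def q_def)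
  then have pq: "h\<^sup>2 / N * (\<Sum>x\<in>Y. \<mu> x * (p x)\<^sup>2) \<le> energy Y a p"
      "h\<^sup>2 / N * (\<Sum>x\<in>Y. \<mu> x * (q x)\<^sup>2) \<le> energy Y a q"
    using t by (intro Cheeger_one_sided[where s="sum \<mu> Y / 2"] assms; simp add: p_def q_def)+
  \<comment> \<open>As \<open>f\<close> has mean zero, its second moment about \<open>t\<close> is
    at least the one about 0.\<close>
  have "(\<Sum>x\<in>Y. \<mu> x * (f x)\<^sup>2) + t\<^sup>2 * sum \<mu> Y - 2 * t * (\<Sum>x\<in>Y. \<mu> x * f x)
     = (\<Sum>x\<in>Y. \<mu> x * (f x - t)\<^sup>2)"
    by (simp add: sum_distrib_left sum_subtractf[symmetric] sum.distrib[symmetric]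
        power2_eq_square algebra_simps)
  moreover have "0 \<le> t\<^sup>2 * sum \<mu> Y"
    by (intro mult_nonneg_nonneg sum_nonneg \<mu>) auto
  ultimately have "(\<Sum>x\<in>Y. \<mu> x * (f x)\<^sup>2) \<le> (\<Sum>x\<in>Y. \<mu> x * (f x - t)\<^sup>2)"
    unfolding mean by linarith
  also have "\<dots> = (\<Sum>x\<in>Y. \<mu> x * (p x)\<^sup>2) + (\<Sum>x\<in>Y. \<mu> x * (q x)\<^sup>2)"
    unfolding sum.distrib[symmetric]
    by (intro sum.cong) (auto simp: p_def q_def max_def power2_eq_square algebra_simps)
  finally have "h\<^sup>2 / N * (\<Sum>x\<in>Y. \<mu> x * (f x)\<^sup>2)
      \<le> h\<^sup>2 / N * ((\<Sum>x\<in>Y. \<mu> x * (p x)\<^sup>2) + (\<Sum>x\<in>Y. \<mu> x * (q x)\<^sup>2))"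
    using hN by (intro mult_left_mono) auto
  also have "\<dots> \<le> energy Y a p + energy Y a q" using pq by (simp add: distrib_left)
  also have "\<dots> = (\<Sum>x\<in>Y. \<Sum>y\<in>Y. a x y * ((p x - p y)\<^sup>2 + (q x - q y)\<^sup>2))"
    by (simp add: energy_def sum.distrib[symmetric] distrib_left)
  also have "\<dots> \<le> energy Y a f"
    unfolding energy_def
  proof (intro sum_mono mult_left_mono a)
    fix x y
    have 1: "f x - f y = (p x - p y) - (q x - q y)" by (auto simp: p_def q_def max_def)
    \<comment> \<open>\<open>p\<close> is non-decreasing and \<open>q\<close> non-increasing as a
      function of \<open>f\<close>.\<close>
    have 2: "(p x - p y) * (q x - q y) \<le> 0"
      by (auto simp: p_def q_def max_def mult_le_0_iff)
    show "(p x - p y)\<^sup>2 + (q x - q y)\<^sup>2 \<le> (f x - f y)\<^sup>2"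
      unfolding 1 using 2 by (simp add: power2_eq_square algebra_simps)
  qed
  finally show ?thesis .
qed

subsection \<open>Spectral gap of the random walk\<close>

lemma Cauchy_Schwarz_weighted_sum:
  fixes w d :: "'a \<Rightarrow> real"
  assumes "\<And>y. y \<in> Y \<Longrightarrow> 0 \<le> w y"
  shows "(\<Sum>y\<in>Y. w y * d y)\<^sup>2 \<le> (\<Sum>y\<in>Y. w y) * (\<Sum>y\<in>Y. w y * (d y)\<^sup>2)"
proof -
  have "(\<Sum>y\<in>Y. w y * d y) = (\<Sum>y\<in>Y. sqrt (w y) * (sqrt (w y) * d y))"
    using assms by (intro sum.cong) (auto simp: mult.assoc[symmetric])
  then have "(\<Sum>y\<in>Y. w y * d y)\<^sup>2 \<le> (\<Sum>y\<in>Y. (sqrt (w y))\<^sup>2) * (\<Sum>y\<in>Y. (sqrt (w y) * d y)\<^sup>2)"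
    by (simp only: Cauchy_Schwarz_ineq_sum)
  also have "\<dots> = (\<Sum>y\<in>Y. w y) * (\<Sum>y\<in>Y. w y * (d y)\<^sup>2)"
    using assms by (intro arg_cong2[where f="(*)"] sum.cong) (auto simp: power_mult_distrib)
  finally show ?thesis .
qed

text \<open>Conjugated by multiplication with \<open>sqrt \<mu>\<close>, this is the lazy random walk with conductances \<open>a\<close>;
  it fixes \<open>sqrt \<mu>\<close>, and the constant \<open>N\<close> bounds the weighted degrees.\<close>

definition walk :: "'a set \<Rightarrow> ('a \<Rightarrow> 'a \<Rightarrow> real) \<Rightarrow> ('a \<Rightarrow> real) \<Rightarrow> real \<Rightarrow> ('a \<Rightarrow> real) \<Rightarrow> 'a \<Rightarrow> real" where
  "walk Y a \<mu> N u x = u x -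
     (\<Sum>y\<in>Y. a x y * (u x / sqrt (\<mu> x) - u y / sqrt (\<mu> y))) / (2 * N * sqrt (\<mu> x))"

text \<open>With \<open>f = v / sqrt \<mu>\<close> and its Laplacian \<open>g\<close>, the squared
  norm of the image is that of \<open>v\<close>, minus energy/(2N) from the cross term, plus a
  quadratic term in \<open>g\<close>. Cauchy-Schwarz and the degree bound limit the latter to
  energy/(4N). The factor 2 in the definition of \<open>walk\<close> thus saves half of the gain,
  which the Poincare inequality converts into a contraction.\<close>

lemma walk_contraction:
  fixes \<mu> :: "'a \<Rightarrow> real"
  assumes Y: "finite Y" and a: "\<And>x y. a x y = a y x" "\<And>x y. x \<in> Y \<Longrightarrow> y \<in> Y \<Longrightarrow> 0 \<le> a x y"
    and deg: "\<And>x. x \<in> Y \<Longrightarrow> (\<Sum>y\<in>Y. a x y) \<le> N * \<mu> x"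
    and \<mu>: "\<And>x. x \<in> Y \<Longrightarrow> 0 < \<mu> x" and N: "0 < N"
    and Poincare: "\<And>f. (\<Sum>x\<in>Y. \<mu> x * f x) = 0 \<Longrightarrow> \<kappa> * (\<Sum>x\<in>Y. \<mu> x * (f x)\<^sup>2) \<le> energy Y a f"
    and v: "(\<Sum>x\<in>Y. sqrt (\<mu> x) * v x) = 0"
  shows "(\<Sum>x\<in>Y. (walk Y a \<mu> N v x)\<^sup>2) \<le> (1 - \<kappa> / (4 * N)) * (\<Sum>x\<in>Y. (v x)\<^sup>2)"
    and "(\<Sum>x\<in>Y. sqrt (\<mu> x) * walk Y a \<mu> N v x) = 0"
proof -
  define f where "f x = v x / sqrt (\<mu> x)" for x
  define g where "g x = (\<Sum>y\<in>Y. a x y * (f x - f y))" for x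
  have walk: "walk Y a \<mu> N v x = v x - g x / (2 * N * sqrt (\<mu> x))" for x
    by (simp add: walk_def g_def f_def)
  \<comment> \<open>The total flow vanishes because \<open>a\<close> is symmetric; therefore the
    walk preserves orthogonality to \<open>sqrt \<mu>\<close>.\<close>
  have "(\<Sum>x\<in>Y. g x) = (\<Sum>x\<in>Y. \<Sum>y\<in>Y. a x y * f x) - (\<Sum>x\<in>Y. \<Sum>y\<in>Y. a x y * f y)"
    by (simp add: g_def right_diff_distrib sum_subtractf)
  also have "(\<Sum>x\<in>Y. \<Sum>y\<in>Y. a x y * f y) = (\<Sum>x\<in>Y. \<Sum>y\<in>Y. a x y * f x)"
    by (subst sum.swap) (simp add: a(1))
  finally have g0: "(\<Sum>x\<in>Y. g x) = 0" by simp
  have "(\<Sum>x\<in>Y. sqrt (\<mu> x) * walk Y a \<mu> N v x) = (\<Sum>x\<in>Y. sqrt (\<mu> x) * v x - g x / (2 * N))"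
    using \<mu> N by (intro sum.cong) (force simp: walk field_simps)+
  then show "(\<Sum>x\<in>Y. sqrt (\<mu> x) * walk Y a \<mu> N v x) = 0"
    using v g0 by (simp add: sum_subtractf sum_divide_distrib[symmetric])
  \<comment> \<open>Summation by parts: the sum is added to its copy with \<open>x\<close> and
    \<open>y\<close> exchanged. The factor 1/2 appears because \<open>energy\<close> counts every
    edge twice.\<close>
  have fg: "(\<Sum>x\<in>Y. f x * g x) = energy Y a f / 2"
  proof -
    have 1: "(\<Sum>x\<in>Y. f x * g x) = (\<Sum>x\<in>Y. \<Sum>y\<in>Y. a x y * (f x * (f x - f y)))"
      by (simp add: g_def sum_distrib_left algebra_simps)
    also have "\<dots> = (\<Sum>x\<in>Y. \<Sum>y\<in>Y. a x y * (f y * (f y - f x)))"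
      by (subst sum.swap) (simp add: a(1))
    finally have "(\<Sum>x\<in>Y. f x * g x) + (\<Sum>x\<in>Y. f x * g x)
        = (\<Sum>x\<in>Y. \<Sum>y\<in>Y. a x y * (f x * (f x - f y)) + a x y * (f y * (f y - f x)))"
      using 1 by (simp only: sum.distrib)
    also have "\<dots> = energy Y a f"
      unfolding energy_def by (intro sum.cong refl) (simp add: power2_eq_square algebra_simps)
    finally show ?thesis by simp
  qed
  have gg: "(\<Sum>x\<in>Y. (g x)\<^sup>2 / \<mu> x) \<le> N * energy Y a f"
    unfolding energy_def
  proof (subst sum_distrib_left, rule sum_mono)
    fix x assume x: "x \<in> Y"
    have "(g x)\<^sup>2 \<le> (\<Sum>y\<in>Y. a x y) * (\<Sum>y\<in>Y. a x y * (f x - f y)\<^sup>2)"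
      unfolding g_def using a x by (intro Cauchy_Schwarz_weighted_sum) auto
    also have "\<dots> \<le> (N * \<mu> x) * (\<Sum>y\<in>Y. a x y * (f x - f y)\<^sup>2)"
      using a(2) x deg by (intro mult_right_mono sum_nonneg) auto
    finally show "(g x)\<^sup>2 / \<mu> x \<le> N * (\<Sum>y\<in>Y. a x y * (f x - f y)\<^sup>2)"
      using \<mu>[OF x] by (simp add: field_simps)
  qed
  have vf: "(v x)\<^sup>2 = \<mu> x * (f x)\<^sup>2" "sqrt (\<mu> x) * v x = \<mu> x * f x" if "x \<in> Y" for x
    using \<mu>[OF that] by (auto simp: f_def power_divide field_simps real_sqrt_mult_self)
  have "\<kappa> * (\<Sum>x\<in>Y. (v x)\<^sup>2) \<le> energy Y a f"
    using Poincare[of f] v vf by simp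
  then have P: "\<kappa> / (4 * N) * (\<Sum>x\<in>Y. (v x)\<^sup>2) \<le> energy Y a f / (4 * N)"
    using N by (simp add: divide_right_mono)
  have "(\<Sum>x\<in>Y. (walk Y a \<mu> N v x)\<^sup>2)
      = (\<Sum>x\<in>Y. (v x)\<^sup>2 - f x * g x / N + (g x)\<^sup>2 / \<mu> x / (4 * N\<^sup>2))"
  proof (rule sum.cong[OF refl])
    fix x assume x: "x \<in> Y"
    have s: "0 < sqrt (\<mu> x)" "\<mu> x = (sqrt (\<mu> x))\<^sup>2" using \<mu>[OF x] by auto
    show "(walk Y a \<mu> N v x)\<^sup>2 = (v x)\<^sup>2 - f x * g x / N + (g x)\<^sup>2 / \<mu> x / (4 * N\<^sup>2)"
      unfolding walk f_def using s(1) N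
      by (subst (3) s(2)) (simp add: field_simps power2_eq_square)
  qed
  also have "\<dots> = (\<Sum>x\<in>Y. (v x)\<^sup>2) - (\<Sum>x\<in>Y. f x * g x) / N + (\<Sum>x\<in>Y. (g x)\<^sup>2 / \<mu> x) / (4 * N\<^sup>2)"
    by (simp add: sum.distrib sum_subtractf sum_divide_distrib)
  also have "\<dots> \<le> (\<Sum>x\<in>Y. (v x)\<^sup>2) - energy Y a f / (2 * N) + N * energy Y a f / (4 * N\<^sup>2)"
    unfolding fg using gg by (intro add_mono divide_right_mono) auto
  also have "\<dots> = (\<Sum>x\<in>Y. (v x)\<^sup>2) - energy Y a f / (4 * N)"
    using N by (simp add: field_simps power2_eq_square)
  finally show "(\<Sum>x\<in>Y. (walk Y a \<mu> N v x)\<^sup>2) \<le> (1 - \<kappa> / (4 * N)) * (\<Sum>x\<in>Y. (v x)\<^sup>2)"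
    using P by (simp add: algebra_simps)
qed

text \<open>Applied to a combination of point masses, this exhibits the values of the powers on
  point masses as matrix entries.\<close>

lemma walk_funpow_linear:
  fixes g :: "'b \<Rightarrow> 'a \<Rightarrow> real"
  assumes "finite I"
  shows "((walk Y a \<mu> N) ^^ k) (\<lambda>x. \<Sum>i\<in>I. c i * g i x)
    = (\<lambda>x. \<Sum>i\<in>I. c i * ((walk Y a \<mu> N) ^^ k) (g i) x)"
proof (induction k)
  case (Suc k)
  have lin: "walk Y a \<mu> N (\<lambda>x. \<Sum>i\<in>I. c i * h i x) x = (\<Sum>i\<in>I. c i * walk Y a \<mu> N (h i) x)"
    for h :: "'b \<Rightarrow> 'a \<Rightarrow> real" and x
  proof -
    have "(\<Sum>y\<in>Y. a x y * ((\<Sum>i\<in>I. c i * h i x) / sqrt (\<mu> x) - (\<Sum>i\<in>I. c i * h i y) / sqrt (\<mu> y)))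
        = (\<Sum>y\<in>Y. \<Sum>i\<in>I. c i * (a x y * (h i x / sqrt (\<mu> x) - h i y / sqrt (\<mu> y))))"
      by (simp add: sum_divide_distrib sum_subtractf[symmetric] sum_distrib_left algebra_simps)
    also have "\<dots> = (\<Sum>i\<in>I. c i * (\<Sum>y\<in>Y. a x y * (h i x / sqrt (\<mu> x) - h i y / sqrt (\<mu> y))))"
      by (subst sum.swap) (simp add: sum_distrib_left)
    finally have "walk Y a \<mu> N (\<lambda>x. \<Sum>i\<in>I. c i * h i x) x = (\<Sum>i\<in>I. c i * h i x)
      - (\<Sum>i\<in>I. c i * (\<Sum>y\<in>Y. a x y * (h i x / sqrt (\<mu> x) - h i y / sqrt (\<mu> y)))) / (2 * N * sqrt (\<mu> x))"
      by (simp only: walk_def)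
    also have "\<dots> = (\<Sum>i\<in>I. c i * walk Y a \<mu> N (h i) x)"
      unfolding sum_divide_distrib[of _ I] sum_subtractf[symmetric] walk_def
      by (intro sum.cong refl) (simp add: right_diff_distrib)
    finally show ?thesis .
  qed
  show ?case by (simp add: Suc.IH) (intro ext lin)
qed simp

lemma walk_propagation:
  assumes Y: "Y \<subseteq> mspace X" "0 \<le> R"
    and a: "\<And>x y. x \<in> Y \<Longrightarrow> y \<in> Y \<Longrightarrow> a x y \<noteq> 0 \<Longrightarrow> mdist X x y \<le> R"
    and "x \<in> Y" "y \<in> Y" "((walk Y a \<mu> N) ^^ k) (\<lambda>z. if z = y then 1 else 0) x \<noteq> 0"
  shows "mdist X x y \<le> k * R"
  using assms(4,6)
proof (induction k arbitrary: x)
  case 0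
  have "mdist X y y = 0" using Y assms(5) by auto
  then show ?case using 0 by (auto split: if_splits)
next
  case (Suc k)
  define w where "w = ((walk Y a \<mu> N) ^^ k) (\<lambda>z. if z = y then 1 else 0)"
  have nz: "walk Y a \<mu> N w x \<noteq> 0" using Suc.prems by (simp add: w_def)
  show ?case
  proof (cases "w x = 0")
    case False
    then have "mdist X x y \<le> k * R" using Suc by (simp add: w_def)
    then show ?thesis using Y(2) by (simp add: algebra_simps)
  next
    case True
    \<comment> \<open>Where \<open>w\<close> vanishes, a nonzero value after one more step can only
      come from a neighbour.\<close>
    have "\<exists>z\<in>Y. a x z * (w x / sqrt (\<mu> x) - w z / sqrt (\<mu> z)) \<noteq> 0"
    proof (rule ccontr)
      assume "\<not> ?thesis"
      then have "(\<Sum>y\<in>Y. a x y * (w x / sqrt (\<mu> x) - w y / sqrt (\<mu> y))) = 0"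
        by (intro sum.neutral) blast
      then show False using nz True by (simp add: walk_def)
    qed
    then obtain z where z: "z \<in> Y" "a x z \<noteq> 0" "w z \<noteq> 0" using True by auto
    have "mdist X x y \<le> mdist X x z + mdist X z y"
      using Y \<open>x \<in> Y\<close> \<open>y \<in> Y\<close> z by (intro mdist_triangle) auto
    also have "\<dots> \<le> R + k * R" using a z Suc by (intro add_mono) (auto simp: w_def)
    finally show ?thesis by (simp add: algebra_simps)
  qed
qed

text \<open>The component of \<open>u\<close> along \<open>sqrt \<mu>\<close> is fixed by the walk
  and is exactly what the kernel \<open>\<xi> x * \<xi> y\<close> subtracts. What remains is the
  power of the walk on the orthogonal part, which contracts at every step;
  \<open>\<kappa> \<le> 4 * N\<close> keeps the contraction factor nonnegative.\<close>

lemma walk_funpow_approx: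
  fixes \<mu> :: "'a \<Rightarrow> real"
  assumes Y: "finite Y" "Y \<noteq> {}"
    and a: "\<And>x y. a x y = a y x" "\<And>x y. x \<in> Y \<Longrightarrow> y \<in> Y \<Longrightarrow> 0 \<le> a x y"
    and deg: "\<And>x. x \<in> Y \<Longrightarrow> (\<Sum>y\<in>Y. a x y) \<le> N * \<mu> x"
    and \<mu>: "\<And>x. x \<in> Y \<Longrightarrow> 0 < \<mu> x" and N: "0 < N" and \<kappa>: "0 \<le> \<kappa>" "\<kappa> \<le> 4 * N"
    and Poincare: "\<And>f. (\<Sum>x\<in>Y. \<mu> x * f x) = 0 \<Longrightarrow> \<kappa> * (\<Sum>x\<in>Y. \<mu> x * (f x)\<^sup>2) \<le> energy Y a f"
  defines "\<xi> \<equiv> \<lambda>x. sqrt (\<mu> x / sum \<mu> Y)"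
  shows "(\<Sum>x\<in>Y. (\<Sum>y\<in>Y. (((walk Y a \<mu> N) ^^ k) (\<lambda>z. if z = y then 1 else 0) x - \<xi> x * \<xi> y) * u y)\<^sup>2)
    \<le> (1 - \<kappa> / (4 * N)) ^ k * (\<Sum>y\<in>Y. (u y)\<^sup>2)"
proof -
  define M where "M = walk Y a \<mu> N"
  define s where "s x = sqrt (\<mu> x)" for x
  define m where "m = sum \<mu> Y"
  have m: "0 < m" using Y \<mu> by (simp add: m_def sum_pos)
  define \<rho> where "\<rho> = 1 - \<kappa> / (4 * N)"
  have \<rho>: "0 \<le> \<rho>" using N \<kappa> by (simp add: \<rho>_def)
  \<comment> \<open>The truncation of \<open>u\<close> to \<open>Y\<close>, written as a combination
    of point masses so that linearity of the powers applies.\<close>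
  define u' where "u' x = (\<Sum>y\<in>Y. u y * (if x = y then 1 else 0))" for x
  have u': "u' x = u x" if "x \<in> Y" for x
    using that Y by (simp add: u'_def if_distrib cong: if_cong)
  define t where "t = (\<Sum>y\<in>Y. s y * u y) / m"
  define v where "v x = u' x - t * s x" for x
  have ss: "(\<Sum>x\<in>Y. s x * s x) = m"
    unfolding s_def m_def using \<mu> by (intro sum.cong) (auto simp: abs_of_pos)
  have sv: "(\<Sum>x\<in>Y. s x * v x) = 0"
  proof -
    have "(\<Sum>x\<in>Y. s x * v x) = (\<Sum>x\<in>Y. s x * u x - t * (s x * s x))"
      by (intro sum.cong) (auto simp: v_def u' algebra_simps)
    also have "\<dots> = (\<Sum>y\<in>Y. s y * u y) - t * m"
      by (simp only: sum_subtractf sum_distrib_left[symmetric] ss)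
    finally show ?thesis using m by (simp add: t_def)
  qed
  have vv: "(\<Sum>x\<in>Y. (v x)\<^sup>2) \<le> (\<Sum>x\<in>Y. (u x)\<^sup>2)"
  proof -
    have "(\<Sum>x\<in>Y. (u x)\<^sup>2) = (\<Sum>x\<in>Y. (v x)\<^sup>2 + 2 * t * (s x * v x) + t\<^sup>2 * (s x * s x))"
      by (intro sum.cong) (auto simp: v_def u' power2_eq_square algebra_simps)
    also have "\<dots> = (\<Sum>x\<in>Y. (v x)\<^sup>2) + t\<^sup>2 * m"
      by (simp add: sum.distrib sum_distrib_left[symmetric] ss sv)
    finally show ?thesis using m by simp
  qed
  have contr: "(\<Sum>x\<in>Y. ((M ^^ k) v x)\<^sup>2) \<le> \<rho> ^ k * (\<Sum>x\<in>Y. (v x)\<^sup>2)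
      \<and> (\<Sum>x\<in>Y. s x * (M ^^ k) v x) = 0" for k
  proof (induction k)
    case (Suc k)
    have "(\<Sum>x\<in>Y. (M ((M ^^ k) v) x)\<^sup>2) \<le> \<rho> * (\<Sum>x\<in>Y. ((M ^^ k) v x)\<^sup>2)"
      and *: "(\<Sum>x\<in>Y. s x * M ((M ^^ k) v) x) = 0"
      using walk_contraction[of Y a N \<mu> \<kappa> "(M ^^ k) v"] assms Suc.IH
      by (simp_all add: M_def s_def \<rho>_def)
    then have "(\<Sum>x\<in>Y. (M ((M ^^ k) v) x)\<^sup>2) \<le> \<rho> * (\<rho> ^ k * (\<Sum>x\<in>Y. (v x)\<^sup>2))"
      using Suc.IH \<rho> by (meson mult_left_mono order_trans)
    then show ?case using * by (simp add: mult.assoc)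
  qed (use sv in simp)
  \<comment> \<open>Claimed on \<open>Y\<close> only, where \<open>s\<close> does not vanish: there
    the multiple of \<open>s\<close> adds the same constant to all quotients by \<open>s\<close>,
    and the walk sees only their differences.\<close>
  have eq: "\<forall>x\<in>Y. (M ^^ k) u' x = (M ^^ k) v x + t * s x" for k
  proof (induction k)
    case (Suc k)
    show ?case
    proof
      fix x assume x: "x \<in> Y"
      have s0: "s y \<noteq> 0" if "y \<in> Y" for y using \<mu>[OF that] by (simp add: s_def)
      have "(M ^^ k) u' x / s x - (M ^^ k) u' y / s y = (M ^^ k) v x / s x - (M ^^ k) v y / s y"
        if "y \<in> Y" for y
        using Suc.IH x that s0 by (simp add: add_divide_distrib)
      then have "(\<Sum>y\<in>Y. a x y * ((M ^^ k) u' x / s x - (M ^^ k) u' y / s y))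
          = (\<Sum>y\<in>Y. a x y * ((M ^^ k) v x / s x - (M ^^ k) v y / s y))"
        by simp
      moreover have "M w x = w x - (\<Sum>y\<in>Y. a x y * (w x / s x - w y / s y)) / (2 * N * s x)" for w
        by (simp add: M_def walk_def s_def)
      ultimately have "M ((M ^^ k) u') x = M ((M ^^ k) v) x + t * s x"
        using Suc.IH x by simp
      then show "(M ^^ Suc k) u' x = (M ^^ Suc k) v x + t * s x" by simp
    qed
  qed (simp add: v_def)
  have "(\<Sum>y\<in>Y. ((M ^^ k) (\<lambda>z. if z = y then 1 else 0) x - \<xi> x * \<xi> y) * u y) = (M ^^ k) v x"
    if x: "x \<in> Y" for x
  proof -
    have "(\<Sum>y\<in>Y. u y * (M ^^ k) (\<lambda>z. if z = y then 1 else 0) x) = (M ^^ k) u' x"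
      unfolding M_def u'_def[abs_def] using Y by (subst walk_funpow_linear) auto
    moreover have "(\<Sum>y\<in>Y. \<xi> x * \<xi> y * u y) = t * s x"
    proof -
      have "\<xi> x * \<xi> y = s x * s y / m" for y
        using m by (simp add: \<xi>_def s_def real_sqrt_divide m_def[symmetric])
      then show ?thesis by (simp add: t_def sum_divide_distrib sum_distrib_left algebra_simps)
    qed
    ultimately show ?thesis using eq x
      by (simp add: left_diff_distrib sum_subtractf mult.commute[of "u _"])
  qed
  then have "(\<Sum>x\<in>Y. (\<Sum>y\<in>Y. ((M ^^ k) (\<lambda>z. if z = y then 1 else 0) x - \<xi> x * \<xi> y) * u y)\<^sup>2)
      = (\<Sum>x\<in>Y. ((M ^^ k) v x)\<^sup>2)" by simp
  also have "\<dots> \<le> \<rho> ^ k * (\<Sum>x\<in>Y. (v x)\<^sup>2)" using contr by blast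
  also have "\<dots> \<le> \<rho> ^ k * (\<Sum>x\<in>Y. (u x)\<^sup>2)" using vv \<rho> by (intro mult_left_mono) auto
  finally show ?thesis by (simp add: M_def \<rho>_def)
qed

text \<open>The isoperimetric constant is h = c/16, the Poincare constant h^2/N, and the contraction
  divides once more by 4N. None of this depends on the block. As \<open>Y\<close> has mass at least
  3/4, normalising multiplies masses by at most 4/3, which the factor 2 covers.\<close>

lemma expander_block_approximable:
  fixes \<mu> :: "'a \<Rightarrow> real" and X :: "'a metric"
  assumes V: "finite V" "V \<subseteq> mspace X" "\<And>x. x \<in> V \<Longrightarrow> 0 \<le> \<mu> x" "sum \<mu> V = 1"
    and c: "0 < c" "c < 1" and R: "0 < R" and N: "1 \<le> N"
    and exp: "\<And>A. A \<subseteq> V \<Longrightarrow> 1/8 \<le> sum \<mu> A \<Longrightarrow> sum \<mu> A \<le> 1/2 \<Longrightarrow>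
      c * sum \<mu> A < sum \<mu> {y \<in> V - A. \<exists>x\<in>A. mdist X x y \<le> R}"
    and card: "\<And>x. x \<in> V \<Longrightarrow> card {y \<in> V. mdist X x y \<le> R} \<le> N"
  shows "\<exists>Y \<xi> Q. Y \<subseteq> V \<and> Y \<noteq> {} \<and> (\<forall>x\<in>Y. 0 \<le> \<xi> x \<and> (\<xi> x)\<^sup>2 \<le> 2 * \<mu> x) \<and> (\<Sum>x\<in>Y. (\<xi> x)\<^sup>2) = 1 \<and>
    (\<forall>k. \<forall>x\<in>Y. \<forall>y\<in>Y. Q k x y \<noteq> 0 \<longrightarrow> mdist X x y \<le> real k * R) \<and>
    (\<forall>k u. (\<Sum>x\<in>Y. (\<Sum>y\<in>Y. (Q k x y - \<xi> x * \<xi> y) * u y)\<^sup>2)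
       \<le> (1 - (c/16)\<^sup>2 / (4 * (real N)\<^sup>2)) ^ k * (\<Sum>y\<in>Y. (u y)\<^sup>2))"
proof -
  define E where "E x y \<longleftrightarrow> mdist X x y \<le> R" for x y
  define a where "a = min_conductance \<mu> E"
  have "\<exists>Y\<subseteq>V. 3/4 \<le> sum \<mu> Y \<and> (\<forall>x\<in>Y. 0 < \<mu> x) \<and>
    (\<forall>A\<subseteq>Y. sum \<mu> A \<le> sum \<mu> Y / 2 \<longrightarrow> c/16 * sum \<mu> A \<le> cut a A (Y - A))"
    unfolding a_def
    by (rule positive_isoperimetric_subset_exists) (use assms in \<open>auto simp: E_def mdist_commute\<close>)
  then obtain Y where Y: "Y \<subseteq> V" "3/4 \<le> sum \<mu> Y" "\<And>x. x \<in> Y \<Longrightarrow> 0 < \<mu> x" and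
    iso: "\<And>A. A \<subseteq> Y \<Longrightarrow> sum \<mu> A \<le> sum \<mu> Y / 2 \<Longrightarrow> c/16 * sum \<mu> A \<le> cut a A (Y - A)"
    by blast
  have finY: "finite Y" using Y V finite_subset by blast
  have Yne: "Y \<noteq> {}" using Y(2) by auto
  have as: "a x y = a y x" for x y
    by (auto simp: a_def min_conductance_def E_def mdist_commute min.commute)
  have a0: "0 \<le> a x y" if "x \<in> Y" "y \<in> Y" for x y
    using Y(3)[OF that(1)] Y(3)[OF that(2)] by (simp add: a_def min_conductance_def)
  have deg: "(\<Sum>y\<in>Y. a x y) \<le> real N * \<mu> x" if x: "x \<in> Y" for x
  proof -
    have "(\<Sum>y\<in>Y. a x y) \<le> (\<Sum>y\<in>Y. if E x y then \<mu> x else 0)"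
      by (intro sum_mono) (auto simp: a_def min_conductance_def)
    also have "\<dots> = card {y \<in> Y. E x y} * \<mu> x"
      using finY by (simp add: sum.If_cases Int_def)
    also have "\<dots> \<le> N * \<mu> x"
    proof (rule mult_right_mono)
      have "card {y \<in> Y. E x y} \<le> card {y \<in> V. mdist X x y \<le> R}"
        using V Y by (intro card_mono) (auto simp: E_def)
      then show "real (card {y \<in> Y. E x y}) \<le> real N" using card[of x] x Y by force
    qed (use Y(3)[OF x] in simp)
    finally show ?thesis .
  qed
  define \<kappa> where "\<kappa> = (c/16)\<^sup>2 / real N"
  have Poin: "\<kappa> * (\<Sum>x\<in>Y. \<mu> x * (f x)\<^sup>2) \<le> energy Y a f" if "(\<Sum>x\<in>Y. \<mu> x * f x) = 0" for f
    unfolding \<kappa>_def using that c N Y(3)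
    by (intro Cheeger_Poincare finY as a0 deg iso) (auto intro: less_imp_le)
  have \<kappa>: "0 \<le> \<kappa>" "\<kappa> \<le> 4 * real N"
  proof -
    have "(c/16)\<^sup>2 \<le> 1" using c by (simp add: power_le_one)
    then have "\<kappa> \<le> 1" unfolding \<kappa>_def using N by (simp add: divide_le_eq)
    then show "\<kappa> \<le> 4 * real N" using N by linarith
  qed (simp add: \<kappa>_def)
  have \<kappa>N: "\<kappa> / (4 * real N) = (c/16)\<^sup>2 / (4 * (real N)\<^sup>2)"
    by (simp add: \<kappa>_def power2_eq_square)
  define \<xi> where "\<xi> x = sqrt (\<mu> x / sum \<mu> Y)" for x
  define Q where "Q k x y = ((walk Y a \<mu> (real N)) ^^ k) (\<lambda>z. if z = y then 1 else 0) x" for k x y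
  have \<xi>2: "(\<xi> x)\<^sup>2 = \<mu> x / sum \<mu> Y" if "x \<in> Y" for x
    using Y(2) Y(3)[OF that] by (simp add: \<xi>_def)
  have "(\<xi> x)\<^sup>2 \<le> 2 * \<mu> x" if "x \<in> Y" for x
  proof -
    have "\<mu> x * 1 \<le> \<mu> x * (2 * sum \<mu> Y)"
      using Y(2) Y(3)[OF that] by (intro mult_left_mono) auto
    then show ?thesis using Y(2) that by (simp add: \<xi>2 divide_le_eq algebra_simps)
  qed
  moreover have "0 \<le> \<xi> x" if "x \<in> Y" for x
    using Y(2) Y(3)[OF that] by (simp add: \<xi>_def)
  moreover have "(\<Sum>x\<in>Y. (\<xi> x)\<^sup>2) = 1"
    using Y(2) by (simp add: \<xi>2 sum_divide_distrib[symmetric])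
  moreover have "mdist X x y \<le> real k * R" if "x \<in> Y" "y \<in> Y" "Q k x y \<noteq> 0" for k x y
  proof (rule walk_propagation[where a=a and \<mu>=\<mu> and N="real N" and Y=Y])
    show "mdist X x' y' \<le> R" if "a x' y' \<noteq> 0" for x' y'
      using that by (auto simp: a_def min_conductance_def E_def split: if_splits)
  qed (use that V Y R in \<open>auto simp: Q_def\<close>)
  moreover have "(\<Sum>x\<in>Y. (\<Sum>y\<in>Y. (Q k x y - \<xi> x * \<xi> y) * u y)\<^sup>2)
       \<le> (1 - (c/16)\<^sup>2 / (4 * (real N)\<^sup>2)) ^ k * (\<Sum>y\<in>Y. (u y)\<^sup>2)" for k u
    unfolding Q_def \<xi>_def \<kappa>N[symmetric]
    by (rule walk_funpow_approx) (use finY Yne as a0 deg Y \<kappa> Poin N in auto)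
  ultimately show ?thesis using Y(1) Yne by (intro exI[of _ Y] exI[of _ \<xi>] exI[of _ Q]) blast
qed

subsection \<open>Coarse geometry\<close>

lemma bdd_below_mdist_image: "bdd_below ((\<lambda>(a, b). mdist X a b) ` P)"
  by (rule bdd_belowI[of _ 0]) auto

lemma set_mdist_le: "a \<in> A \<Longrightarrow> b \<in> B \<Longrightarrow> set_mdist X A B \<le> mdist X a b"
  unfolding set_mdist_def
  by (rule cINF_lower2[OF bdd_below_mdist_image, of "(a, b)"]) auto

lemma set_mdist_ge:
  assumes "A \<noteq> {}" "B \<noteq> {}" "\<And>a b. a \<in> A \<Longrightarrow> b \<in> B \<Longrightarrow> r \<le> mdist X a b"
  shows "r \<le> set_mdist X A B"
  unfolding set_mdist_def using assms by (intro cINF_greatest) auto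

lemma set_mdist_attained:
  assumes "A \<noteq> {}" "B \<noteq> {}" "finite A" "finite B"
  shows "\<exists>a\<in>A. \<exists>b\<in>B. set_mdist X A B = mdist X a b"
proof -
  let ?D = "(\<lambda>(a, b). mdist X a b) ` (A \<times> B)"
  have "Inf ?D = Min ?D" using assms by (intro cInf_eq_Min) auto
  also have "\<dots> \<in> ?D" using assms by (intro Min_in) auto
  finally show ?thesis unfolding set_mdist_def by auto
qed

lemma sparse_decomposition_iff:
  "sparse_decomposition X B \<longleftrightarrow>
     (\<Union>n. B n) = mspace X \<and> disjoint_family B \<and> (\<forall>n. finite (B n) \<and> B n \<noteq> {}) \<and>
     (\<forall>R. \<exists>N. \<forall>n m. n \<noteq> m \<and> N \<le> n + m \<longrightarrow> (\<forall>x\<in>B n. \<forall>y\<in>B m. R \<le> mdist X x y))"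
proof -
  have "R \<le> set_mdist X (B n) (B m) \<longleftrightarrow> (\<forall>x\<in>B n. \<forall>y\<in>B m. R \<le> mdist X x y)"
    if "B n \<noteq> {}" "B m \<noteq> {}" for R n m
    using that set_mdist_le set_mdist_ge by (metis order_trans)
  then show ?thesis unfolding sparse_decomposition_def by (auto 4 0)
qed

text \<open>Finiteness turns the infimum in \<open>set_mdist\<close> into a minimum, so the bound
  \<open>R\<close>, which is not strict, is witnessed by a point of \<open>A\<close>.\<close>

lemma outer_boundary_submetric:
  assumes "B \<subseteq> mspace X" "A \<subseteq> B" "A \<noteq> {}" "finite A"
  shows "outer_boundary (submetric X B) R A = {y \<in> B - A. \<exists>x\<in>A. mdist X x y \<le> R}"
proof -
  have "set_mdist (submetric X B) {y} A \<le> R \<longleftrightarrow> (\<exists>x\<in>A. mdist X x y \<le> R)" for y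
  proof
    assume "set_mdist (submetric X B) {y} A \<le> R"
    then show "\<exists>x\<in>A. mdist X x y \<le> R"
      using set_mdist_attained[of "{y}" A "submetric X B"] assms by (auto simp: mdist_commute)
  next
    assume "\<exists>x\<in>A. mdist X x y \<le> R"
    then show "set_mdist (submetric X B) {y} A \<le> R"
      using set_mdist_le[of y "{y}" _ A "submetric X B"] by (force simp: mdist_commute)
  qed
  then show ?thesis using assms by (auto simp: outer_boundary_def)
qed

text \<open>The sets under test have mass at least \<open>\<alpha> > 0\<close>; they are therefore
  nonempty, and their boundaries consist of the outside points within \<open>R\<close> of some point
  of the set.\<close>

lemma measured_asymptotic_expanders_submetric:
  assumes "\<And>n. finite (B n) \<and> B n \<subseteq> mspace X \<and> set_pmf (m n) \<subseteq> B n"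
  shows "measured_asymptotic_expanders (\<lambda>n. submetric X (B n)) m \<longleftrightarrow>
    (\<forall>\<alpha>. 0 < \<alpha> \<and> \<alpha> \<le> 1/2 \<longrightarrow> (\<exists>c R. 0 < c \<and> c < 1 \<and> 0 < R \<and>
      (\<forall>n. \<forall>A \<subseteq> B n. \<alpha> \<le> measure_pmf.prob (m n) A \<and> measure_pmf.prob (m n) A \<le> 1/2 \<longrightarrow>
        c * measure_pmf.prob (m n) A
          < measure_pmf.prob (m n) {y \<in> B n - A. \<exists>x\<in>A. mdist X x y \<le> R})))"
proof -
  have ms: "mspace (submetric X (B n)) = B n" for n using assms[of n] by auto
  have "outer_boundary (submetric X (B n)) R A = {y \<in> B n - A. \<exists>x\<in>A. mdist X x y \<le> R}"
    if "0 < \<alpha>" "A \<subseteq> B n" "\<alpha> \<le> measure_pmf.prob (m n) A" for n R A \<alpha>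
  proof (rule outer_boundary_submetric)
    show "A \<noteq> {}" using that by auto
  qed (use that assms[of n] in \<open>auto intro: finite_subset\<close>)
  note bd = this
  have "(\<forall>n. \<forall>A \<subseteq> B n. \<alpha> \<le> measure_pmf.prob (m n) A \<and> measure_pmf.prob (m n) A \<le> 1/2 \<longrightarrow>
        measure_pmf.prob (m n) (outer_boundary (submetric X (B n)) R A) > c * measure_pmf.prob (m n) A)
     \<longleftrightarrow> (\<forall>n. \<forall>A \<subseteq> B n. \<alpha> \<le> measure_pmf.prob (m n) A \<and> measure_pmf.prob (m n) A \<le> 1/2 \<longrightarrow>
        c * measure_pmf.prob (m n) A
          < measure_pmf.prob (m n) {y \<in> B n - A. \<exists>x\<in>A. mdist X x y \<le> R})"
    if "0 < \<alpha>" for \<alpha> c R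
    using bd[OF that] by (intro iff_allI imp_cong refl) simp
  then show ?thesis unfolding measured_asymptotic_expanders_def ms using assms by (auto 4 0)
qed

lemma ghostly_measured_asymptotic_expanders_imp_sparse:
  "ghostly_measured_asymptotic_expanders X \<Longrightarrow> sparse_space X"
  by (auto simp: ghostly_measured_asymptotic_expanders_def sparse_space_def)

lemma bounded_geometry_submetric:
  assumes "bounded_geometry X"
  shows "bounded_geometry (submetric X S)"
  unfolding bounded_geometry_def
proof (intro allI impI)
  fix R :: real assume "0 < R"
  then obtain N where N: "\<And>x. x \<in> mspace X \<Longrightarrow> finite (mcball_of X x R) \<and> card (mcball_of X x R) \<le> N"
    using assms unfolding bounded_geometry_def by blast
  have "mcball_of (submetric X S) x R \<subseteq> mcball_of X x R" for x by auto
  then show "\<exists>N. \<forall>x\<in>mspace (submetric X S).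
      finite (mcball_of (submetric X S) x R) \<and> card (mcball_of (submetric X S) x R) \<le> N"
    using N by (intro exI[of _ N]) (auto intro: finite_subset order_trans[OF card_mono])
qed

lemma bounded_geometry_imp_discrete:
  assumes "bounded_geometry X" "mspace X \<noteq> {}"
  shows "discrete_space X"
proof -
  interpret Metric_space "mspace X" "mdist X" by (rule Metric_space_mspace_mdist)
  have "openin mtopology {x}" if x: "x \<in> mspace X" for x
  proof -
    have fin: "finite (mcball_of X x 1)" using assms(1) x unfolding bounded_geometry_def by (meson zero_less_one)
    \<comment> \<open>The extra element 1 keeps \<open>D\<close> nonempty when \<open>x\<close> is
      alone in its unit ball, and keeps the ball of radius \<open>Min D\<close> inside that finite
      ball.\<close>
    define D where "D = insert 1 (mdist X x ` (mcball_of X x 1 - {x}))"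
    have D: "finite D" "D \<noteq> {}" using fin by (auto simp: D_def)
    have "0 < d" if "d \<in> D" for d
    proof (cases "d = 1")
      case False
      then have "d \<in> mdist X x ` (mcball_of X x 1 - {x})" using \<open>d \<in> D\<close> by (simp add: D_def)
      then show ?thesis using x by (auto simp: less_le)
    qed simp
    then have "0 < Min D" using D by (simp add: Min_gr_iff)
    moreover have "mball x (Min D) \<subseteq> {x}"
    proof
      fix y assume y: "y \<in> mball x (Min D)"
      show "y \<in> {x}"
      proof (rule ccontr)
        assume "y \<notin> {x}"
        moreover have "mdist X x y < 1" using y D by (auto simp: D_def)
        ultimately have "mdist X x y \<in> D" using y by (auto simp: D_def)
        then show False using y D by (auto simp: Min_gr_iff)
      qed
    qed
    ultimately show ?thesis using x unfolding openin_mtopology by blast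
  qed
  then show ?thesis
    using assms(2) unfolding discrete_space_def mtopology_of_def
    by (metis discrete_topology_unique topspace_mtopology)
qed

text \<open>A form without control functions, convenient one scale at a time. They are recovered
  from the supremum of image distances over pairs at distance at most \<open>t\<close>, and the
  infimum over pairs at distance at least \<open>t\<close>.\<close>

lemma coarse_embedding_iff:
  "coarse_embedding Z X f \<longleftrightarrow> f \<in> mspace Z \<rightarrow> mspace X \<and>
     (\<forall>R. \<exists>S. \<forall>x\<in>mspace Z. \<forall>y\<in>mspace Z. mdist Z x y \<le> R \<longrightarrow> mdist X (f x) (f y) \<le> S) \<and>
     (\<forall>S. \<exists>R. \<forall>x\<in>mspace Z. \<forall>y\<in>mspace Z. mdist X (f x) (f y) \<le> S \<longrightarrow> mdist Z x y \<le> R)"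
  (is "?L \<longleftrightarrow> ?f \<and> ?up \<and> ?lo")
proof
  assume ?L
  then obtain \<rho>1 \<rho>2 where f: ?f and c: "control_function \<rho>1" "control_function \<rho>2" and
    \<rho>: "\<And>x y. x \<in> mspace Z \<Longrightarrow> y \<in> mspace Z \<Longrightarrow>
      \<rho>1 (mdist Z x y) \<le> mdist X (f x) (f y) \<and> mdist X (f x) (f y) \<le> \<rho>2 (mdist Z x y)"
    unfolding coarse_embedding_def by blast
  have mono: "mono_on {0..} \<rho>1" "mono_on {0..} \<rho>2" using c by (auto simp: control_function_def)
  have ?up
  proof
    fix R
    have "\<rho>2 (mdist Z x y) \<le> \<rho>2 (max R 0)" if "mdist Z x y \<le> R" for x y
      using that by (intro mono_onD[OF mono(2)]) auto
    then show "\<exists>S. \<forall>x\<in>mspace Z. \<forall>y\<in>mspace Z. mdist Z x y \<le> R \<longrightarrow> mdist X (f x) (f y) \<le> S"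
      using \<rho> by (meson order_trans)
  qed
  moreover have ?lo
  proof
    fix S
    obtain t where t: "0 \<le> t" "S < \<rho>1 t"
      using c(1) unfolding control_function_def bdd_above_def by (auto simp: not_le)
    have "mdist Z x y \<le> t" if "x \<in> mspace Z" "y \<in> mspace Z" "mdist X (f x) (f y) \<le> S" for x y
    proof (rule ccontr)
      assume "\<not> ?thesis"
      then have "\<rho>1 t \<le> \<rho>1 (mdist Z x y)" using t by (intro mono_onD[OF mono(1)]) auto
      then show False using \<rho>[OF that(1,2)] that(3) t by linarith
    qed
    then show "\<exists>R. \<forall>x\<in>mspace Z. \<forall>y\<in>mspace Z. mdist X (f x) (f y) \<le> S \<longrightarrow> mdist Z x y \<le> R"
      by blast
  qed
  ultimately show "?f \<and> ?up \<and> ?lo" using f by blast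
next
  assume *: "?f \<and> ?up \<and> ?lo"
  \<comment> \<open>The inserted 0 and \<open>t\<close> make supremum and infimum meaningful when no
    pair qualifies. The inserted \<open>t\<close> also makes the lower function unbounded if
    \<open>Z\<close> is bounded; for the upper function this is achieved by the summand
    \<open>t\<close> added to the supremum.\<close>
  define U where "U t = insert 0 {mdist X (f x) (f y) | x y. x \<in> mspace Z \<and> y \<in> mspace Z \<and> mdist Z x y \<le> t}" for t
  define L where "L t = insert t {mdist X (f x) (f y) | x y. x \<in> mspace Z \<and> y \<in> mspace Z \<and> t \<le> mdist Z x y}" for t
  have U: "bdd_above (U t)" for t
  proof -
    obtain S where "\<And>x y. x \<in> mspace Z \<Longrightarrow> y \<in> mspace Z \<Longrightarrow> mdist Z x y \<le> t \<Longrightarrow> mdist X (f x) (f y) \<le> S"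
      using * by blast
    then show ?thesis by (intro bdd_aboveI[of _ "max S 0"]) (auto simp: U_def le_max_iff_disj)
  qed
  have Ubounds: "0 \<le> Sup (U t)" for t using U by (intro cSup_upper) (auto simp: U_def)
  have L: "bdd_below (L t)" if "0 \<le> t" for t
    using that by (intro bdd_belowI[of _ 0]) (auto simp: L_def)
  have "control_function (\<lambda>t. t + Sup (U t))"
    unfolding control_function_def
  proof (intro conjI)
    show "mono_on {0..} (\<lambda>t. t + Sup (U t))"
    proof (rule mono_onI)
      fix r s :: real assume "r \<le> s"
      then have "U r \<subseteq> U s" unfolding U_def by (fastforce intro: order_trans)
      then have "Sup (U r) \<le> Sup (U s)" using U by (intro cSup_subset_mono) (auto simp: U_def)
      then show "r + Sup (U r) \<le> s + Sup (U s)" using \<open>r \<le> s\<close> by linarith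
    qed
    show "\<not> bdd_above ((\<lambda>t. t + Sup (U t)) ` {0..})"
    proof
      assume "bdd_above ((\<lambda>t. t + Sup (U t)) ` {0..})"
      then obtain M where M: "\<And>t. 0 \<le> t \<Longrightarrow> t + Sup (U t) \<le> M" by (auto simp: bdd_above_def)
      show False using M[of "max M 0 + 1"] Ubounds[of "max M 0 + 1"] by linarith
    qed
  qed (use Ubounds in auto)
  moreover have "control_function (\<lambda>t. Inf (L t))"
    unfolding control_function_def
  proof (intro conjI)
    show "(\<lambda>t. Inf (L t)) \<in> {0..} \<rightarrow> {0..}"
      by (auto simp: L_def intro!: cInf_greatest)
    show "mono_on {0..} (\<lambda>t. Inf (L t))"
    proof (rule mono_onI)
      fix r s :: real assume "r \<in> {0..}" "r \<le> s"
      show "Inf (L r) \<le> Inf (L s)"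
      proof (rule cInf_mono)
        fix l assume "l \<in> L s"
        then consider "l = s" | "l \<in> L r" using \<open>r \<le> s\<close> by (fastforce simp: L_def intro: order_trans)
        then show "\<exists>a\<in>L r. a \<le> l" using \<open>r \<le> s\<close> by cases (auto simp: L_def)
      qed (use \<open>r \<in> {0..}\<close> L in \<open>auto simp: L_def\<close>)
    qed
    show "\<not> bdd_above ((\<lambda>t. Inf (L t)) ` {0..})"
    proof
      assume "bdd_above ((\<lambda>t. Inf (L t)) ` {0..})"
      then obtain M where M: "\<And>t. 0 \<le> t \<Longrightarrow> Inf (L t) \<le> M" by (auto simp: bdd_above_def)
      obtain R where R: "\<And>x y. x \<in> mspace Z \<Longrightarrow> y \<in> mspace Z \<Longrightarrow> mdist X (f x) (f y) \<le> M + 1 \<Longrightarrow> mdist Z x y \<le> R"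
        using * by meson
      \<comment> \<open>Pairs at distance at least \<open>t\<close> exceed \<open>R\<close> and so
        have image distance above \<open>M + 1\<close>; the summand \<open>\<bar>M\<bar>\<close>
        makes the inserted element \<open>t\<close> itself large enough.\<close>
      define t where "t = \<bar>R\<bar> + \<bar>M\<bar> + 1"
      have "M + 1 \<le> Inf (L t)"
      proof (rule cInf_greatest)
        fix l assume "l \<in> L t"
        then show "M + 1 \<le> l"
        proof (unfold L_def, elim insertE CollectE exE conjE)
          fix x y assume xy: "l = mdist X (f x) (f y)" "x \<in> mspace Z" "y \<in> mspace Z" "t \<le> mdist Z x y"
          show ?thesis
          proof (rule ccontr)
            assume "\<not> ?thesis"
            then have "mdist Z x y \<le> R" using R xy by auto
            then show False using xy by (auto simp: t_def)
          qed
        qed (auto simp: t_def)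
      qed (auto simp: L_def)
      then show False using M[of t] by (auto simp: t_def)
    qed
  qed
  moreover have "Inf (L (mdist Z x y)) \<le> mdist X (f x) (f y) \<and>
      mdist X (f x) (f y) \<le> mdist Z x y + Sup (U (mdist Z x y))"
    if "x \<in> mspace Z" "y \<in> mspace Z" for x y
  proof -
    have "Inf (L (mdist Z x y)) \<le> mdist X (f x) (f y)"
      using that by (intro cInf_lower L) (auto simp: L_def)
    moreover have "mdist X (f x) (f y) \<le> Sup (U (mdist Z x y))"
      using that by (intro cSup_upper U) (auto simp: U_def)
    ultimately show ?thesis by (simp add: add_increasing)
  qed
  ultimately show ?L unfolding coarse_embedding_def using * by blast
qed

section \<open>Transport along coarse embeddings\<close>

lemma coarse_embedding_compose:
  assumes "coarse_embedding W Z g" "coarse_embedding Z X f"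
  shows "coarse_embedding W X (f \<circ> g)"
proof -
  have g: "g w \<in> mspace Z" if "w \<in> mspace W" for w
    using assms(1) that by (auto simp: coarse_embedding_iff)
  show ?thesis
    unfolding coarse_embedding_iff o_def
  proof (intro conjI allI)
    show "(\<lambda>x. f (g x)) \<in> mspace W \<rightarrow> mspace X"
      using assms by (auto simp: coarse_embedding_iff)
    fix R
    obtain S where "\<forall>x\<in>mspace W. \<forall>y\<in>mspace W. mdist W x y \<le> R \<longrightarrow> mdist Z (g x) (g y) \<le> S"
      using assms(1) unfolding coarse_embedding_iff by meson
    moreover obtain T where "\<forall>x\<in>mspace Z. \<forall>y\<in>mspace Z. mdist Z x y \<le> S \<longrightarrow> mdist X (f x) (f y) \<le> T"
      using assms(2) unfolding coarse_embedding_iff by meson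
    ultimately show "\<exists>S. \<forall>x\<in>mspace W. \<forall>y\<in>mspace W. mdist W x y \<le> R \<longrightarrow> mdist X (f (g x)) (f (g y)) \<le> S"
      using g by blast
  next
    fix S
    obtain R where "\<forall>x\<in>mspace Z. \<forall>y\<in>mspace Z. mdist X (f x) (f y) \<le> S \<longrightarrow> mdist Z x y \<le> R"
      using assms(2) unfolding coarse_embedding_iff by meson
    moreover obtain T where "\<forall>x\<in>mspace W. \<forall>y\<in>mspace W. mdist Z (g x) (g y) \<le> R \<longrightarrow> mdist W x y \<le> T"
      using assms(1) unfolding coarse_embedding_iff by meson
    ultimately show "\<exists>R. \<forall>x\<in>mspace W. \<forall>y\<in>mspace W. mdist X (f (g x)) (f (g y)) \<le> S \<longrightarrow> mdist W x y \<le> R"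
      using g by blast
  qed
qed

text \<open>Coarse density lets \<open>g y\<close> be chosen with \<open>f (g y)\<close> within
  \<open>C\<close> of \<open>y\<close>. Passing from points of \<open>Y\<close> to these images
  changes distances by at most \<open>2 * C\<close>, so the two estimates for \<open>f\<close> turn
  into those for \<open>g\<close> with exchanged roles.\<close>

lemma coarse_equivalence_inverse:
  assumes "coarse_equivalence X Y f"
  shows "\<exists>g. coarse_embedding Y X g"
proof -
  obtain C where "\<forall>y\<in>mspace Y. \<exists>x\<in>mspace X. mdist Y y (f x) \<le> C"
    using assms unfolding coarse_equivalence_def by blast
  then obtain g where g: "\<And>y. y \<in> mspace Y \<Longrightarrow> g y \<in> mspace X \<and> mdist Y y (f (g y)) \<le> C" by metis
  have f: "f x \<in> mspace Y" if "x \<in> mspace X" for x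
    using assms that by (auto simp: coarse_equivalence_def coarse_embedding_iff)
  have close: "mdist Y y y' \<le> mdist Y (f (g y)) (f (g y')) + 2 * C"
    "mdist Y (f (g y)) (f (g y')) \<le> mdist Y y y' + 2 * C"
    if "y \<in> mspace Y" "y' \<in> mspace Y" for y y'
  proof -
    have in_Y: "f (g y) \<in> mspace Y" "f (g y') \<in> mspace Y" using f g that by auto
    have 1: "mdist Y y (f (g y)) \<le> C" "mdist Y y' (f (g y')) \<le> C" using g that by auto
    have "mdist Y y y' \<le> mdist Y y (f (g y)) + mdist Y (f (g y)) y'"
      "mdist Y (f (g y)) y' \<le> mdist Y (f (g y)) (f (g y')) + mdist Y (f (g y')) y'"
      "mdist Y (f (g y)) (f (g y')) \<le> mdist Y (f (g y)) y + mdist Y y (f (g y'))"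
      "mdist Y y (f (g y')) \<le> mdist Y y y' + mdist Y y' (f (g y'))"
      using that in_Y by (intro mdist_triangle; simp)+
    then show "mdist Y y y' \<le> mdist Y (f (g y)) (f (g y')) + 2 * C"
      "mdist Y (f (g y)) (f (g y')) \<le> mdist Y y y' + 2 * C"
      using 1 mdist_commute[of Y y "f (g y)"] mdist_commute[of Y y' "f (g y')"] by linarith+
  qed
  have "coarse_embedding Y X g"
    unfolding coarse_embedding_iff
  proof (intro conjI allI)
    show "g \<in> mspace Y \<rightarrow> mspace X" using g by auto
    fix R
    obtain S where S: "\<forall>x\<in>mspace X. \<forall>y\<in>mspace X. mdist Y (f x) (f y) \<le> R + 2 * C \<longrightarrow> mdist X x y \<le> S"
      using assms unfolding coarse_equivalence_def coarse_embedding_iff by meson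
    have "mdist X (g x) (g y) \<le> S" if "x \<in> mspace Y" "y \<in> mspace Y" "mdist Y x y \<le> R" for x y
      using S g that close(2)[OF that(1,2)] by force
    then show "\<exists>S. \<forall>x\<in>mspace Y. \<forall>y\<in>mspace Y. mdist Y x y \<le> R \<longrightarrow> mdist X (g x) (g y) \<le> S"
      by blast
  next
    fix S
    obtain R where R: "\<forall>x\<in>mspace X. \<forall>y\<in>mspace X. mdist X x y \<le> S \<longrightarrow> mdist Y (f x) (f y) \<le> R"
      using assms unfolding coarse_equivalence_def coarse_embedding_iff by meson
    have "mdist Y x y \<le> R + 2 * C" if "x \<in> mspace Y" "y \<in> mspace Y" "mdist X (g x) (g y) \<le> S" for x y
      using R g that close(1)[OF that(1,2)] by force
    then show "\<exists>R. \<forall>x\<in>mspace Y. \<forall>y\<in>mspace Y. mdist X (g x) (g y) \<le> S \<longrightarrow> mdist Y x y \<le> R"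
      by blast
  qed
  then show ?thesis by blast
qed

lemma prob_Int_superset:
  assumes "set_pmf p \<subseteq> B"
  shows "measure_pmf.prob p (B \<inter> A) = measure_pmf.prob p A"
  using assms by (intro measure_pmf.finite_measure_eq_AE) (auto simp: AE_measure_pmf_iff)

text \<open>The image blocks are pairwise disjoint only after discarding finitely many of them.\<close>

lemma ghostly_expanders_coarse_image:
  assumes bg: "bounded_geometry Z" and gh: "ghostly_measured_asymptotic_expanders Z"
    and ce: "coarse_embedding Z X f"
  shows "\<exists>S\<subseteq>mspace X. ghostly_measured_asymptotic_expanders (submetric X S)"
proof -
  obtain B m where dec: "sparse_decomposition Z B" and supp: "\<And>n. set_pmf (m n) \<subseteq> B n"
    and ghost: "(\<lambda>n. SUP x\<in>B n. pmf (m n) x) \<longlonglongrightarrow> 0"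
    and mae: "measured_asymptotic_expanders (\<lambda>n. submetric Z (B n)) m"
    using gh unfolding ghostly_measured_asymptotic_expanders_def by blast
  have B: "\<And>n. finite (B n)" "\<And>n. B n \<noteq> {}" "\<And>n. B n \<subseteq> mspace Z"
    using dec by (auto simp: sparse_decomposition_iff)
  have f: "f x \<in> mspace X" if "x \<in> mspace Z" for x
    using ce that by (auto simp: coarse_embedding_iff)
  \<comment> \<open>The lower control at scale 0: points with a common image are within
    \<open>r\<close>. This bounds the fibres and, through the choice of \<open>k\<close>, makes the
    images of the remaining blocks disjoint.\<close>
  obtain r where r: "\<And>x y. x \<in> mspace Z \<Longrightarrow> y \<in> mspace Z \<Longrightarrow> mdist X (f x) (f y) \<le> 0 \<Longrightarrow> mdist Z x y \<le> r"
    using ce unfolding coarse_embedding_iff by meson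
  have fiber: "mdist Z x y \<le> r" if "x \<in> mspace Z" "y \<in> mspace Z" "f x = f y" for x y
    using r[OF that(1,2)] that(3) mdist_zero[OF f[OF that(1)] f[OF that(1)]] by simp
  obtain k where k: "\<And>n l. n \<noteq> l \<Longrightarrow> k \<le> n + l \<Longrightarrow> \<forall>x\<in>B n. \<forall>y\<in>B l. r + 1 \<le> mdist Z x y"
    using dec unfolding sparse_decomposition_iff by meson
  \<comment> \<open>Fibres lie in balls of this radius, so they have at most \<open>K\<close>
    points. The maximum with 1 is taken because \<open>r\<close> may fail to be positive.\<close>
  obtain K where K: "\<And>x. x \<in> mspace Z \<Longrightarrow> card (mcball_of Z x (max r 1)) \<le> K \<and> finite (mcball_of Z x (max r 1))"
    using bg unfolding bounded_geometry_def by (metis less_max_iff_disj zero_less_one)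
  define B' where "B' n = f ` B (n + k)" for n
  define m' where "m' n = map_pmf f (m (n + k))" for n
  define S where "S = (\<Union>n. B' n)"
  have S: "S \<subseteq> mspace X" using f subsetD[OF B(3)] by (auto simp: S_def B'_def)
  have B'X: "B' n \<subseteq> mspace X" for n using S by (auto simp: S_def)
  have "sparse_decomposition (submetric X S) B'"
    unfolding sparse_decomposition_iff
  proof (intro conjI allI)
    show "(\<Union>n. B' n) = mspace (submetric X S)" using S by (auto simp: S_def)
    show "disjoint_family B'"
      unfolding disjoint_family_on_def
    proof (intro ballI impI)
      fix n l :: nat assume "n \<noteq> l"
      show "B' n \<inter> B' l = {}"
      proof (rule ccontr)
        assume "B' n \<inter> B' l \<noteq> {}"
        then obtain x y where xy: "x \<in> B (n + k)" "y \<in> B (l + k)" "f x = f y" by (auto simp: B'_def)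
        then have "mdist Z x y \<le> r" using fiber B by blast
        moreover have "r + 1 \<le> mdist Z x y" using k[of "n + k" "l + k"] \<open>n \<noteq> l\<close> xy by auto
        ultimately show False by simp
      qed
    qed
    fix R
    obtain T where T: "\<And>x y. x \<in> mspace Z \<Longrightarrow> y \<in> mspace Z \<Longrightarrow> mdist X (f x) (f y) \<le> R \<Longrightarrow> mdist Z x y \<le> T"
      using ce unfolding coarse_embedding_iff by meson
    obtain N where N: "\<And>n l. n \<noteq> l \<Longrightarrow> N \<le> n + l \<Longrightarrow> \<forall>x\<in>B n. \<forall>y\<in>B l. T + 1 \<le> mdist Z x y"
      using dec unfolding sparse_decomposition_iff by meson
    have "R \<le> mdist X (f x) (f y)" if "n \<noteq> l" "N \<le> n + l" "x \<in> B (n + k)" "y \<in> B (l + k)" for n l x y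
    proof (rule ccontr)
      assume "\<not> ?thesis"
      then have "mdist Z x y \<le> T" using T[of x y] that B by (meson linear subsetD)
      moreover have "T + 1 \<le> mdist Z x y" using N[of "n + k" "l + k"] that by auto
      ultimately show False by simp
    qed
    then show "\<exists>N. \<forall>n l. n \<noteq> l \<and> N \<le> n + l \<longrightarrow> (\<forall>x\<in>B' n. \<forall>y\<in>B' l. R \<le> mdist (submetric X S) x y)"
      by (intro exI[of _ N]) (auto simp: B'_def)
  qed (use B in \<open>auto simp: B'_def\<close>)
  moreover have supp': "set_pmf (m' n) \<subseteq> B' n" for n
    using supp by (auto simp: m'_def B'_def)
  moreover have "(\<lambda>n. SUP x\<in>B' n. pmf (m' n) x) \<longlonglongrightarrow> 0"
  proof (rule tendsto_sandwich[where f="\<lambda>_. 0"])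
    show "(\<lambda>n. real K * (SUP x\<in>B (n + k). pmf (m (n + k)) x)) \<longlonglongrightarrow> 0"
      using tendsto_mult[OF tendsto_const[of "real K"] LIMSEQ_ignore_initial_segment[OF ghost, of k]] by simp
    show "\<forall>\<^sub>F n in sequentially. 0 \<le> (SUP x\<in>B' n. pmf (m' n) x)"
    proof (intro always_eventually allI)
      fix n
      obtain b where "b \<in> B' n" using B(2)[of "n + k"] unfolding B'_def by blast
      then show "0 \<le> (SUP x\<in>B' n. pmf (m' n) x)"
        using B by (intro cSUP_upper2[of _ _ b]) (auto simp: B'_def)
    qed
    show "\<forall>\<^sub>F n in sequentially. (SUP x\<in>B' n. pmf (m' n) x) \<le> real K * (SUP x\<in>B (n + k). pmf (m (n + k)) x)"
    proof (intro always_eventually allI cSUP_least)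
      fix n show "B' n \<noteq> {}" using B by (auto simp: B'_def)
      fix y assume "y \<in> B' n"
      then obtain x where x: "x \<in> B (n + k)" "f x = y" by (auto simp: B'_def)
      let ?F = "B (n + k) \<inter> f -` {y}" and ?s = "SUP x\<in>B (n + k). pmf (m (n + k)) x"
      have "pmf (m' n) y = measure_pmf.prob (m (n + k)) (f -` {y})"
        by (simp add: m'_def pmf_map)
      also have "\<dots> = measure_pmf.prob (m (n + k)) ?F"
        using supp by (rule prob_Int_superset[symmetric])
      also have "\<dots> = (\<Sum>z\<in>?F. pmf (m (n + k)) z)"
        using B by (intro measure_measure_pmf_finite) auto
      also have "\<dots> \<le> (\<Sum>z\<in>?F. ?s)"
        using B by (intro sum_mono cSUP_upper) auto
      also have "\<dots> = card ?F * ?s" by simp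
      also have "\<dots> \<le> K * ?s"
      proof (rule mult_right_mono)
        have xZ: "x \<in> mspace Z" using B x by blast
        have "?F \<subseteq> mcball_of Z x (max r 1)"
          using B x xZ fiber[OF xZ] by (auto simp: le_max_iff_disj dest!: subsetD[OF B(3)])
        then have "card ?F \<le> card (mcball_of Z x (max r 1))"
          using K[OF xZ] by (intro card_mono) auto
        then show "real (card ?F) \<le> real K" using K[OF xZ] by linarith
        show "0 \<le> ?s" using x B by (intro cSUP_upper2[of _ _ x]) auto
      qed
      finally show "pmf (m' n) y \<le> real K * ?s" .
    qed
  qed simp
  moreover have "measured_asymptotic_expanders (\<lambda>n. submetric (submetric X S) (B' n)) m'"
  proof -
    have 1: "finite (B' n) \<and> B' n \<subseteq> mspace (submetric X S) \<and> set_pmf (m' n) \<subseteq> B' n" for n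
      using B B'X supp' by (auto simp: B'_def S_def)
    have 2: "finite (B n) \<and> B n \<subseteq> mspace Z \<and> set_pmf (m n) \<subseteq> B n" for n
      using B supp by auto
    show ?thesis
      unfolding measured_asymptotic_expanders_submetric[of B', OF 1]
    proof (intro allI impI)
      fix \<alpha> :: real assume "0 < \<alpha> \<and> \<alpha> \<le> 1/2"
      then obtain c R where c: "0 < c" "c < 1" "0 < R" and
        exp: "\<And>n A. A \<subseteq> B n \<Longrightarrow> \<alpha> \<le> measure_pmf.prob (m n) A \<Longrightarrow> measure_pmf.prob (m n) A \<le> 1/2 \<Longrightarrow>
          c * measure_pmf.prob (m n) A
            < measure_pmf.prob (m n) {y \<in> B n - A. \<exists>x\<in>A. mdist Z x y \<le> R}"
        using mae unfolding measured_asymptotic_expanders_submetric[of B, OF 2] by meson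
      obtain T where T: "\<And>x y. x \<in> mspace Z \<Longrightarrow> y \<in> mspace Z \<Longrightarrow> mdist Z x y \<le> R \<Longrightarrow> mdist X (f x) (f y) \<le> T"
        using ce unfolding coarse_embedding_iff by meson
      have "c * measure_pmf.prob (m' n) A
          < measure_pmf.prob (m' n) {y \<in> B' n - A. \<exists>x\<in>A. mdist X x y \<le> max T 1}"
        if A: "A \<subseteq> B' n" "\<alpha> \<le> measure_pmf.prob (m' n) A" "measure_pmf.prob (m' n) A \<le> 1/2" for n A
      proof -
        \<comment> \<open>The full preimage within the block: what lies outside it maps outside
          \<open>A\<close>. So its \<open>R\<close>-boundary maps into the boundary of
          \<open>A\<close>, and the constant \<open>c\<close> is preserved.\<close>
        define A' where "A' = B (n + k) \<inter> f -` A"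
        have A': "measure_pmf.prob (m' n) A = measure_pmf.prob (m (n + k)) A'"
          unfolding m'_def measure_map_pmf A'_def using supp by (rule prob_Int_superset[symmetric])
        have "c * measure_pmf.prob (m (n + k)) A'
            < measure_pmf.prob (m (n + k)) {y \<in> B (n + k) - A'. \<exists>x\<in>A'. mdist Z x y \<le> R}"
          using A A' by (intro exp) (auto simp: A'_def)
        also have "\<dots> \<le> measure_pmf.prob (m (n + k)) (f -` {y \<in> B' n - A. \<exists>x\<in>A. mdist X x y \<le> max T 1})"
        proof (rule measure_pmf.finite_measure_mono)
          show "{y \<in> B (n + k) - A'. \<exists>x\<in>A'. mdist Z x y \<le> R}
            \<subseteq> f -` {y \<in> B' n - A. \<exists>x\<in>A. mdist X x y \<le> max T 1}"
            using T B(3)[of "n + k"] by (fastforce simp: A'_def B'_def le_max_iff_disj)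
        qed simp
        finally show ?thesis unfolding A' by (simp only: m'_def measure_map_pmf)
      qed
      then show "\<exists>c R. 0 < c \<and> c < 1 \<and> 0 < R \<and> (\<forall>n. \<forall>A\<subseteq>B' n. \<alpha> \<le> measure_pmf.prob (m' n) A \<and>
          measure_pmf.prob (m' n) A \<le> 1/2 \<longrightarrow> c * measure_pmf.prob (m' n) A
          < measure_pmf.prob (m' n) {y \<in> B' n - A. \<exists>x\<in>A. mdist (submetric X S) x y \<le> R})"
        using c by (intro exI[of _ c] exI[of _ "max T 1"]) auto
    qed
  qed
  ultimately have "ghostly_measured_asymptotic_expanders (submetric X S)"
    unfolding ghostly_measured_asymptotic_expanders_def by blast
  then show ?thesis using S by blast
qed

lemma sparse_space_countable:
  assumes "sparse_space X"
  shows "countable (mspace X)"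
proof -
  obtain B where "sparse_decomposition X B" using assms unfolding sparse_space_def by blast
  then have B: "(\<Union>n. B n) = mspace X" "\<And>n. finite (B n)"
    by (simp_all add: sparse_decomposition_def)
  have "countable (\<Union>n. B n)" using B(2) by (intro countable_UN) (auto intro: countable_finite)
  then show ?thesis by (simp only: B(1))
qed

lemma sparse_space_nonempty:
  assumes "sparse_space X"
  shows "mspace X \<noteq> {}"
proof -
  obtain B where "sparse_decomposition X B" using assms unfolding sparse_space_def by blast
  then have "(\<Union>n. B n) = mspace X" "B 0 \<noteq> {}"
    by (simp_all add: sparse_decomposition_def)
  then show ?thesis by blast
qed

text \<open>From (4) to (3), a subspace \<open>S\<close> of \<open>X\<close> has to be realised
  inside the type \<open>'z\<close>. Being countable, it is copied along an injection
  \<open>j\<close>, with the metric pulled back by the inverse \<open>i\<close>. That the copy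
  contains ghostly expanders is not verified by hand: the result on coarse images is applied to the
  isometry \<open>j\<close>, and the resulting subspace \<open>S'\<close> embeds into
  \<open>X\<close> by \<open>i\<close>.\<close>

lemma no_embedded_expanders_iff:
  fixes X :: "'a metric"
  assumes "bounded_geometry X" "infinite (UNIV :: 'z set)"
  shows "no_embedded_expanders TYPE('z) X \<longleftrightarrow> no_expander_subspace X"
proof (rule iffI; rule ccontr)
  assume "no_expander_subspace X" "\<not> no_embedded_expanders TYPE('z) X"
  then obtain Z :: "'z metric" and f where "bounded_geometry Z" "ghostly_measured_asymptotic_expanders Z"
    "coarse_embedding Z X f"
    unfolding no_embedded_expanders_def by blast
  from ghostly_expanders_coarse_image[OF this] \<open>no_expander_subspace X\<close> show False
    using ghostly_measured_asymptotic_expanders_imp_sparse unfolding no_expander_subspace_def by blast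
next
  assume emb: "no_embedded_expanders TYPE('z) X" and "\<not> no_expander_subspace X"
  then obtain S where S: "S \<subseteq> mspace X" "sparse_space (submetric X S)"
    "ghostly_measured_asymptotic_expanders (submetric X S)"
    unfolding no_expander_subspace_def by blast
  have mS: "mspace (submetric X S) = S" using S by auto
  have "countable S" using sparse_space_countable[OF S(2)] mS by simp
  obtain g :: "nat \<Rightarrow> 'z" where "inj g"
    using assms(2) infinite_countable_subset by blast
  define j where "j = g \<circ> to_nat_on S"
  have j: "inj_on j S"
    unfolding j_def using \<open>countable S\<close> \<open>inj g\<close> by (intro comp_inj_on) (auto intro: inj_on_subset)
  define i where "i = inv_into S j"
  have i: "i (j x) = x" if "x \<in> S" for x using j that by (simp add: i_def)
  have "Metric_space (j ` S) (\<lambda>a b. mdist X (i a) (i b))"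
  proof
    fix a b assume "a \<in> j ` S" "b \<in> j ` S"
    then obtain x y where "a = j x" "b = j y" "x \<in> S" "y \<in> S" by blast
    then show "mdist X (i a) (i b) = 0 \<longleftrightarrow> a = b"
      using mdist_zero[of x X y] subsetD[OF S(1)] i j by (auto simp: inj_on_eq_iff)
  qed (use S(1) i in \<open>auto simp: mdist_commute intro!: mdist_triangle\<close>)
  then have Z: "mspace (metric (j ` S, \<lambda>a b. mdist X (i a) (i b))) = j ` S"
      "mdist (metric (j ` S, \<lambda>a b. mdist X (i a) (i b))) = (\<lambda>a b. mdist X (i a) (i b))"
    by (simp_all add: Metric_space.mspace_metric Metric_space.mdist_metric)
  define Z where "Z = metric (j ` S, \<lambda>a b. mdist X (i a) (i b))"
  note Z = Z[folded Z_def]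
  have "coarse_embedding (submetric X S) Z j"
    unfolding coarse_embedding_iff mS using i by (auto simp: Z)
  then obtain S' where S': "S' \<subseteq> mspace Z" "ghostly_measured_asymptotic_expanders (submetric Z S')"
    using ghostly_expanders_coarse_image[OF bounded_geometry_submetric[OF assms(1)] S(3)] by blast
  have "coarse_embedding (submetric Z S') X i"
    unfolding coarse_embedding_iff using S' S(1) i by (auto simp: Z)
  moreover have bgZ: "bounded_geometry Z"
    unfolding bounded_geometry_def
  proof (intro allI impI)
    fix R :: real assume "0 < R"
    then obtain N where N: "\<And>x. x \<in> mspace X \<Longrightarrow> finite (mcball_of X x R) \<and> card (mcball_of X x R) \<le> N"
      using assms(1) unfolding bounded_geometry_def by blast
    have "finite (mcball_of Z z R) \<and> card (mcball_of Z z R) \<le> N" if "z \<in> mspace Z" for z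
    proof -
      have inj: "inj_on i (mcball_of Z z R)" using i by (auto simp: Z inj_on_def)
      moreover have "i ` mcball_of Z z R \<subseteq> mcball_of X (i z) R"
        using i subsetD[OF S(1)] by (auto simp: Z)
      moreover have "i z \<in> mspace X" using that i S(1) by (auto simp: Z)
      ultimately show ?thesis
        using N by (meson card_inj_on_le finite_subset finite_imageD order_trans)
    qed
    then show "\<exists>N. \<forall>x\<in>mspace Z. finite (mcball_of Z x R) \<and> card (mcball_of Z x R) \<le> N" by blast
  qed
  moreover have "sparse_space (submetric Z S')"
    using S'(2) by (rule ghostly_measured_asymptotic_expanders_imp_sparse)
  ultimately show False
    using emb S'(2) bounded_geometry_submetric[OF bgZ]
      bounded_geometry_imp_discrete[OF bounded_geometry_submetric[OF bgZ] sparse_space_nonempty]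
    unfolding no_embedded_expanders_def by blast
qed

lemma no_embedded_expanders_coarse_embedding:
  assumes "coarse_embedding X Y f" "no_embedded_expanders TYPE('z) Y"
  shows "no_embedded_expanders TYPE('z) X"
  using assms(2) coarse_embedding_compose[OF _ assms(1)]
  unfolding no_embedded_expanders_def by blast

subsection \<open>Square-summable functions and bounded operators\<close>

lemma norm_cscale:
  fixes x :: "'h::complex_hilbert"
  shows "norm (a *\<^sub>C x) = cmod a * norm x"
proof -
  have "complex_of_real ((norm (a *\<^sub>C x))\<^sup>2) = a * cnj (cinner (a *\<^sub>C x) x)"
    by (metis cinner_self cinner_cscale_left cinner_commute)
  also have "\<dots> = (a * cnj a) * cnj (cinner x x)" by (simp add: cinner_cscale_left)
  also have "\<dots> = complex_of_real ((cmod a * norm x)\<^sup>2)"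
    by (simp add: cinner_self complex_norm_square[symmetric] power_mult_distrib)
  finally have "(norm (a *\<^sub>C x))\<^sup>2 = (cmod a * norm x)\<^sup>2" by (simp only: of_real_eq_iff)
  then show ?thesis by (simp add: power2_eq_iff_nonneg)
qed

lemma cinner_cscale_right:
  fixes x :: "'h::complex_hilbert"
  shows "cinner x (a *\<^sub>C y) = cnj a * cinner x y"
  by (metis cinner_commute cinner_cscale_left complex_cnj_mult)

lemma cinner_add_right:
  fixes x :: "'h::complex_hilbert"
  shows "cinner x (y + z) = cinner x y + cinner x z"
  by (metis cinner_add_left cinner_commute complex_cnj_add)

lemma cinner_zero_left [simp]: "cinner (0::'h::complex_hilbert) y = 0"
  using cinner_add_left[of 0 0 y] by simp

text \<open>Cauchy-Schwarz by Pythagoras: \<open>w\<close> is the component of \<open>h\<close>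
  orthogonal to \<open>e\<close>, and its squared norm is the difference of the two squares.\<close>

lemma cinner_bound_unit:
  fixes e :: "'h::complex_hilbert"
  assumes "norm e = 1"
  shows "cmod (cinner h e) \<le> norm h"
proof -
  define c where "c = cinner h e"
  define w where "w = h + (- c) *\<^sub>C e"
  have "cinner w e = 0"
    unfolding w_def cinner_add_left cinner_cscale_left using assms by (simp add: cinner_self c_def)
  have "cinner w w = cinner w h + cnj (- c) * cinner w e"
    by (subst (2) w_def) (simp only: cinner_add_right cinner_cscale_right)
  also have "\<dots> = cinner w h" by (simp add: \<open>cinner w e = 0\<close>)
  also have "\<dots> = complex_of_real ((norm h)\<^sup>2) - c * cnj c"
    unfolding w_def cinner_add_left cinner_cscale_left by (simp add: cinner_self c_def cinner_commute[of e h])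
  finally have "complex_of_real ((norm w)\<^sup>2) = complex_of_real ((norm h)\<^sup>2 - (cmod c)\<^sup>2)"
    unfolding of_real_diff complex_norm_square by (simp only: cinner_self)
  then have "(norm w)\<^sup>2 = (norm h)\<^sup>2 - (cmod c)\<^sup>2" by (simp only: of_real_eq_iff)
  then have "(cmod c)\<^sup>2 \<le> (norm h)\<^sup>2" using zero_le_power2[of "norm w"] by linarith
  then show ?thesis unfolding c_def by (rule power2_le_imp_le) simp
qed

text \<open>Serves to see that a disc of multiples of \<open>e\<close> is compact.\<close>

lemma continuous_on_cscale_left: "continuous_on (A :: complex set) (\<lambda>z. z *\<^sub>C (e::'h::complex_hilbert))"
proof (rule continuous_on_iff[THEN iffD2], intro ballI allI impI)
  fix x :: complex and \<epsilon> :: real assume "0 < \<epsilon>"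
  have d: "dist (y *\<^sub>C e) (x *\<^sub>C e) = dist y x * norm e" for y x
    by (simp add: dist_norm complex_hilbert.scale_left_diff_distrib[symmetric] norm_cscale)
  have "dist y x * norm e < \<epsilon>" if "dist y x < \<epsilon> / (norm e + 1)" for y
  proof -
    have "dist y x * norm e \<le> dist y x * (norm e + 1)" by (intro mult_left_mono) auto
    also have "\<dots> < \<epsilon>" using that by (simp add: less_divide_eq add_pos_nonneg add.commute)
    finally show ?thesis .
  qed
  then show "\<exists>d>0. \<forall>x'\<in>A. dist x' x < d \<longrightarrow> dist (x' *\<^sub>C e) (x *\<^sub>C e) < \<epsilon>"
    using \<open>0 < \<epsilon>\<close> by (intro exI[of _ "\<epsilon> / (norm e + 1)"]) (auto simp: d add_nonneg_pos)
qed

section \<open>Norm estimates by finite partial sums\<close>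

lemma l2_norm_power2: "(l2_norm S \<eta>)\<^sup>2 = (\<Sum>\<^sub>\<infinity>x\<in>S. (norm (\<eta> x))\<^sup>2)"
  unfolding l2_norm_def by (simp add: infsum_nonneg)

lemma l2_norm_nonneg: "0 \<le> l2_norm S \<eta>"
  unfolding l2_norm_def by (simp add: infsum_nonneg)

lemma l2_finite_sum_le:
  assumes "\<eta> \<in> l2 S" "finite F" "F \<subseteq> S"
  shows "(\<Sum>x\<in>F. (norm (\<eta> x))\<^sup>2) \<le> (l2_norm S \<eta>)\<^sup>2"
  unfolding l2_norm_power2 using assms by (intro finite_sum_le_infsum) (auto simp: l2_def)

text \<open>Reduces membership in \<open>l2\<close> and norm bounds to uniform estimates of finite
  sums, the form in which the later operator bounds are proved.\<close>

lemma l2_bounded_finite_sums: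
  assumes "\<And>x. x \<notin> S \<Longrightarrow> \<zeta> x = 0"
    and "\<And>F. finite F \<Longrightarrow> F \<subseteq> S \<Longrightarrow> (\<Sum>x\<in>F. (norm (\<zeta> x))\<^sup>2) \<le> C"
  shows "\<zeta> \<in> l2 S" "(l2_norm S \<zeta>)\<^sup>2 \<le> C"
proof -
  have s: "(\<lambda>x. (norm (\<zeta> x))\<^sup>2) summable_on S"
    using assms by (intro nonneg_bdd_above_summable_on) (auto intro!: bdd_aboveI[of _ C])
  then show "\<zeta> \<in> l2 S" using assms by (auto simp: l2_def)
  show "(l2_norm S \<zeta>)\<^sup>2 \<le> C"
    unfolding l2_norm_power2 using assms by (intro infsum_le_finite_sums s) auto
qed

lemma l2_finite_support:
  assumes "finite F" "F \<subseteq> S" "\<And>x. x \<notin> F \<Longrightarrow> \<eta> x = 0"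
  shows "\<eta> \<in> l2 S" "(l2_norm S \<eta>)\<^sup>2 = (\<Sum>x\<in>F. (norm (\<eta> x))\<^sup>2)"
proof -
  have b: "(\<Sum>x\<in>G. (norm (\<eta> x))\<^sup>2) \<le> (\<Sum>x\<in>F. (norm (\<eta> x))\<^sup>2)" if "finite G" for G
  proof -
    have "(\<Sum>x\<in>G. (norm (\<eta> x))\<^sup>2) = (\<Sum>x\<in>G \<inter> F. (norm (\<eta> x))\<^sup>2)"
      using that assms(3) by (intro sum.mono_neutral_right) auto
    also have "\<dots> \<le> (\<Sum>x\<in>F. (norm (\<eta> x))\<^sup>2)" using assms by (intro sum_mono2) auto
    finally show ?thesis .
  qed
  show 1: "\<eta> \<in> l2 S"
    by (rule l2_bounded_finite_sums(1)[where C="\<Sum>x\<in>F. (norm (\<eta> x))\<^sup>2"]) (use b assms in auto)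
  have "(l2_norm S \<eta>)\<^sup>2 \<le> (\<Sum>x\<in>F. (norm (\<eta> x))\<^sup>2)"
    by (rule l2_bounded_finite_sums(2)) (use b assms in auto)
  moreover have "(\<Sum>x\<in>F. (norm (\<eta> x))\<^sup>2) \<le> (l2_norm S \<eta>)\<^sup>2"
    using 1 assms by (intro l2_finite_sum_le) auto
  ultimately show "(l2_norm S \<eta>)\<^sup>2 = (\<Sum>x\<in>F. (norm (\<eta> x))\<^sup>2)" by simp
qed

text \<open>The pointwise estimate (a + b)^2 \<le> 2 a^2 + 2 b^2 takes the place of the triangle
  inequality; the aim is membership and some finite bound.\<close>

lemma l2_diff:
  fixes \<eta> \<zeta> :: "'a \<Rightarrow> 'h::complex_hilbert"
  assumes "\<eta> \<in> l2 S" "\<zeta> \<in> l2 S"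
  shows "(\<lambda>x. \<eta> x - \<zeta> x) \<in> l2 S"
    and "(l2_norm S (\<lambda>x. \<eta> x - \<zeta> x))\<^sup>2 \<le> 2 * (l2_norm S \<eta>)\<^sup>2 + 2 * (l2_norm S \<zeta>)\<^sup>2"
proof -
  have pt: "(norm (\<eta> x - \<zeta> x))\<^sup>2 \<le> 2 * (norm (\<eta> x))\<^sup>2 + 2 * (norm (\<zeta> x))\<^sup>2" for x
  proof -
    have "(norm (\<eta> x - \<zeta> x))\<^sup>2 \<le> (norm (\<eta> x) + norm (\<zeta> x))\<^sup>2"
      by (intro power_mono norm_triangle_ineq4) auto
    also have "\<dots> \<le> 2 * (norm (\<eta> x))\<^sup>2 + 2 * (norm (\<zeta> x))\<^sup>2"
      using zero_le_power2[of "norm (\<eta> x) - norm (\<zeta> x)"] by (simp add: power2_eq_square algebra_simps)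
    finally show ?thesis .
  qed
  have b: "(\<Sum>x\<in>F. (norm (\<eta> x - \<zeta> x))\<^sup>2) \<le> 2 * (l2_norm S \<eta>)\<^sup>2 + 2 * (l2_norm S \<zeta>)\<^sup>2"
    if "finite F" "F \<subseteq> S" for F
  proof -
    have "(\<Sum>x\<in>F. (norm (\<eta> x - \<zeta> x))\<^sup>2) \<le> (\<Sum>x\<in>F. 2 * (norm (\<eta> x))\<^sup>2 + 2 * (norm (\<zeta> x))\<^sup>2)"
      by (intro sum_mono pt)
    also have "\<dots> = 2 * (\<Sum>x\<in>F. (norm (\<eta> x))\<^sup>2) + 2 * (\<Sum>x\<in>F. (norm (\<zeta> x))\<^sup>2)"
      by (simp add: sum.distrib sum_distrib_left)
    also have "\<dots> \<le> 2 * (l2_norm S \<eta>)\<^sup>2 + 2 * (l2_norm S \<zeta>)\<^sup>2"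
      using l2_finite_sum_le[OF assms(1) that] l2_finite_sum_le[OF assms(2) that] by linarith
    finally show ?thesis .
  qed
  have z: "\<eta> x - \<zeta> x = 0" if "x \<notin> S" for x using assms that by (simp add: l2_def)
  show "(\<lambda>x. \<eta> x - \<zeta> x) \<in> l2 S"
    by (rule l2_bounded_finite_sums(1)) (use z b in blast)+
  show "(l2_norm S (\<lambda>x. \<eta> x - \<zeta> x))\<^sup>2 \<le> 2 * (l2_norm S \<eta>)\<^sup>2 + 2 * (l2_norm S \<zeta>)\<^sup>2"
    by (rule l2_bounded_finite_sums(2)) (use z b in blast)+
qed

lemma bounded_operator_l2: "T \<in> bounded_operators S \<Longrightarrow> \<eta> \<in> l2 S \<Longrightarrow> T \<eta> \<in> l2 S"
  unfolding bounded_operators_def by auto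

lemma bounded_operator_add:
  "T \<in> bounded_operators S \<Longrightarrow> \<eta> \<in> l2 S \<Longrightarrow> \<zeta> \<in> l2 S \<Longrightarrow>
    T (\<lambda>x. \<eta> x + \<zeta> x) = (\<lambda>x. T \<eta> x + T \<zeta> x)"
  unfolding bounded_operators_def by simp

lemma bounded_operator_cscale:
  "T \<in> bounded_operators S \<Longrightarrow> \<eta> \<in> l2 S \<Longrightarrow> T (\<lambda>x. a *\<^sub>C \<eta> x) = (\<lambda>x. a *\<^sub>C T \<eta> x)"
  unfolding bounded_operators_def by simp

lemma bounded_operator_bound:
  assumes "T \<in> bounded_operators S"
  shows "\<exists>K\<ge>0. \<forall>\<eta>\<in>l2 S. l2_norm S (T \<eta>) \<le> K * l2_norm S \<eta>"
proof -
  obtain K where K: "\<forall>\<eta>\<in>l2 S. l2_norm S (T \<eta>) \<le> K * l2_norm S \<eta>"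
    using assms unfolding bounded_operators_def by auto
  have "K * l2_norm S \<eta> \<le> \<bar>K\<bar> * l2_norm S \<eta>" for \<eta> :: "'a \<Rightarrow> 'b"
    by (intro mult_right_mono l2_norm_nonneg) simp
  then show ?thesis using K by (intro exI[of _ "\<bar>K\<bar>"]) (force intro: order_trans)
qed

text \<open>\<open>l2_op_norm\<close> is a supremum of reals, so it dominates the individual values
  only once the set is known to be bounded; this is extracted from the bounds of the two
  operators.\<close>

lemma l2_op_norm_diff_upper:
  assumes "T \<in> bounded_operators S" "T' \<in> bounded_operators S" "\<eta> \<in> l2 S" "l2_norm S \<eta> \<le> 1"
  shows "l2_norm S (\<lambda>x. T \<eta> x - T' \<eta> x) \<le> l2_op_norm S (\<lambda>\<eta> x. T \<eta> x - T' \<eta> x)"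
proof -
  obtain K where K: "0 \<le> K" "\<And>\<eta>. \<eta> \<in> l2 S \<Longrightarrow> l2_norm S (T \<eta>) \<le> K * l2_norm S \<eta>"
    using bounded_operator_bound[OF assms(1)] by blast
  obtain K' where K': "0 \<le> K'" "\<And>\<eta>. \<eta> \<in> l2 S \<Longrightarrow> l2_norm S (T' \<eta>) \<le> K' * l2_norm S \<eta>"
    using bounded_operator_bound[OF assms(2)] by blast
  have TT: "T \<eta> \<in> l2 S" "T' \<eta> \<in> l2 S" if "\<eta> \<in> l2 S" for \<eta>
    using assms(1,2) that by (auto intro: bounded_operator_l2)
  have le: "l2_norm S (\<lambda>x. T \<eta> x - T' \<eta> x) \<le> sqrt (2 * K\<^sup>2 + 2 * K'\<^sup>2)"
    if \<eta>: "\<eta> \<in> l2 S" "l2_norm S \<eta> \<le> 1" for \<eta>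
  proof (rule real_le_rsqrt)
    have "K * l2_norm S \<eta> \<le> K" "K' * l2_norm S \<eta> \<le> K'"
      using \<eta>(2) K(1) K'(1) by (auto simp: mult_left_le)
    then have "l2_norm S (T \<eta>) \<le> K" "l2_norm S (T' \<eta>) \<le> K'"
      using K(2)[OF \<eta>(1)] K'(2)[OF \<eta>(1)] by linarith+
    then have "(l2_norm S (T \<eta>))\<^sup>2 \<le> K\<^sup>2" "(l2_norm S (T' \<eta>))\<^sup>2 \<le> K'\<^sup>2"
      by (auto intro!: power_mono l2_norm_nonneg)
    then show "(l2_norm S (\<lambda>x. T \<eta> x - T' \<eta> x))\<^sup>2 \<le> 2 * K\<^sup>2 + 2 * K'\<^sup>2"
      using l2_diff(2)[OF TT[OF \<eta>(1)]] by linarith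
  qed
  show ?thesis
    unfolding l2_op_norm_def
    by (rule cSUP_upper) (use assms(3,4) le in \<open>auto intro!: bdd_aboveI[of _ "sqrt (2 * K\<^sup>2 + 2 * K'\<^sup>2)"]\<close>)
qed

lemma bounded_operator_finite_support:
  assumes T: "T \<in> bounded_operators S" and "finite F" "F \<subseteq> S"
  shows "T (\<lambda>z. if z \<in> F then \<eta> z else 0) x = (\<Sum>y\<in>F. matrix_entry T x y (\<eta> y))"
  using assms(2,3)
proof (induction F rule: finite_induct)
  case empty
  have "(\<lambda>x. 0) \<in> l2 S" by (rule l2_finite_support[of "{}"]) auto
  from bounded_operator_cscale[OF T this, of 0]
  show ?case by simp
next
  case (insert y F)
  have eq: "(\<lambda>z. if z \<in> insert y F then \<eta> z else 0)
      = (\<lambda>z. (if z = y then \<eta> y else 0) + (if z \<in> F then \<eta> z else 0))"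
    using insert.hyps by (auto simp: fun_eq_iff)
  have "(\<lambda>z. if z = y then \<eta> y else 0) \<in> l2 S"
    using insert.prems by (intro l2_finite_support(1)[of "{y}"]) auto
  moreover have "(\<lambda>z. if z \<in> F then \<eta> z else 0) \<in> l2 S"
    using insert by (intro l2_finite_support(1)[of F]) auto
  ultimately have "T (\<lambda>z. if z \<in> insert y F then \<eta> z else 0)
      = (\<lambda>x. T (\<lambda>z. if z = y then \<eta> y else 0) x + T (\<lambda>z. if z \<in> F then \<eta> z else 0) x)"
    unfolding eq by (rule bounded_operator_add[OF T])
  then show ?case using insert by (simp add: matrix_entry_def)
qed

subsection \<open>Ghost projections yield expanders\<close>

text \<open>Test \<open>P - T\<close> on the restriction of \<open>\<xi> n\<close> to \<open>D\<close>: on \<open>A\<close>, the value of \<open>P\<close> is the mass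
  of \<open>D\<close> times \<open>\<xi> n\<close>, while \<open>T\<close> contributes nothing.\<close>

lemma block_projection_corner_bound:
  fixes P :: "('a \<Rightarrow> 'h::complex_hilbert) \<Rightarrow> ('a \<Rightarrow> 'h)"
  assumes P: "block_rank_one_projection X B \<xi> P"
    and T: "T \<in> bounded_operators (mspace X)"
    and small: "l2_op_norm (mspace X) (\<lambda>\<eta> x. P \<eta> x - T \<eta> x) < \<epsilon>"
    and AD: "A \<subseteq> B n" "D \<subseteq> B n" "\<And>x y. x \<in> A \<Longrightarrow> y \<in> D \<Longrightarrow> matrix_entry T x y = (\<lambda>h. 0)"
  shows "(\<Sum>x\<in>D. (norm (\<xi> n x))\<^sup>2)\<^sup>2 * (\<Sum>x\<in>A. (norm (\<xi> n x))\<^sup>2) \<le> \<epsilon>\<^sup>2"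
proof -
  have dec: "finite (B n)" "B n \<subseteq> mspace X"
    using P by (auto simp: block_rank_one_projection_def sparse_decomposition_def)
  have Pb: "P \<in> bounded_operators (mspace X)"
    and Pn: "\<And>\<eta>. \<eta> \<in> l2 (mspace X) \<Longrightarrow>
      restrict_to (B n) (P \<eta>) = rank_one_projection (B n) (\<xi> n) (restrict_to (B n) \<eta>)"
    using P by (auto simp: block_rank_one_projection_def is_direct_sum_def)
  have unit: "(\<Sum>x\<in>B n. (norm (\<xi> n x))\<^sup>2) = 1"
    using P l2_norm_power2[of "B n" "\<xi> n"] dec by (simp add: block_rank_one_projection_def)
  have fin: "finite A" "finite D" "A \<subseteq> mspace X" "D \<subseteq> mspace X"
    using AD dec finite_subset by blast+
  define \<eta> where "\<eta> z = (if z \<in> D then \<xi> n z else 0)" for z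
  define d where "d = (\<Sum>x\<in>D. (norm (\<xi> n x))\<^sup>2)"
  have \<eta>: "\<eta> \<in> l2 (mspace X)" "(l2_norm (mspace X) \<eta>)\<^sup>2 = d"
    using l2_finite_support[of D "mspace X" \<eta>] fin by (auto simp: \<eta>_def d_def)
  have "d \<le> 1" unfolding d_def unit[symmetric] using AD dec by (intro sum_mono2) auto
  then have "l2_norm (mspace X) \<eta> \<le> 1" using \<eta>(2) by (simp add: power2_le_iff_abs_le abs_le_square_iff[symmetric] power2_le_imp_le)
  then have "l2_norm (mspace X) (\<lambda>x. P \<eta> x - T \<eta> x) < \<epsilon>"
    using l2_op_norm_diff_upper[OF Pb T \<eta>(1)] small by linarith
  then have sq: "(l2_norm (mspace X) (\<lambda>x. P \<eta> x - T \<eta> x))\<^sup>2 \<le> \<epsilon>\<^sup>2"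
    using l2_norm_nonneg by (intro power_mono) auto
  have T0: "T \<eta> x = 0" if "x \<in> A" for x
  proof -
    have "T \<eta> x = (\<Sum>y\<in>D. matrix_entry T x y (\<xi> n y))"
      unfolding \<eta>_def[abs_def] using fin T by (intro bounded_operator_finite_support) auto
    then show ?thesis using AD(3)[OF that] by simp
  qed
  have P1: "P \<eta> x = complex_of_real d *\<^sub>C \<xi> n x" if "x \<in> B n" for x
  proof -
    have "P \<eta> x = l2_inner (B n) (restrict_to (B n) \<eta>) (\<xi> n) *\<^sub>C \<xi> n x"
      using fun_cong[OF Pn[OF \<eta>(1)], of x] that by (simp add: restrict_to_def rank_one_projection_def)
    also have "l2_inner (B n) (restrict_to (B n) \<eta>) (\<xi> n) = (\<Sum>x\<in>D. cinner (\<xi> n x) (\<xi> n x))"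
      unfolding l2_inner_def using dec AD
      by (simp, intro sum.mono_neutral_cong_right) (auto simp: restrict_to_def \<eta>_def)
    also have "\<dots> = complex_of_real d" by (simp add: cinner_self d_def)
    finally show ?thesis .
  qed
  have "d\<^sup>2 * (\<Sum>x\<in>A. (norm (\<xi> n x))\<^sup>2) = (\<Sum>x\<in>A. (norm (P \<eta> x - T \<eta> x))\<^sup>2)"
    unfolding sum_distrib_left
  proof (rule sum.cong[OF refl])
    fix x assume "x \<in> A"
    then show "d\<^sup>2 * (norm (\<xi> n x))\<^sup>2 = (norm (P \<eta> x - T \<eta> x))\<^sup>2"
      using T0 P1 AD(1) by (auto simp: norm_cscale power_mult_distrib subset_iff)
  qed
  also have "\<dots> \<le> (l2_norm (mspace X) (\<lambda>x. P \<eta> x - T \<eta> x))\<^sup>2"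
    using fin \<eta>(1) by (intro l2_finite_sum_le l2_diff(1) bounded_operator_l2[OF Pb] bounded_operator_l2[OF T])
  finally show ?thesis using sq by (simp add: d_def)
qed

text \<open>If the boundary had at most half the mass of \<open>A\<close>, the rest \<open>D\<close>
  of the block would keep mass at least 1 - 1/2 - 1/4 = 1/4. It is farther from \<open>A\<close>
  than the propagation of the approximant \<open>T\<close>, so the corner bound forces (1/4)^2
  \<alpha> below the square of the approximation error.\<close>

lemma block_projection_expanders:
  fixes P :: "('a \<Rightarrow> 'h::complex_hilbert) \<Rightarrow> ('a \<Rightarrow> 'h)"
  assumes P: "block_rank_one_projection X B \<xi> P"
    and cl: "P \<in> operator_norm_closure (mspace X) {T \<in> bounded_operators (mspace X). finite_propagation X T}"
    and \<alpha>: "0 < \<alpha>"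
  shows "\<exists>R>0. \<forall>n. \<forall>A\<subseteq>B n. \<alpha> \<le> (\<Sum>x\<in>A. (norm (\<xi> n x))\<^sup>2) \<and> (\<Sum>x\<in>A. (norm (\<xi> n x))\<^sup>2) \<le> 1/2 \<longrightarrow>
    1/2 * (\<Sum>x\<in>A. (norm (\<xi> n x))\<^sup>2) < (\<Sum>y | y \<in> B n - A \<and> (\<exists>x\<in>A. mdist X x y \<le> R). (norm (\<xi> n y))\<^sup>2)"
proof -
  \<comment> \<open>The square \<alpha>/25 of this error is less than (1/4)^2 \<alpha> =
    \<alpha>/16.\<close>
  have "0 < sqrt \<alpha> / 5" using \<alpha> by simp
  then obtain T where T: "T \<in> bounded_operators (mspace X)" "finite_propagation X T"
      and close: "l2_op_norm (mspace X) (\<lambda>\<eta> x. P \<eta> x - T \<eta> x) < sqrt \<alpha> / 5"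
    using cl unfolding operator_norm_closure_def by blast
  obtain R0 where R0: "\<And>x y. x \<in> mspace X \<Longrightarrow> y \<in> mspace X \<Longrightarrow> matrix_entry T x y \<noteq> (\<lambda>h. 0) \<Longrightarrow> mdist X x y \<le> R0"
    using T(2) unfolding finite_propagation_def bdd_above_def by blast
  define R where "R = max R0 1"
  have "1/2 * (\<Sum>x\<in>A. (norm (\<xi> n x))\<^sup>2) < (\<Sum>y | y \<in> B n - A \<and> (\<exists>x\<in>A. mdist X x y \<le> R). (norm (\<xi> n y))\<^sup>2)"
    if A: "A \<subseteq> B n" "\<alpha> \<le> (\<Sum>x\<in>A. (norm (\<xi> n x))\<^sup>2)" "(\<Sum>x\<in>A. (norm (\<xi> n x))\<^sup>2) \<le> 1/2" for n A
  proof (rule ccontr)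
    let ?m = "\<lambda>A. \<Sum>x\<in>A. (norm (\<xi> n x))\<^sup>2"
    define bd where "bd = {y. y \<in> B n - A \<and> (\<exists>x\<in>A. mdist X x y \<le> R)}"
    assume "\<not> ?thesis"
    then have bd: "?m bd \<le> 1/4" using A(3) by (simp add: bd_def)
    have dec: "finite (B n)" "B n \<subseteq> mspace X"
      using P by (auto simp: block_rank_one_projection_def sparse_decomposition_def)
    have unit: "?m (B n) = 1"
      using P l2_norm_power2[of "B n" "\<xi> n"] dec by (simp add: block_rank_one_projection_def)
    define D where "D = B n - A - bd"
    have "?m D = ?m (B n) - ?m A - ?m bd"
      unfolding D_def using dec A(1) by (subst sum_diff, auto simp: bd_def)+
    then have D: "1/4 \<le> ?m D" using unit A(3) bd by linarith
    have "(?m D)\<^sup>2 * ?m A \<le> (sqrt \<alpha> / 5)\<^sup>2"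
    proof (rule block_projection_corner_bound[OF P T(1) close A(1)])
      fix x y assume "x \<in> A" "y \<in> D"
      then show "matrix_entry T x y = (\<lambda>h. 0)"
        using R0[of x y] A(1) dec unfolding D_def bd_def R_def by (fastforce simp: le_max_iff_disj)
    qed (auto simp: D_def)
    also have "\<dots> = \<alpha> / 25" using \<alpha> by (simp add: power_divide)
    finally have "(?m D)\<^sup>2 * ?m A \<le> \<alpha> / 25" .
    moreover have "(1/4)\<^sup>2 * \<alpha> \<le> (?m D)\<^sup>2 * ?m A"
      using D A(2) \<alpha> by (intro mult_mono power_mono) auto
    ultimately show False using \<alpha> by (simp add: power2_eq_square)
  qed
  then show ?thesis by (intro exI[of _ R]) (auto simp: R_def)
qed

section \<open>Measures associated with unit vectors\<close>

definition fiber_measure :: "'a set \<Rightarrow> ('a \<Rightarrow> 'h::complex_hilbert) \<Rightarrow> 'a pmf" where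
  "fiber_measure B \<xi> = embed_pmf (\<lambda>x. if x \<in> B then (norm (\<xi> x))\<^sup>2 else 0)"

lemma pmf_fiber_measure:
  assumes "finite B" "l2_norm B \<xi> = 1"
  shows "pmf (fiber_measure B \<xi>) x = (if x \<in> B then (norm (\<xi> x))\<^sup>2 else 0)"
  unfolding fiber_measure_def
proof (rule pmf_embed_pmf)
  have "(\<integral>\<^sup>+x. ennreal (if x \<in> B then (norm (\<xi> x))\<^sup>2 else 0) \<partial>count_space UNIV)
      = (\<Sum>x\<in>B. ennreal (if x \<in> B then (norm (\<xi> x))\<^sup>2 else 0))"
    by (rule nn_integral_count_space'[OF assms(1)]) auto
  also have "\<dots> = ennreal (\<Sum>x\<in>B. (norm (\<xi> x))\<^sup>2)" by (simp add: sum_ennreal)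
  also have "(\<Sum>x\<in>B. (norm (\<xi> x))\<^sup>2) = 1"
    using l2_norm_power2[of B \<xi>] assms by simp
  finally show "(\<integral>\<^sup>+x. ennreal (if x \<in> B then (norm (\<xi> x))\<^sup>2 else 0) \<partial>count_space UNIV) = 1"
    by simp
qed auto

lemma prob_fiber_measure:
  assumes "finite B" "l2_norm B \<xi> = 1" "A \<subseteq> B"
  shows "measure_pmf.prob (fiber_measure B \<xi>) A = (\<Sum>x\<in>A. (norm (\<xi> x))\<^sup>2)"
  using assms finite_subset[OF assms(3,1)]
  by (subst measure_measure_pmf_finite) (auto simp: pmf_fiber_measure subset_iff intro!: sum.cong)

text \<open>Lets the Roe algebra share one argument with the uniform one, carried out in the closure
  of all finite propagation operators.\<close>

lemma roe_algebra_subset: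
  "roe_algebra X
    \<subseteq> operator_norm_closure (mspace X) {T \<in> bounded_operators (mspace X). finite_propagation X T}"
  unfolding roe_algebra_def operator_norm_closure_def by blast

text \<open>The expansion constant is 1/2 for every \<open>\<alpha>\<close>; only the radius varies,
  with the approximant that \<open>\<alpha>\<close> calls for.\<close>

lemma ghost_projection_imp_expanders:
  fixes P :: "('a \<Rightarrow> 'h::complex_hilbert) \<Rightarrow> ('a \<Rightarrow> 'h)"
  assumes P: "block_rank_one_ghost_projection X P"
    and cl: "P \<in> operator_norm_closure (mspace X) {T \<in> bounded_operators (mspace X). finite_propagation X T}"
  shows "ghostly_measured_asymptotic_expanders X"
proof -
  obtain B \<xi> where B: "block_rank_one_projection X B \<xi> P"
    and ghost: "(\<lambda>n. SUP x\<in>B n. (norm (\<xi> n x))\<^sup>2) \<longlonglongrightarrow> 0"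
    using P unfolding block_rank_one_ghost_projection_def by blast
  have dec: "sparse_decomposition X B" and unit: "\<And>n. l2_norm (B n) (\<xi> n) = 1"
    using B by (auto simp: block_rank_one_projection_def)
  have fin: "finite (B n)" "B n \<subseteq> mspace X" for n
    using dec by (auto simp: sparse_decomposition_def)
  define m where "m n = fiber_measure (B n) (\<xi> n)" for n
  have pmf: "pmf (m n) x = (if x \<in> B n then (norm (\<xi> n x))\<^sup>2 else 0)" for n x
    unfolding m_def by (rule pmf_fiber_measure[OF fin(1) unit])
  have prob: "measure_pmf.prob (m n) A = (\<Sum>x\<in>A. (norm (\<xi> n x))\<^sup>2)" if "A \<subseteq> B n" for n A
    unfolding m_def by (rule prob_fiber_measure[OF fin(1) unit that])
  have supp: "set_pmf (m n) \<subseteq> B n" for n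
    by (auto simp: set_pmf_iff pmf split: if_splits)
  have "measured_asymptotic_expanders (\<lambda>n. submetric X (B n)) m"
  proof (subst measured_asymptotic_expanders_submetric)
    show "finite (B n) \<and> B n \<subseteq> mspace X \<and> set_pmf (m n) \<subseteq> B n" for n using fin supp by auto
    show "\<forall>\<alpha>. 0 < \<alpha> \<and> \<alpha> \<le> 1/2 \<longrightarrow> (\<exists>c R. 0 < c \<and> c < 1 \<and> 0 < R \<and>
      (\<forall>n. \<forall>A \<subseteq> B n. \<alpha> \<le> measure_pmf.prob (m n) A \<and> measure_pmf.prob (m n) A \<le> 1/2 \<longrightarrow>
        c * measure_pmf.prob (m n) A
          < measure_pmf.prob (m n) {y \<in> B n - A. \<exists>x\<in>A. mdist X x y \<le> R}))"
    proof (intro allI impI)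
      fix \<alpha> :: real assume "0 < \<alpha> \<and> \<alpha> \<le> 1/2"
      then obtain R where R: "0 < R" and *: "\<And>n A. A \<subseteq> B n \<Longrightarrow> \<alpha> \<le> (\<Sum>x\<in>A. (norm (\<xi> n x))\<^sup>2) \<Longrightarrow>
          (\<Sum>x\<in>A. (norm (\<xi> n x))\<^sup>2) \<le> 1/2 \<Longrightarrow> 1/2 * (\<Sum>x\<in>A. (norm (\<xi> n x))\<^sup>2)
          < (\<Sum>y | y \<in> B n - A \<and> (\<exists>x\<in>A. mdist X x y \<le> R). (norm (\<xi> n y))\<^sup>2)"
        using block_projection_expanders[OF B cl, of \<alpha>] by meson
      have "1/2 * measure_pmf.prob (m n) A < measure_pmf.prob (m n) {y \<in> B n - A. \<exists>x\<in>A. mdist X x y \<le> R}"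
        if "A \<subseteq> B n" "\<alpha> \<le> measure_pmf.prob (m n) A" "measure_pmf.prob (m n) A \<le> 1/2" for n A
      proof -
        have "{y \<in> B n - A. \<exists>x\<in>A. mdist X x y \<le> R} \<subseteq> B n" by auto
        from prob[OF this] show ?thesis using *[OF that(1)] that prob[OF that(1)] by simp
      qed
      then show "\<exists>c R. 0 < c \<and> c < 1 \<and> 0 < R \<and>
        (\<forall>n. \<forall>A \<subseteq> B n. \<alpha> \<le> measure_pmf.prob (m n) A \<and> measure_pmf.prob (m n) A \<le> 1/2 \<longrightarrow>
          c * measure_pmf.prob (m n) A
            < measure_pmf.prob (m n) {y \<in> B n - A. \<exists>x\<in>A. mdist X x y \<le> R})"
        using R by (intro exI[of _ "1/2"] exI[of _ R]) auto
    qed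
  qed
  moreover have "(\<lambda>n. SUP x\<in>B n. pmf (m n) x) \<longlonglongrightarrow> 0"
    using ghost by (simp add: pmf cong: SUP_cong_simp)
  ultimately show ?thesis
    unfolding ghostly_measured_asymptotic_expanders_def using dec supp by blast
qed

subsection \<open>Expanders yield ghost projections\<close>

text \<open>A union over all indices, so that a point in no block gets the empty set; the operators
  built from kernels then vanish there.\<close>

definition block :: "(nat \<Rightarrow> 'a set) \<Rightarrow> 'a \<Rightarrow> 'a set" where
  "block Y x = (\<Union>n\<in>{n. x \<in> Y n}. Y n)"

lemma block_eq:
  assumes "disjoint_family Y" "x \<in> Y n"
  shows "block Y x = Y n"
proof -
  have "{n. x \<in> Y n} = {n}" using assms by (auto simp: disjoint_family_on_def)
  then show ?thesis by (simp add: block_def)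
qed

lemma block_empty: "x \<notin> (\<Union>n. Y n) \<Longrightarrow> block Y x = {}"
  by (auto simp: block_def)

text \<open>The block diagonal matrix \<open>K\<close> tensored with the projection onto the line spanned by \<open>e\<close>.\<close>

definition kernel_operator ::
    "(nat \<Rightarrow> 'a set) \<Rightarrow> ('a \<Rightarrow> 'a \<Rightarrow> real) \<Rightarrow> 'h \<Rightarrow> ('a \<Rightarrow> 'h::complex_hilbert) \<Rightarrow> ('a \<Rightarrow> 'h)" where
  "kernel_operator Y K e \<eta> x = (\<Sum>y\<in>block Y x. complex_of_real (K x y) * cinner (\<eta> y) e) *\<^sub>C e"

lemma kernel_operator_diff:
  "kernel_operator Y K e \<eta> x - kernel_operator Y K' e \<eta> x = kernel_operator Y (\<lambda>x y. K x y - K' x y) e \<eta> x"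
  by (simp add: kernel_operator_def complex_hilbert.scale_left_diff_distrib[symmetric]
      sum_subtractf[symmetric] left_diff_distrib)

text \<open>The kernel is real, so it acts separately on real and imaginary parts of the coordinates
  along \<open>e\<close>, and the real estimate carries over with the same constant.\<close>

lemma kernel_operator_block_bound:
  fixes e :: "'h::complex_hilbert"
  assumes e: "norm e = 1" and Y: "disjoint_family Y"
    and K: "\<And>u::'a \<Rightarrow> real. (\<Sum>x\<in>Y n. (\<Sum>y\<in>Y n. K x y * u y)\<^sup>2) \<le> C * (\<Sum>y\<in>Y n. (u y)\<^sup>2)"
    and C: "0 \<le> C"
  shows "(\<Sum>x\<in>Y n. (norm (kernel_operator Y K e \<eta> x))\<^sup>2) \<le> C * (\<Sum>y\<in>Y n. (norm (\<eta> y))\<^sup>2)"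
proof -
  define z where "z y = cinner (\<eta> y) e" for y
  have "(norm (kernel_operator Y K e \<eta> x))\<^sup>2
      = (\<Sum>y\<in>Y n. K x y * Re (z y))\<^sup>2 + (\<Sum>y\<in>Y n. K x y * Im (z y))\<^sup>2" if "x \<in> Y n" for x
    using e by (simp add: kernel_operator_def block_eq[OF Y that] norm_cscale cmod_power2 z_def)
  then have "(\<Sum>x\<in>Y n. (norm (kernel_operator Y K e \<eta> x))\<^sup>2)
      = (\<Sum>x\<in>Y n. (\<Sum>y\<in>Y n. K x y * Re (z y))\<^sup>2) + (\<Sum>x\<in>Y n. (\<Sum>y\<in>Y n. K x y * Im (z y))\<^sup>2)"
    by (simp add: sum.distrib)
  also have "\<dots> \<le> C * (\<Sum>y\<in>Y n. (Re (z y))\<^sup>2) + C * (\<Sum>y\<in>Y n. (Im (z y))\<^sup>2)"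
    by (intro add_mono K)
  also have "\<dots> = C * (\<Sum>y\<in>Y n. (cmod (z y))\<^sup>2)"
    by (simp add: distrib_left[symmetric] sum.distrib[symmetric] cmod_power2)
  also have "\<dots> \<le> C * (\<Sum>y\<in>Y n. (norm (\<eta> y))\<^sup>2)"
    unfolding z_def using C cinner_bound_unit[OF e] by (intro mult_left_mono sum_mono power_mono) auto
  finally show ?thesis .
qed

text \<open>A finite set meets finitely many blocks; once it is enlarged to their union, the
  blockwise estimates can be added.\<close>

lemma l2_blockwise_bound:
  fixes \<eta> \<zeta> :: "'a \<Rightarrow> 'h::complex_hilbert"
  assumes Y: "disjoint_family Y" "\<And>n. finite (Y n)" "(\<Union>n. Y n) = S"
    and \<eta>: "\<eta> \<in> l2 S" and \<zeta>: "\<And>x. x \<notin> S \<Longrightarrow> \<zeta> x = 0" and C: "0 \<le> C"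
    and le: "\<And>n. (\<Sum>x\<in>Y n. (norm (\<zeta> x))\<^sup>2) \<le> C * (\<Sum>x\<in>Y n. (norm (\<eta> x))\<^sup>2)"
  shows "\<zeta> \<in> l2 S" "l2_norm S \<zeta> \<le> sqrt C * l2_norm S \<eta>"
proof -
  have b: "(\<Sum>x\<in>F. (norm (\<zeta> x))\<^sup>2) \<le> C * (l2_norm S \<eta>)\<^sup>2" if F: "finite F" "F \<subseteq> S" for F
  proof -
    have "\<forall>x\<in>F. \<exists>n. x \<in> Y n" using F(2) Y(3) by blast
    then obtain i where i: "\<And>x. x \<in> F \<Longrightarrow> x \<in> Y (i x)" by metis
    define I where "I = i ` F"
    have I: "finite I" "F \<subseteq> (\<Union>n\<in>I. Y n)" using F i by (auto simp: I_def)
    have dis: "\<forall>n\<in>I. \<forall>l\<in>I. n \<noteq> l \<longrightarrow> Y n \<inter> Y l = {}"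
      using Y(1) by (auto simp: disjoint_family_on_def)
    have "(\<Sum>x\<in>F. (norm (\<zeta> x))\<^sup>2) \<le> (\<Sum>x\<in>(\<Union>n\<in>I. Y n). (norm (\<zeta> x))\<^sup>2)"
      using I Y by (intro sum_mono2) auto
    also have "\<dots> = (\<Sum>n\<in>I. \<Sum>x\<in>Y n. (norm (\<zeta> x))\<^sup>2)"
      using I Y(2) dis by (intro sum.UNION_disjoint) auto
    also have "\<dots> \<le> (\<Sum>n\<in>I. C * (\<Sum>x\<in>Y n. (norm (\<eta> x))\<^sup>2))" by (intro sum_mono le)
    also have "\<dots> = C * (\<Sum>x\<in>(\<Union>n\<in>I. Y n). (norm (\<eta> x))\<^sup>2)"
      using I Y(2) dis by (subst sum.UNION_disjoint) (auto simp: sum_distrib_left)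
    also have "\<dots> \<le> C * (l2_norm S \<eta>)\<^sup>2"
      using I Y C by (intro mult_left_mono l2_finite_sum_le[OF \<eta>]) auto
    finally show ?thesis .
  qed
  show "\<zeta> \<in> l2 S"
    by (rule l2_bounded_finite_sums(1)) (use \<zeta> b in blast)+
  have "(l2_norm S \<zeta>)\<^sup>2 \<le> C * (l2_norm S \<eta>)\<^sup>2"
    by (rule l2_bounded_finite_sums(2)) (use \<zeta> b in blast)+
  then have "l2_norm S \<zeta> \<le> sqrt (C * (l2_norm S \<eta>)\<^sup>2)" by (rule real_le_rsqrt)
  then show "l2_norm S \<zeta> \<le> sqrt C * l2_norm S \<eta>"
    by (simp add: real_sqrt_mult l2_norm_nonneg)
qed

lemma kernel_operator_l2:
  fixes e :: "'h::complex_hilbert"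
  assumes e: "norm e = 1" and Y: "disjoint_family Y" "\<And>n. finite (Y n)" "(\<Union>n. Y n) = S"
    and K: "\<And>n (u::'a \<Rightarrow> real). (\<Sum>x\<in>Y n. (\<Sum>y\<in>Y n. K x y * u y)\<^sup>2) \<le> C * (\<Sum>y\<in>Y n. (u y)\<^sup>2)"
    and C: "0 \<le> C" and \<eta>: "\<eta> \<in> l2 S"
  shows "kernel_operator Y K e \<eta> \<in> l2 S" "l2_norm S (kernel_operator Y K e \<eta>) \<le> sqrt C * l2_norm S \<eta>"
proof -
  have z: "kernel_operator Y K e \<eta> x = 0" if "x \<notin> S" for x
    using block_empty[of x Y] that Y(3) by (simp add: kernel_operator_def)
  note b = kernel_operator_block_bound[OF e Y(1) K C]
  show "kernel_operator Y K e \<eta> \<in> l2 S" "l2_norm S (kernel_operator Y K e \<eta>) \<le> sqrt C * l2_norm S \<eta>"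
    by (rule l2_blockwise_bound[OF Y \<eta> z C b]; assumption)+
qed

lemma kernel_operator_bounded:
  fixes e :: "'h::complex_hilbert"
  assumes e: "norm e = 1" and Y: "disjoint_family Y" "\<And>n. finite (Y n)" "(\<Union>n. Y n) = S"
    and K: "\<And>n (u::'a \<Rightarrow> real). (\<Sum>x\<in>Y n. (\<Sum>y\<in>Y n. K x y * u y)\<^sup>2) \<le> C * (\<Sum>y\<in>Y n. (u y)\<^sup>2)"
    and C: "0 \<le> C"
  shows "kernel_operator Y K e \<in> bounded_operators S"
  unfolding bounded_operators_def
proof (intro CollectI conjI ballI allI)
  show "kernel_operator Y K e \<in> l2 S \<rightarrow> l2 S" using kernel_operator_l2(1)[OF assms] by blast
  show "\<exists>k. \<forall>\<eta>\<in>l2 S. l2_norm S (kernel_operator Y K e \<eta>) \<le> k * l2_norm S \<eta>"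
    using kernel_operator_l2(2)[OF assms] by blast
  show "kernel_operator Y K e (\<lambda>x. \<eta> x + \<zeta> x)
      = (\<lambda>x. kernel_operator Y K e \<eta> x + kernel_operator Y K e \<zeta> x)" for \<eta> \<zeta>
    by (simp add: fun_eq_iff kernel_operator_def cinner_add_left distrib_left sum.distrib
        complex_hilbert.scale_left_distrib)
  show "kernel_operator Y K e (\<lambda>x. a *\<^sub>C \<eta> x) = (\<lambda>x. a *\<^sub>C kernel_operator Y K e \<eta> x)" for a \<eta>
    by (simp add: fun_eq_iff kernel_operator_def cinner_cscale_left sum_distrib_left mult.left_commute)
qed

lemma kernel_operator_op_norm:
  fixes e :: "'h::complex_hilbert"
  assumes e: "norm e = 1" and Y: "disjoint_family Y" "\<And>n. finite (Y n)" "(\<Union>n. Y n) = S"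
    and K: "\<And>n (u::'a \<Rightarrow> real). (\<Sum>x\<in>Y n. (\<Sum>y\<in>Y n. K x y * u y)\<^sup>2) \<le> C * (\<Sum>y\<in>Y n. (u y)\<^sup>2)"
    and C: "0 \<le> C"
  shows "l2_op_norm S (kernel_operator Y K e) \<le> sqrt C"
  unfolding l2_op_norm_def
proof (rule cSUP_least)
  have "(\<lambda>x. 0) \<in> {\<eta> :: 'a \<Rightarrow> 'h. \<eta> \<in> l2 S \<and> l2_norm S \<eta> \<le> 1}"
    by (simp add: l2_def l2_norm_def)
  then show "{\<eta> :: 'a \<Rightarrow> 'h. \<eta> \<in> l2 S \<and> l2_norm S \<eta> \<le> 1} \<noteq> {}" by blast
  fix \<eta> :: "'a \<Rightarrow> 'h" assume "\<eta> \<in> {\<eta> \<in> l2 S. l2_norm S \<eta> \<le> 1}"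
  then have \<eta>: "\<eta> \<in> l2 S" "l2_norm S \<eta> \<le> 1" by auto
  have "l2_norm S (kernel_operator Y K e \<eta>) \<le> sqrt C * l2_norm S \<eta>"
    by (rule kernel_operator_l2(2)[OF assms \<eta>(1)])
  also have "\<dots> \<le> sqrt C" using \<eta>(2) C by (simp add: mult_left_le)
  finally show "l2_norm S (kernel_operator Y K e \<eta>) \<le> sqrt C" .
qed

lemma matrix_entry_kernel_operator:
  assumes "disjoint_family Y" "x \<in> Y n" "finite (Y n)"
  shows "matrix_entry (kernel_operator Y K e) x y h
    = (if y \<in> Y n then (complex_of_real (K x y) * cinner h e) *\<^sub>C e else 0)"
proof -
  have "(\<Sum>z\<in>Y n. complex_of_real (K x z) * cinner (if z = y then h else 0) e)
      = (\<Sum>z\<in>Y n. if z = y then complex_of_real (K x y) * cinner h e else 0)"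
    by (intro sum.cong) auto
  then show ?thesis
    using assms(3) by (simp add: matrix_entry_def kernel_operator_def block_eq[OF assms(1,2)])
qed

text \<open>All entries take values in the line spanned by \<open>e\<close> and map the unit ball
  into a compact disc of that line.\<close>

lemma kernel_operator_locally_compact:
  fixes e :: "'h::complex_hilbert"
  assumes e: "norm e = 1" and Y: "disjoint_family Y" "\<And>n. finite (Y n)" "(\<Union>n. Y n) = mspace X"
  shows "locally_compact_operator X (kernel_operator Y K e)"
  unfolding locally_compact_operator_def
proof (intro ballI)
  fix x y assume "x \<in> mspace X" "y \<in> mspace X"
  then obtain n where n: "x \<in> Y n" using Y(3) by blast
  let ?C = "(\<lambda>z. z *\<^sub>C e) ` cball 0 \<bar>K x y\<bar>"
  have "compact ?C" by (intro compact_continuous_image continuous_on_cscale_left compact_cball)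
  moreover have "matrix_entry (kernel_operator Y K e) x y ` cball 0 1 \<subseteq> ?C"
  proof (rule image_subsetI)
    fix h :: 'h assume "h \<in> cball 0 1"
    then have "cmod (cinner h e) \<le> 1" using cinner_bound_unit[OF e, of h] by simp
    then have "cmod (complex_of_real (K x y) * cinner h e) \<le> \<bar>K x y\<bar>"
      by (simp add: norm_mult mult_left_le)
    then show "matrix_entry (kernel_operator Y K e) x y h \<in> ?C"
      by (cases "y \<in> Y n") (auto simp: matrix_entry_kernel_operator[OF Y(1) n Y(2)] intro: image_eqI[of _ _ 0])
  qed
  ultimately have "closure (matrix_entry (kernel_operator Y K e) x y ` cball 0 1) \<subseteq> ?C"
    by (intro closure_minimal compact_imp_closed)
  then show "compact_operator (matrix_entry (kernel_operator Y K e) x y)"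
    unfolding compact_operator_def
    using \<open>compact ?C\<close> compact_Int_closed[OF \<open>compact ?C\<close> closed_closure] by (metis Int_absorb1)
qed

lemma kernel_operator_finite_propagation:
  assumes Y: "disjoint_family Y" "\<And>n. finite (Y n)" "(\<Union>n. Y n) = mspace X"
    and K: "\<And>n x y. x \<in> Y n \<Longrightarrow> y \<in> Y n \<Longrightarrow> K x y \<noteq> 0 \<Longrightarrow> mdist X x y \<le> R"
  shows "finite_propagation X (kernel_operator Y K e)"
  unfolding finite_propagation_def
proof (rule bdd_aboveI[of _ R], elim CollectE exE conjE)
  fix d x y assume *: "d = mdist X x y" "x \<in> mspace X" "matrix_entry (kernel_operator Y K e) x y \<noteq> (\<lambda>h. 0)"
  then obtain n where n: "x \<in> Y n" using Y(3) by blast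
  have "y \<in> Y n \<and> K x y \<noteq> 0"
  proof (rule ccontr)
    assume "\<not> ?thesis"
    then have "matrix_entry (kernel_operator Y K e) x y h = 0" for h
      by (auto simp: matrix_entry_kernel_operator[OF Y(1) n Y(2)])
    then show False using *(3) by blast
  qed
  then show "d \<le> R" using K n * by blast
qed

text \<open>The factor 1 is written out so that the estimate has the shape with a constant
  \<open>C\<close> that the operator lemmas expect.\<close>

lemma rank_one_kernel_bound:
  fixes \<xi> u :: "'a \<Rightarrow> real"
  assumes "(\<Sum>x\<in>Y. (\<xi> x)\<^sup>2) = 1"
  shows "(\<Sum>x\<in>Y. (\<Sum>y\<in>Y. \<xi> x * \<xi> y * u y)\<^sup>2) \<le> 1 * (\<Sum>y\<in>Y. (u y)\<^sup>2)"
proof -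
  have "(\<Sum>x\<in>Y. (\<Sum>y\<in>Y. \<xi> x * \<xi> y * u y)\<^sup>2) = (\<Sum>x\<in>Y. (\<xi> x)\<^sup>2) * (\<Sum>y\<in>Y. \<xi> y * u y)\<^sup>2"
    by (simp add: mult.assoc sum_distrib_left[symmetric] power_mult_distrib sum_distrib_right[symmetric])
  also have "\<dots> \<le> (\<Sum>y\<in>Y. (\<xi> y)\<^sup>2) * (\<Sum>y\<in>Y. (u y)\<^sup>2)"
    using assms Cauchy_Schwarz_ineq_sum[of \<xi> u Y] by simp
  finally show ?thesis using assms by simp
qed

lemma kernel_rank_one_projection:
  fixes e :: "'h::complex_hilbert"
  assumes e: "norm e = 1" and dec: "sparse_decomposition X Y"
    and unit: "\<And>n. (\<Sum>x\<in>Y n. (\<xi> x)\<^sup>2) = 1"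
  shows "block_rank_one_projection X Y (\<lambda>n x. if x \<in> Y n then complex_of_real (\<xi> x) *\<^sub>C e else 0)
    (kernel_operator Y (\<lambda>x y. \<xi> x * \<xi> y) e)"
proof -
  let ?v = "\<lambda>n x. if x \<in> Y n then complex_of_real (\<xi> x) *\<^sub>C e else 0"
  let ?P = "kernel_operator Y (\<lambda>x y. \<xi> x * \<xi> y) e"
  have Y: "disjoint_family Y" "\<And>n. finite (Y n)" "(\<Union>n. Y n) = mspace X"
    using dec by (auto simp: sparse_decomposition_def)
  have v: "?v n \<in> l2 (Y n)" "l2_norm (Y n) (?v n) = 1" for n
  proof -
    show "?v n \<in> l2 (Y n)" using Y by (intro l2_finite_support(1)[of "Y n"]) auto
    have "(l2_norm (Y n) (?v n))\<^sup>2 = (\<Sum>x\<in>Y n. (norm (?v n x))\<^sup>2)"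
      using Y by (intro l2_finite_support(2)) auto
    also have "\<dots> = 1" using e unit by (simp add: norm_cscale)
    finally show "l2_norm (Y n) (?v n) = 1"
      using l2_norm_nonneg[of "Y n" "?v n"] by (simp add: power2_eq_1_iff)
  qed
  have "restrict_to (Y n) (?P \<eta>) = rank_one_projection (Y n) (?v n) (restrict_to (Y n) \<eta>)" for \<eta> n
  proof
    fix x
    have "l2_inner (Y n) (restrict_to (Y n) \<eta>) (?v n) = (\<Sum>y\<in>Y n. complex_of_real (\<xi> y) * cinner (\<eta> y) e)"
      unfolding l2_inner_def using Y(2)
      by (simp, intro sum.cong) (auto simp: restrict_to_def cinner_cscale_right)
    then show "restrict_to (Y n) (?P \<eta>) x = rank_one_projection (Y n) (?v n) (restrict_to (Y n) \<eta>) x"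
      by (auto simp: restrict_to_def[of _ "?P \<eta>"] rank_one_projection_def kernel_operator_def
          block_eq[OF Y(1)] complex_hilbert.scale_scale sum_distrib_right sum_distrib_left mult_ac)
  qed
  moreover have "?P \<in> bounded_operators (mspace X)"
    by (rule kernel_operator_bounded[OF e Y rank_one_kernel_bound[OF unit]]) simp
  ultimately show ?thesis
    unfolding block_rank_one_projection_def is_direct_sum_def using dec v by blast
qed

text \<open>The rate \<open>\<rho>\<close> and the constant \<open>R\<close> are common to all
  blocks. So for fixed \<open>k\<close> the blockwise approximants assemble to one operator of
  propagation at most \<open>k * R\<close>, with an error that is uniform over the blocks.\<close>

lemma kernel_limit_in_roe_algebra:
  fixes e :: "'h::complex_hilbert"
  assumes e: "norm e = 1" and Y: "disjoint_family Y" "\<And>n. finite (Y n)" "(\<Union>n. Y n) = mspace X"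
    and P: "\<And>n (u::'a \<Rightarrow> real). (\<Sum>x\<in>Y n. (\<Sum>y\<in>Y n. K x y * u y)\<^sup>2) \<le> 1 * (\<Sum>y\<in>Y n. (u y)\<^sup>2)"
    and Q: "\<And>k n (u::'a \<Rightarrow> real). (\<Sum>x\<in>Y n. (\<Sum>y\<in>Y n. (Q k x y - K x y) * u y)\<^sup>2) \<le> \<rho> ^ k * (\<Sum>y\<in>Y n. (u y)\<^sup>2)"
    and \<rho>: "0 \<le> \<rho>" "\<rho> < 1"
    and band: "\<And>k n x y. x \<in> Y n \<Longrightarrow> y \<in> Y n \<Longrightarrow> Q k x y \<noteq> 0 \<Longrightarrow> mdist X x y \<le> real k * R"
  shows "kernel_operator Y K e \<in> roe_algebra X"
  unfolding roe_algebra_def operator_norm_closure_def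
proof (intro CollectI conjI allI impI)
  show "kernel_operator Y K e \<in> bounded_operators (mspace X)"
    by (rule kernel_operator_bounded[OF e Y P]) auto
  fix \<epsilon> :: real assume \<epsilon>: "0 < \<epsilon>"
  \<comment> \<open>The estimates concern squared norms, so the operator error is
    \<open>sqrt (\<rho> ^ k)\<close>.\<close>
  obtain k where k: "\<rho> ^ k < \<epsilon>\<^sup>2" using real_arch_pow_inv[of "\<epsilon>\<^sup>2" \<rho>] \<epsilon> \<rho> by auto
  have "kernel_operator Y (Q k) e \<in> bounded_operators (mspace X)"
  \<comment> \<open>Write \<open>Q k\<close> as the sum of \<open>Q k - K\<close> and
    \<open>K\<close>, both of which are bounded on every block by hypothesis.\<close>
  proof (rule kernel_operator_bounded[OF e Y])
    fix n and u :: "'a \<Rightarrow> real"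
    have "(\<Sum>x\<in>Y n. (\<Sum>y\<in>Y n. Q k x y * u y)\<^sup>2)
        \<le> (\<Sum>x\<in>Y n. 2 * (\<Sum>y\<in>Y n. (Q k x y - K x y) * u y)\<^sup>2 + 2 * (\<Sum>y\<in>Y n. K x y * u y)\<^sup>2)"
    proof (rule sum_mono)
      fix x
      define a where "a = (\<Sum>y\<in>Y n. (Q k x y - K x y) * u y)"
      define b where "b = (\<Sum>y\<in>Y n. K x y * u y)"
      have "(\<Sum>y\<in>Y n. Q k x y * u y) = a + b"
        unfolding a_def b_def by (simp add: sum.distrib[symmetric] algebra_simps)
      moreover have "(a + b)\<^sup>2 \<le> 2 * a\<^sup>2 + 2 * b\<^sup>2"
        using zero_le_power2[of "a - b"] by (simp add: power2_eq_square algebra_simps)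
      ultimately show "(\<Sum>y\<in>Y n. Q k x y * u y)\<^sup>2
        \<le> 2 * (\<Sum>y\<in>Y n. (Q k x y - K x y) * u y)\<^sup>2 + 2 * (\<Sum>y\<in>Y n. K x y * u y)\<^sup>2"
        by (simp add: a_def b_def)
    qed
    also have "\<dots> = 2 * (\<Sum>x\<in>Y n. (\<Sum>y\<in>Y n. (Q k x y - K x y) * u y)\<^sup>2)
        + 2 * (\<Sum>x\<in>Y n. (\<Sum>y\<in>Y n. K x y * u y)\<^sup>2)"
      by (simp add: sum.distrib sum_distrib_left)
    also have "\<dots> \<le> (2 * \<rho> ^ k + 2) * (\<Sum>y\<in>Y n. (u y)\<^sup>2)"
      using Q[where n=n and k=k and u=u] P[where n=n and u=u] by (simp add: distrib_right)
    finally show "(\<Sum>x\<in>Y n. (\<Sum>y\<in>Y n. Q k x y * u y)\<^sup>2) \<le> (2 * \<rho> ^ k + 2) * (\<Sum>y\<in>Y n. (u y)\<^sup>2)" .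
  qed (use \<rho> in simp)
  moreover have "finite_propagation X (kernel_operator Y (Q k) e)"
    by (rule kernel_operator_finite_propagation[OF Y band])
  moreover have "locally_compact_operator X (kernel_operator Y (Q k) e)"
    by (rule kernel_operator_locally_compact[OF e Y])
  moreover have "l2_op_norm (mspace X) (\<lambda>\<eta> x. kernel_operator Y K e \<eta> x - kernel_operator Y (Q k) e \<eta> x) < \<epsilon>"
  proof -
    have "(\<Sum>x\<in>Y n. (\<Sum>y\<in>Y n. (K x y - Q k x y) * u y)\<^sup>2) \<le> \<rho> ^ k * (\<Sum>y\<in>Y n. (u y)\<^sup>2)" for n u
    proof -
      have "(\<Sum>y\<in>Y n. (K x y - Q k x y) * u y) = - (\<Sum>y\<in>Y n. (Q k x y - K x y) * u y)" for x
        by (simp add: sum_negf[symmetric] algebra_simps)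
      then show ?thesis using Q[where n=n and k=k and u=u] by simp
    qed
    then have "l2_op_norm (mspace X) (kernel_operator Y (\<lambda>x y. K x y - Q k x y) e) \<le> sqrt (\<rho> ^ k)"
      by (rule kernel_operator_op_norm[OF e Y]) (use \<rho> in simp)
    also have "\<dots> < \<epsilon>" using k \<epsilon> by (simp add: real_less_lsqrt)
    finally show ?thesis by (simp add: kernel_operator_diff[abs_def])
  qed
  ultimately show "\<exists>T'\<in>{T \<in> bounded_operators (mspace X). finite_propagation X T \<and> locally_compact_operator X T}.
      l2_op_norm (mspace X) (\<lambda>\<eta> x. kernel_operator Y K e \<eta> x - T' \<eta> x) < \<epsilon>"
    by blast
qed

section \<open>Gluing the blocks\<close>

lemma expanders_block_approximable:
  assumes bg: "bounded_geometry X" and gh: "ghostly_measured_asymptotic_expanders X"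
  obtains B m Y \<xi> Q \<rho> R where "sparse_decomposition X B" "(\<lambda>n. SUP x\<in>B n. pmf (m n) x) \<longlonglongrightarrow> 0"
    "\<And>n. Y n \<subseteq> B n" "\<And>n. Y n \<noteq> {}" "\<And>n x. x \<in> Y n \<Longrightarrow> (\<xi> n x)\<^sup>2 \<le> 2 * pmf (m n) x"
    "\<And>n. (\<Sum>x\<in>Y n. (\<xi> n x)\<^sup>2) = 1" "0 \<le> \<rho>" "\<rho> < 1"
    "\<And>n k x y. x \<in> Y n \<Longrightarrow> y \<in> Y n \<Longrightarrow> Q n k x y \<noteq> 0 \<Longrightarrow> mdist X x y \<le> real k * R"
    "\<And>n k u. (\<Sum>x\<in>Y n. (\<Sum>y\<in>Y n. (Q n k x y - \<xi> n x * \<xi> n y) * u y)\<^sup>2) \<le> \<rho> ^ k * (\<Sum>y\<in>Y n. (u y)\<^sup>2)"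
proof -
  obtain B m where dec: "sparse_decomposition X B" and supp: "\<And>n. set_pmf (m n) \<subseteq> B n"
    and ghost: "(\<lambda>n. SUP x\<in>B n. pmf (m n) x) \<longlonglongrightarrow> 0"
    and mae: "measured_asymptotic_expanders (\<lambda>n. submetric X (B n)) m"
    using gh unfolding ghostly_measured_asymptotic_expanders_def by blast
  have B: "finite (B n)" "B n \<subseteq> mspace X" for n
    using dec by (auto simp: sparse_decomposition_def)
  have 1: "finite (B n) \<and> B n \<subseteq> mspace X \<and> set_pmf (m n) \<subseteq> B n" for n using B supp by auto
  have "(0::real) < 1/8 \<and> (1/8::real) \<le> 1/2" by simp
  then obtain c R where c: "0 < c" "c < 1" "0 < R" and
    exp: "\<And>n A. A \<subseteq> B n \<Longrightarrow> 1/8 \<le> measure_pmf.prob (m n) A \<Longrightarrow> measure_pmf.prob (m n) A \<le> 1/2 \<Longrightarrow>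
      c * measure_pmf.prob (m n) A < measure_pmf.prob (m n) {y \<in> B n - A. \<exists>x\<in>A. mdist X x y \<le> R}"
    using mae unfolding measured_asymptotic_expanders_submetric[of B, OF 1] by meson
  obtain N0 where N0: "\<And>x. x \<in> mspace X \<Longrightarrow> finite (mcball_of X x R) \<and> card (mcball_of X x R) \<le> N0"
    using bg \<open>0 < R\<close> unfolding bounded_geometry_def by blast
  \<comment> \<open>At least 1, because the spectral gap has \<open>N\<close> in its denominator;
    this keeps \<open>\<rho>\<close> between 0 and 1.\<close>
  define N where "N = max N0 1"
  define \<rho> where "\<rho> = 1 - (c/16)\<^sup>2 / (4 * (real N)\<^sup>2)"
  have prob: "measure_pmf.prob (m n) A = sum (pmf (m n)) A" if "A \<subseteq> B n" for n A
    using finite_subset[OF that B(1)] by (rule measure_measure_pmf_finite)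
  have ex: "\<exists>Y \<xi> Q. Y \<subseteq> B n \<and> Y \<noteq> {} \<and> (\<forall>x\<in>Y. 0 \<le> \<xi> x \<and> (\<xi> x)\<^sup>2 \<le> 2 * pmf (m n) x) \<and> (\<Sum>x\<in>Y. (\<xi> x)\<^sup>2) = 1 \<and>
    (\<forall>k. \<forall>x\<in>Y. \<forall>y\<in>Y. Q k x y \<noteq> 0 \<longrightarrow> mdist X x y \<le> real k * R) \<and>
    (\<forall>k u. (\<Sum>x\<in>Y. (\<Sum>y\<in>Y. (Q k x y - \<xi> x * \<xi> y) * u y)\<^sup>2) \<le> \<rho> ^ k * (\<Sum>y\<in>Y. (u y)\<^sup>2))" for n
    unfolding \<rho>_def
  proof (rule expander_block_approximable)
    show "sum (pmf (m n)) (B n) = 1" using B supp by (intro sum_pmf_eq_1) auto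
    show "c * sum (pmf (m n)) A < sum (pmf (m n)) {y \<in> B n - A. \<exists>x\<in>A. mdist X x y \<le> R}"
      if A: "A \<subseteq> B n" "1/8 \<le> sum (pmf (m n)) A" "sum (pmf (m n)) A \<le> 1/2" for A
    proof -
      have "{y \<in> B n - A. \<exists>x\<in>A. mdist X x y \<le> R} \<subseteq> B n" by blast
      from prob[OF this] show ?thesis using exp[OF A(1)] A prob[OF A(1)] by simp
    qed
    show "card {y \<in> B n. mdist X x y \<le> R} \<le> N" if x: "x \<in> B n" for x
    proof -
      have xX: "x \<in> mspace X" using x B by blast
      have "{y \<in> B n. mdist X x y \<le> R} \<subseteq> mcball_of X x R" using xX B(2)[of n] by auto
      then have "card {y \<in> B n. mdist X x y \<le> R} \<le> card (mcball_of X x R)"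
        using N0[OF xX] by (intro card_mono) auto
      then show ?thesis using N0[OF xX] unfolding N_def by (meson le_trans max.cobounded1)
    qed
  qed (use B c in \<open>auto simp: N_def\<close>)
  define good where "good n Y \<xi> Q \<longleftrightarrow> Y \<subseteq> B n \<and> Y \<noteq> {} \<and> (\<forall>x\<in>Y. 0 \<le> \<xi> x \<and> (\<xi> x)\<^sup>2 \<le> 2 * pmf (m n) x) \<and> (\<Sum>x\<in>Y. (\<xi> x)\<^sup>2) = 1 \<and>
    (\<forall>k. \<forall>x\<in>Y. \<forall>y\<in>Y. Q k x y \<noteq> 0 \<longrightarrow> mdist X x y \<le> real k * R) \<and>
    (\<forall>k u. (\<Sum>x\<in>Y. (\<Sum>y\<in>Y. (Q k x y - \<xi> x * \<xi> y) * u y)\<^sup>2) \<le> \<rho> ^ k * (\<Sum>y\<in>Y. (u y)\<^sup>2))"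
    for n Y \<xi> and Q :: "nat \<Rightarrow> 'a \<Rightarrow> 'a \<Rightarrow> real"
  have "\<forall>n. \<exists>Y \<xi> Q. good n Y \<xi> Q" using ex by (simp add: good_def)
  then obtain Y \<xi> Q where good: "\<And>n. good n (Y n) (\<xi> n) (Q n)" by metis
  have \<rho>: "0 \<le> \<rho>" "\<rho> < 1"
  proof -
    have "(c/16)\<^sup>2 \<le> 1" using c by (simp add: power_le_one)
    moreover have "1 \<le> (real N)\<^sup>2" by (simp add: N_def)
    ultimately have "(c/16)\<^sup>2 / (4 * (real N)\<^sup>2) \<le> 1" by (subst divide_le_eq_1) auto
    then show "0 \<le> \<rho>" by (simp add: \<rho>_def)
    show "\<rho> < 1" using c by (simp add: \<rho>_def N_def)
  qed
  show thesis
  proof (rule that[where B=B and m=m and Y=Y and \<xi>=\<xi> and Q=Q and \<rho>=\<rho> and R=R])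
  qed (use dec ghost \<rho> good in \<open>simp_all add: good_def\<close>)
qed

text \<open>The spectral gap holds only on the good parts \<open>Y n\<close> of the blocks, so the
  projection lives over their union \<open>S\<close>. Its decomposition inherits sparseness from the
  \<open>B n\<close>, and its masses are at most twice the original ones.\<close>

lemma expanders_imp_ghost_projection:
  fixes e :: "'h::complex_hilbert" and X :: "'a metric"
  assumes e: "norm e = 1" and bg: "bounded_geometry X" and gh: "ghostly_measured_asymptotic_expanders X"
  shows "\<exists>S\<subseteq>mspace X. sparse_space (submetric X S) \<and>
    (\<exists>P\<in>(roe_algebra (submetric X S) :: (('a \<Rightarrow> 'h) \<Rightarrow> ('a \<Rightarrow> 'h)) set).
      block_rank_one_ghost_projection (submetric X S) P)"
proof -
  obtain B m Y \<xi> Q \<rho> R where dec: "sparse_decomposition X B"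
    and ghost: "(\<lambda>n. SUP x\<in>B n. pmf (m n) x) \<longlonglongrightarrow> 0"
    and YB: "\<And>n. Y n \<subseteq> B n" "\<And>n. Y n \<noteq> {}" and le: "\<And>n x. x \<in> Y n \<Longrightarrow> (\<xi> n x)\<^sup>2 \<le> 2 * pmf (m n) x"
    and unit: "\<And>n. (\<Sum>x\<in>Y n. (\<xi> n x)\<^sup>2) = 1" and \<rho>: "0 \<le> \<rho>" "\<rho> < 1"
    and band: "\<And>n k x y. x \<in> Y n \<Longrightarrow> y \<in> Y n \<Longrightarrow> Q n k x y \<noteq> 0 \<Longrightarrow> mdist X x y \<le> real k * R"
    and approx: "\<And>n k u. (\<Sum>x\<in>Y n. (\<Sum>y\<in>Y n. (Q n k x y - \<xi> n x * \<xi> n y) * u y)\<^sup>2)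
      \<le> \<rho> ^ k * (\<Sum>y\<in>Y n. (u y)\<^sup>2)"
    by (rule expanders_block_approximable[OF bg gh]) (rule that; assumption)
  have B: "finite (B n)" "B n \<subseteq> mspace X" "disjoint_family B" for n
    using dec by (auto simp: sparse_decomposition_def)
  define S where "S = (\<Union>n. Y n)"
  have SX: "S \<subseteq> mspace X" using YB B by (force simp: S_def)
  have mS: "mspace (submetric X S) = S" using SX by auto
  have disY: "disjoint_family Y" using B(3) YB unfolding disjoint_family_on_def by blast
  have finY: "finite (Y n)" for n using YB B finite_subset by blast
  have decY: "sparse_decomposition (submetric X S) Y"
    unfolding sparse_decomposition_iff
  proof (intro conjI allI)
    fix r
    obtain N where "\<And>n k. n \<noteq> k \<Longrightarrow> N \<le> n + k \<Longrightarrow> \<forall>x\<in>B n. \<forall>y\<in>B k. r \<le> mdist X x y"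
      using dec unfolding sparse_decomposition_iff by meson
    then show "\<exists>N. \<forall>n k. n \<noteq> k \<and> N \<le> n + k \<longrightarrow> (\<forall>x\<in>Y n. \<forall>y\<in>Y k. r \<le> mdist (submetric X S) x y)"
      using YB(1) by (intro exI[of _ N]) (auto simp: subset_iff)
  qed (use disY finY YB SX in \<open>auto simp: S_def\<close>)
  have UY: "(\<Union>n. Y n) = mspace (submetric X S)" using mS by (simp add: S_def)
  \<comment> \<open>A kernel is one function of two points; recovering the block index of a point
    merges the vectors and matrices of all blocks into such functions.\<close>
  define i where "i x = (SOME n. x \<in> Y n)" for x
  have i: "i x = n" if "x \<in> Y n" for x n
  proof -
    have "x \<in> Y (i x)" unfolding i_def using that by (rule someI)
    then show ?thesis using disY that by (auto simp: disjoint_family_on_def)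
  qed
  define \<xi>' where "\<xi>' x = \<xi> (i x) x" for x
  have \<xi>': "\<xi>' x = \<xi> n x" if "x \<in> Y n" for x n using i[OF that] by (simp add: \<xi>'_def)
  have unit': "(\<Sum>x\<in>Y n. (\<xi>' x)\<^sup>2) = 1" for n using unit[of n] by (simp add: \<xi>')
  define P where "P = kernel_operator Y (\<lambda>x y. \<xi>' x * \<xi>' y) e"
  have "P \<in> roe_algebra (submetric X S)"
    unfolding P_def
  proof (rule kernel_limit_in_roe_algebra[OF e disY finY UY, where Q="\<lambda>k x y. Q (i x) k x y" and \<rho>=\<rho> and R=R])
    show "(\<Sum>x\<in>Y n. (\<Sum>y\<in>Y n. \<xi>' x * \<xi>' y * u y)\<^sup>2) \<le> 1 * (\<Sum>y\<in>Y n. (u y)\<^sup>2)" for n u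
      by (rule rank_one_kernel_bound[OF unit'])
    show "(\<Sum>x\<in>Y n. (\<Sum>y\<in>Y n. (Q (i x) k x y - \<xi>' x * \<xi>' y) * u y)\<^sup>2) \<le> \<rho> ^ k * (\<Sum>y\<in>Y n. (u y)\<^sup>2)" for k n u
      using approx[of n k u] by (simp add: \<xi>' i)
    show "mdist (submetric X S) x y \<le> real k * R" if "x \<in> Y n" "y \<in> Y n" "Q (i x) k x y \<noteq> 0" for k n x y
      using band[OF that(1,2)] that(3) i[OF that(1)] by simp
  qed (rule \<rho>)+
  moreover have "block_rank_one_ghost_projection (submetric X S) P"
    unfolding block_rank_one_ghost_projection_def
  proof (intro exI conjI)
    let ?v = "\<lambda>n x. if x \<in> Y n then complex_of_real (\<xi>' x) *\<^sub>C e else 0"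
    show "block_rank_one_projection (submetric X S) Y ?v P"
      unfolding P_def by (rule kernel_rank_one_projection[OF e decY unit'])
    have nv: "(norm (?v n x))\<^sup>2 = (\<xi> n x)\<^sup>2" if "x \<in> Y n" for n x
      using that e by (simp add: norm_cscale \<xi>')
    show "(\<lambda>n. SUP x\<in>Y n. (norm (?v n x))\<^sup>2) \<longlonglongrightarrow> 0"
    proof (rule tendsto_sandwich[where f="\<lambda>_. 0"])
      show "(\<lambda>n. 2 * (SUP x\<in>B n. pmf (m n) x)) \<longlonglongrightarrow> 0"
        using tendsto_mult[OF tendsto_const[of 2] ghost] by simp
      show "\<forall>\<^sub>F n in sequentially. 0 \<le> (SUP x\<in>Y n. (norm (?v n x))\<^sup>2)"
      proof (intro always_eventually allI)
        fix n
        obtain b where "b \<in> Y n" using YB(2) by blast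
        then show "0 \<le> (SUP x\<in>Y n. (norm (?v n x))\<^sup>2)"
          using finY by (intro cSUP_upper2[of _ _ b]) auto
      qed
      show "\<forall>\<^sub>F n in sequentially. (SUP x\<in>Y n. (norm (?v n x))\<^sup>2) \<le> 2 * (SUP x\<in>B n. pmf (m n) x)"
      proof (intro always_eventually allI cSUP_least)
        fix n show "Y n \<noteq> {}" by (rule YB)
        fix x assume x: "x \<in> Y n"
        have "pmf (m n) x \<le> (SUP x\<in>B n. pmf (m n) x)"
          using x YB(1)[of n] B by (intro cSUP_upper) auto
        then show "(norm (?v n x))\<^sup>2 \<le> 2 * (SUP x\<in>B n. pmf (m n) x)"
          using nv[OF x] le[OF x] by linarith
      qed
    qed simp
  qed
  moreover have "sparse_space (submetric X S)" using decY by (auto simp: sparse_space_def)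
  ultimately show ?thesis using SX by blast
qed

section \<open>The equivalences and their coarse invariance\<close>

lemma unit_vector_exists:
  assumes "infinite_dim_hilbert TYPE('h::complex_hilbert)"
  obtains e :: "'h::complex_hilbert" where "norm e = 1"
proof -
  have "\<exists>x::'h. x \<noteq> 0"
  proof (rule ccontr)
    assume "\<not> ?thesis"
    then have "complex_hilbert.span {} = (UNIV :: 'h set)" by auto
    then show False using assms unfolding infinite_dim_hilbert_def by blast
  qed
  then obtain x :: 'h where "x \<noteq> 0" by blast
  then show thesis by (intro that[of "x /\<^sub>R norm x"]) simp
qed

lemma expander_subspace_imp_ghost_projection:
  fixes e :: "'h::complex_hilbert" and X :: "'a metric"
  assumes e: "norm e = 1" and bg: "bounded_geometry X" and "\<not> no_expander_subspace X"
  shows "\<exists>S\<subseteq>mspace X. sparse_space (submetric X S) \<and>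
    (\<exists>P\<in>(roe_algebra (submetric X S) :: (('a \<Rightarrow> 'h) \<Rightarrow> ('a \<Rightarrow> 'h)) set).
      block_rank_one_ghost_projection (submetric X S) P)"
proof -
  obtain S where S: "S \<subseteq> mspace X" "ghostly_measured_asymptotic_expanders (submetric X S)"
    using assms(3) unfolding no_expander_subspace_def by blast
  obtain S' where S': "S' \<subseteq> mspace (submetric X S)" and
    *: "sparse_space (submetric (submetric X S) S') \<and>
      (\<exists>P\<in>(roe_algebra (submetric (submetric X S) S') :: (('a \<Rightarrow> 'h) \<Rightarrow> ('a \<Rightarrow> 'h)) set).
        block_rank_one_ghost_projection (submetric (submetric X S) S') P)"
    using expanders_imp_ghost_projection[OF e bounded_geometry_submetric[OF bg] S(2)] by blast
  \<comment> \<open>A subspace of the subspace \<open>S\<close> is thereby a subspace of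
    \<open>X\<close>, with the same metric.\<close>
  have "S \<inter> S' = S'" using S' by auto
  then show ?thesis using * S S' by (intro exI[of _ S']) auto
qed

lemma roe_ghost_free_iff:
  fixes X :: "'a metric"
  assumes bg: "bounded_geometry X" and inf: "infinite_dim_hilbert TYPE('h::complex_hilbert)"
  shows "roe_ghost_free TYPE('h) X \<longleftrightarrow> no_expander_subspace X"
proof
  assume free: "roe_ghost_free TYPE('h) X"
  obtain e :: 'h where "norm e = 1" using unit_vector_exists[OF inf] .
  from expander_subspace_imp_ghost_projection[OF this bg] free
  show "no_expander_subspace X" unfolding roe_ghost_free_def by blast
next
  assume "no_expander_subspace X"
  then show "roe_ghost_free TYPE('h) X"
    using ghost_projection_imp_expanders roe_algebra_subset
    unfolding no_expander_subspace_def roe_ghost_free_def by blast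
qed

text \<open>The construction is reused with the complex numbers as coefficient space and
  \<open>e = 1\<close>; by \<open>roe_algebra_subset\<close> the projection lies in the uniform Roe
  algebra.\<close>

lemma uniform_roe_ghost_free_iff:
  fixes X :: "'a metric"
  assumes bg: "bounded_geometry X"
  shows "uniform_roe_ghost_free X \<longleftrightarrow> no_expander_subspace X"
proof
  assume free: "uniform_roe_ghost_free X"
  have "norm (1::complex) = 1" by simp
  from expander_subspace_imp_ghost_projection[OF this bg] free roe_algebra_subset
  show "no_expander_subspace X"
    unfolding uniform_roe_ghost_free_def uniform_roe_algebra_def by blast
next
  assume "no_expander_subspace X"
  then show "uniform_roe_ghost_free X"
    using ghost_projection_imp_expanders
    unfolding no_expander_subspace_def uniform_roe_ghost_free_def uniform_roe_algebra_def by blast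
qed

theorem corollary3:
  fixes X :: "'a metric"
  assumes "discrete_space X" and "bounded_geometry X"
    and "separable_hilbert TYPE('h::complex_hilbert)" and "infinite_dim_hilbert TYPE('h)"
    and "infinite (UNIV :: 'z set)"
  shows "(roe_ghost_free TYPE('h) X \<longleftrightarrow> uniform_roe_ghost_free X) \<and>
         (uniform_roe_ghost_free X \<longleftrightarrow> no_expander_subspace X) \<and>
         (no_expander_subspace X \<longleftrightarrow> no_embedded_expanders TYPE('z) X) \<and>
         (\<forall>(Y::'b metric) f.
            discrete_space Y \<and> bounded_geometry Y \<and> coarse_equivalence X Y f \<longrightarrow>
              (roe_ghost_free TYPE('h) X \<longleftrightarrow> roe_ghost_free TYPE('h) Y) \<and>
              (uniform_roe_ghost_free X \<longleftrightarrow> uniform_roe_ghost_free Y) \<and>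
              (no_expander_subspace X \<longleftrightarrow> no_expander_subspace Y) \<and>
              (no_embedded_expanders TYPE('z) X \<longleftrightarrow> no_embedded_expanders TYPE('z) Y))"
proof -
  note eqX = roe_ghost_free_iff[OF assms(2,4)] uniform_roe_ghost_free_iff[OF assms(2)]
    no_embedded_expanders_iff[OF assms(2,5)]
  have "no_expander_subspace X \<longleftrightarrow> no_expander_subspace Y"
    and "roe_ghost_free TYPE('h) Y \<longleftrightarrow> no_expander_subspace Y"
    and "uniform_roe_ghost_free Y \<longleftrightarrow> no_expander_subspace Y"
    and "no_embedded_expanders TYPE('z) Y \<longleftrightarrow> no_expander_subspace Y"
    if Y: "bounded_geometry Y" "coarse_equivalence X Y f" for Y :: "'b metric" and f
  proof -
    show eqY: "roe_ghost_free TYPE('h) Y \<longleftrightarrow> no_expander_subspace Y"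
      "uniform_roe_ghost_free Y \<longleftrightarrow> no_expander_subspace Y"
      "no_embedded_expanders TYPE('z) Y \<longleftrightarrow> no_expander_subspace Y"
      using roe_ghost_free_iff[OF Y(1) assms(4)] uniform_roe_ghost_free_iff[OF Y(1)]
        no_embedded_expanders_iff[OF Y(1) assms(5)] by auto
    obtain g where "coarse_embedding Y X g" using coarse_equivalence_inverse[OF Y(2)] by blast
    \<comment> \<open>Absence of embedded expanders is inherited backwards along a coarse embedding,
      here along \<open>f\<close> and along \<open>g\<close>.\<close>
    then have "no_embedded_expanders TYPE('z) X \<longleftrightarrow> no_embedded_expanders TYPE('z) Y"
      using Y(2) no_embedded_expanders_coarse_embedding[of X Y f]
        no_embedded_expanders_coarse_embedding[of Y X g]
      unfolding coarse_equivalence_def by blast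
    then show "no_expander_subspace X \<longleftrightarrow> no_expander_subspace Y" by (simp add: eqX eqY)
  qed
  then show ?thesis using eqX by blast
qed

end
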